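(* Consider the problem $\partial_t u = Au + f(u)$, $u|_{\partial\Omega}=b$, $u(0)=u_0$, with exact solution $u(t)$, where $b$ is time-invariant. Let $A_0$ denote the linear differential operator $A$ endowed with homogeneous Dirichlet boundary conditions. Assume that $A_0$ generates a $\mathcal{C}_0$ semigroup on the Banach space $X$ (with norm $\|\cdot\|$), that $f$ is twice differentiable, and that $u(0)$ is sufficiently smooth. Let $S_\tau$ be one step, with step size $\tau>0$, of Strang splitting with the second order TDBC correction (defined in the context), and let $t_n=n\tau$. Then the local error satisfies $$\| S_{\tau}(u(t_n))-u(t_n+\tau) \| \leq C \tau^2,$$ where $C$ is independent of $\tau$. If, in addition, $A_0$ generates an analytic semigroup on $X$, then $$ S_{\tau}(u(t_n))-u(t_n+\tau) = \tau^3 A_0\overline{E} + \mathcal{O}(\tau^3), $$ where $\overline{E}$ satisfies $\| \overline{E} \| \leq C$ and $\| A_0 \overline{E} \| \leq C/\tau$ with $C$ independent of $\tau$.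
   Context: Setting. $X$ is a Banach space of functions on a domain $\Omega$, with norm $\|\cdot\|$. $A$ is a linear differential operator with smooth coefficients. $\partial\Omega$ denotes the part of the boundary of $\Omega$ on which Dirichlet conditions are imposed. The Dirichlet data $b$ do not depend on time. $A_0$ is the operator $A$ endowed with homogeneous Dirichlet boundary conditions on $\partial\Omega$. (Prototypical example: $\Omega\subset\mathbb{R}^d$ bounded with smooth boundary, $X=L^2(\Omega)$, $A=\Delta$, and $A_0$ the Laplacian with domain $H^2(\Omega)\cap H^1_0(\Omega)$.) The function $f$ is a nonlinear, non-stiff reaction on $X$, depending on $u$ but not on its derivatives, so that $f(u)|_{\partial\Omega}=f(b)$ whenever $u|_{\partial\Omega}=b$. Standing assumptions. $f$ is sufficiently smooth in a neighborhood of the exact solution, and one works in a framework of smooth data and smooth solutions. As $A$ is a differential operator with smooth coefficients, its application to the (spatially smooth) functions that occur, such as the exact solution $u(t)$ and functions obtained from it through $f$ and $A$, is well defined and bounded. In contrast, applying $A_0$ to a function requires that function to satisfy in addition homogeneous Dirichlet boundary conditions. Scheme (Strang splitting with the second order TDBC correction). For step size $\tau$: - $\varphi^f_t(w_0)=w(t)$ is the solution at time $t$ of $\partial_t w = f(w)$, $w(0)=w_0$ (no boundary conditions). - $\varphi^A_\tau(v_0)=v(\tau)$, where $v$ is the exact solution on $[0,\tau]$ of $\partial_s v = Av$, $v(0)=v_0$, with the modified time-dependent boundary condition $$v(s)|_{\partial\Omega} = \overline{V}(s) = b+\left(\tfrac{\tau}{2}-s\right)f(b), \qquad 0\le s\le\tau.$$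 This inhomogeneous boundary value problem is understood by homogenization: for a spatially smooth function $\rho(s)=\rho_0+s\rho_1$ with the prescribed boundary values, $v-\rho$ is the (mild) solution of $(v-\rho)'=A_0(v-\rho)+A\rho-\rho'$. - $S_\tau = \varphi^f_{\tau/2}\circ\varphi^A_\tau\circ\varphi^f_{\tau/2}$. Notation. $\mathcal{O}(\tau^k)$ denotes a term whose norm in $X$ is bounded by a constant times $\tau^k$, the constant being independent of $\tau$. *)

theory Defs
  imports "HOL-Analysis.Analysis"
begin

section \<open>Spatially smooth functions and differential operators\<close>

text \<open>
  Functions on the domain take values in a Euclidean space \<open>'v\<close>: this covers real- and
  complex-valued functions and systems alike. Multi-indices are lists of coordinate directions.
\<close>

primrec pderivs :: "'a::euclidean_space list \<Rightarrow> ('a \<Rightarrow> 'b::real_normed_vector) \<Rightarrow> 'a \<Rightarrow> 'b" where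
  "pderivs [] g = g"
| "pderivs (e # es) g = (\<lambda>x. frechet_derivative (pderivs es g) (at x) e)"

definition smooth_upto :: "'a::euclidean_space set \<Rightarrow> ('a \<Rightarrow> 'b::real_normed_vector) \<Rightarrow> bool" where
  "smooth_upto \<Omega> g \<longleftrightarrow>
     (\<exists>V. open V \<and> closure \<Omega> \<subseteq> V \<and>
        (\<forall>es. set es \<subseteq> Basis \<longrightarrow> pderivs es g differentiable_on V))"

definition smooth_diff_op ::
  "'a::euclidean_space set \<Rightarrow> (('a \<Rightarrow> 'v::euclidean_space) \<Rightarrow> ('a \<Rightarrow> 'v)) \<Rightarrow> bool" where
  "smooth_diff_op \<Omega> A \<longleftrightarrow>
     (\<exists>I (a :: 'a list \<Rightarrow> 'a \<Rightarrow> 'v \<Rightarrow>\<^sub>L 'v).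
        finite I \<and> (\<forall>\<alpha>\<in>I. set \<alpha> \<subseteq> Basis \<and> smooth_upto \<Omega> (a \<alpha>)) \<and>
        A = (\<lambda>g x. \<Sum>\<alpha>\<in>I. blinfun_apply (a \<alpha> x) (pderivs \<alpha> g x)))"


section \<open>Banach spaces of functions\<close>

text \<open>
  The Banach space is the whole type \<open>'x\<close>. Its elements are functions on \<open>\<Omega>\<close>, possibly up to null sets:
  \<open>Fn\<close> is the set of representing functions and \<open>cls g\<close> the element represented by \<open>g\<close>. For
  \<open>L\<^sup>2(\<Omega>)\<close>, \<open>Fn\<close> is the set of functions that are square integrable on \<open>\<Omega>\<close>
  and \<open>cls\<close> is the quotient map. The values of \<open>cls\<close> outside \<open>Fn\<close> are irrelevant.
\<close>

definition banach_function_space ::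
  "'a::euclidean_space set \<Rightarrow> ('a \<Rightarrow> 'v::euclidean_space) set \<Rightarrow> (('a \<Rightarrow> 'v) \<Rightarrow> 'x::banach) \<Rightarrow> bool" where
  "banach_function_space \<Omega> Fn cls \<longleftrightarrow>
     cls ` Fn = UNIV \<and>
     (\<forall>g\<in>Fn. \<forall>h\<in>Fn. (\<lambda>x. g x + h x) \<in> Fn \<and> cls (\<lambda>x. g x + h x) = cls g + cls h) \<and>
     (\<forall>r. \<forall>g\<in>Fn. (\<lambda>x. r *\<^sub>R g x) \<in> Fn \<and> cls (\<lambda>x. r *\<^sub>R g x) = r *\<^sub>R cls g) \<and>
     (\<forall>g\<in>Fn. \<forall>h. (\<forall>x\<in>\<Omega>. h x = g x) \<longrightarrow> h \<in> Fn \<and> cls h = cls g) \<and>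
     (\<forall>g\<in>Fn. \<forall>h\<in>Fn. cls g = cls h \<longrightarrow> (AE x in lebesgue. x \<in> \<Omega> \<longrightarrow> g x = h x))"

text \<open>
  The spatially smooth functions on which \<open>A\<close> is well defined in \<open>'x\<close>. If \<open>\<Omega>\<close> is bounded and
  \<open>'x\<close> contains every function that is smooth up to the boundary, these are all such functions.
\<close>

definition smooth_fns ::
  "'a::euclidean_space set \<Rightarrow> ('a \<Rightarrow> 'v::euclidean_space) set \<Rightarrow> (('a \<Rightarrow> 'v) \<Rightarrow> ('a \<Rightarrow> 'v)) \<Rightarrow>
   ('a \<Rightarrow> 'v) set" where
  "smooth_fns \<Omega> Fn A = {g. smooth_upto \<Omega> g \<and> g \<in> Fn \<and> A g \<in> Fn}"


section \<open>Semigroups and generators\<close>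

definition C0_semigroup :: "(real \<Rightarrow> 'x::banach \<Rightarrow>\<^sub>L 'x) \<Rightarrow> bool" where
  "C0_semigroup S \<longleftrightarrow>
     S 0 = id_blinfun \<and>
     (\<forall>s\<ge>0. \<forall>t\<ge>0. S (s + t) = S s o\<^sub>L S t) \<and>
     (\<forall>x. ((\<lambda>t. blinfun_apply (S t) x) \<longlongrightarrow> x) (at_right 0))"

text \<open>Unbounded operators are given by a domain \<open>D\<close> and a function used only on \<open>D\<close>.\<close>

definition generates :: "'x::banach set \<Rightarrow> ('x \<Rightarrow> 'x) \<Rightarrow> (real \<Rightarrow> 'x \<Rightarrow>\<^sub>L 'x) \<Rightarrow> bool" where
  "generates D B S \<longleftrightarrow>
     C0_semigroup S \<and>
     (\<forall>x. x \<in> D \<longleftrightarrow>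
        (\<exists>y. ((\<lambda>h. (1 / h) *\<^sub>R (blinfun_apply (S h) x - x)) \<longlongrightarrow> y) (at_right 0))) \<and>
     (\<forall>x\<in>D. ((\<lambda>h. (1 / h) *\<^sub>R (blinfun_apply (S h) x - x)) \<longlongrightarrow> B x) (at_right 0))"

text \<open>
  Analyticity refers to the complexification of \<open>'x\<close>, that is \<open>'x \<times> 'x\<close> with the following
  complex scaling; \<open>(x, y)\<close> stands for \<open>x + iy\<close>. The norm of the product type is equivalent to every
  norm of the complexification in common use.
\<close>

definition cscale :: "complex \<Rightarrow> 'x::real_vector \<times> 'x \<Rightarrow> 'x \<times> 'x" where
  "cscale c p = (Re c *\<^sub>R fst p - Im c *\<^sub>R snd p, Im c *\<^sub>R fst p + Re c *\<^sub>R snd p)"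

definition sector :: "real \<Rightarrow> complex set" where
  "sector \<delta> = {z. z \<noteq> 0 \<and> \<bar>Arg z\<bar> < \<delta>}"

definition analytic_semigroup :: "(real \<Rightarrow> 'x::banach \<Rightarrow>\<^sub>L 'x) \<Rightarrow> bool" where
  "analytic_semigroup S \<longleftrightarrow>
     C0_semigroup S \<and>
     (\<exists>\<delta>>0. \<delta> \<le> pi / 2 \<and>
       (\<exists>H :: complex \<Rightarrow> ('x \<times> 'x) \<Rightarrow>\<^sub>L ('x \<times> 'x).
          (\<forall>t\<ge>0. \<forall>x y. blinfun_apply (H (complex_of_real t)) (x, y) =
                          (blinfun_apply (S t) x, blinfun_apply (S t) y)) \<and>
          (\<forall>z\<in>sector \<delta>. \<forall>c p. blinfun_apply (H z) (cscale c p) = cscale c (blinfun_apply (H z) p)) \<and>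
          (\<forall>z\<in>sector \<delta>. \<forall>z'\<in>sector \<delta>. H (z + z') = H z o\<^sub>L H z') \<and>
          (\<forall>z\<in>sector \<delta>. \<forall>p. \<exists>q.
             ((\<lambda>z'. blinfun_apply (H z') p) has_derivative (\<lambda>h. cscale h q)) (at z)) \<and>
          (\<forall>p. ((\<lambda>z. blinfun_apply (H z) p) \<longlongrightarrow> p) (at 0 within sector \<delta>))))"

text \<open>
  \<open>(D, B)\<close> is \<open>A\<close> with homogeneous Dirichlet conditions on \<open>\<Gamma>\<close>: among the smooth functions, \<open>D\<close>
  contains exactly those that vanish on \<open>\<Gamma>\<close>. The choice of the non-smooth elements of \<open>D\<close>
  (such as those of \<open>H\<^sup>2(\<Omega>) \<inter> H\<^sup>1\<^sub>0(\<Omega>)\<close> for the Laplacian) is left to the function space.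
\<close>

definition dirichlet_realization ::
  "'a::euclidean_space set \<Rightarrow> 'a set \<Rightarrow> ('a \<Rightarrow> 'v::euclidean_space) set \<Rightarrow> (('a \<Rightarrow> 'v) \<Rightarrow> 'x::banach) \<Rightarrow>
   (('a \<Rightarrow> 'v) \<Rightarrow> ('a \<Rightarrow> 'v)) \<Rightarrow> 'x set \<Rightarrow> ('x \<Rightarrow> 'x) \<Rightarrow> bool" where
  "dirichlet_realization \<Omega> \<Gamma> Fn cls A D B \<longleftrightarrow>
     (\<forall>g\<in>smooth_fns \<Omega> Fn A.
        (cls g \<in> D \<longleftrightarrow> (\<forall>x\<in>\<Gamma>. g x = 0)) \<and>
        (cls g \<in> D \<longrightarrow> B (cls g) = cls (A g)))"


section \<open>Reaction and exact solution\<close>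

text \<open>
  \<open>f\<close>, considered on the set \<open>U\<close>, depends on the values of its argument but not on derivatives:
  it acts by \<open>(f u)(x) = F x (u x)\<close>.
\<close>

definition acts_pointwise ::
  "('a \<Rightarrow> 'v) set \<Rightarrow> (('a \<Rightarrow> 'v) \<Rightarrow> 'x) \<Rightarrow> 'x set \<Rightarrow> ('x \<Rightarrow> 'x) \<Rightarrow> ('a \<Rightarrow> 'v \<Rightarrow> 'v) \<Rightarrow> bool" where
  "acts_pointwise Fn cls U f F \<longleftrightarrow>
     (\<forall>g\<in>Fn. cls g \<in> U \<longrightarrow> (\<lambda>x. F x (g x)) \<in> Fn \<and> f (cls g) = cls (\<lambda>x. F x (g x)))"

definition C2_on :: "'x::real_normed_vector set \<Rightarrow> ('x \<Rightarrow> 'x) \<Rightarrow> bool" where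
  "C2_on U f \<longleftrightarrow>
     (\<exists>(f' :: 'x \<Rightarrow> 'x \<Rightarrow>\<^sub>L 'x) (f'' :: 'x \<Rightarrow> 'x \<Rightarrow>\<^sub>L ('x \<Rightarrow>\<^sub>L 'x)).
        (\<forall>x\<in>U. (f has_derivative blinfun_apply (f' x)) (at x)) \<and>
        (\<forall>x\<in>U. (f' has_derivative blinfun_apply (f'' x)) (at x)) \<and>
        continuous_on U f'')"

definition exact_solution ::
  "'a set \<Rightarrow> (('a \<Rightarrow> 'v) \<Rightarrow> 'x::banach) \<Rightarrow> (('a \<Rightarrow> 'v) \<Rightarrow> ('a \<Rightarrow> 'v)) \<Rightarrow> ('x \<Rightarrow> 'x) \<Rightarrow> ('a \<Rightarrow> 'v) \<Rightarrow>
   ('a \<Rightarrow> 'v) \<Rightarrow> real \<Rightarrow> (real \<Rightarrow> 'a \<Rightarrow> 'v) \<Rightarrow> bool" where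
  "exact_solution \<Gamma> cls A f b u0 T u \<longleftrightarrow>
     u 0 = u0 \<and>
     (\<forall>t\<in>{0..T}.
        (\<forall>x\<in>\<Gamma>. u t x = b x) \<and>
        ((\<lambda>s. cls (u s)) has_vector_derivative cls (A (u t)) + f (cls (u t))) (at t within {0..T}))"

text \<open>
  Regularity of the exact solution, as it holds for sufficiently smooth data: \<open>u\<close> is \<open>C\<^sup>2\<close> in time
  with values in \<open>'x\<close>, \<open>u(t)\<close> and \<open>f(u(t))\<close> are spatially smooth, and applying \<open>A\<close> to them is well
  defined and bounded on the time interval.
\<close>

definition smooth_framework ::
  "'a::euclidean_space set \<Rightarrow> ('a \<Rightarrow> 'v::euclidean_space) set \<Rightarrow> (('a \<Rightarrow> 'v) \<Rightarrow> 'x::banach) \<Rightarrow>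
   (('a \<Rightarrow> 'v) \<Rightarrow> ('a \<Rightarrow> 'v)) \<Rightarrow> ('a \<Rightarrow> 'v \<Rightarrow> 'v) \<Rightarrow> real \<Rightarrow> (real \<Rightarrow> 'a \<Rightarrow> 'v) \<Rightarrow> bool" where
  "smooth_framework \<Omega> Fn cls A F T u \<longleftrightarrow>
     (\<forall>t\<in>{0..T}. u t \<in> smooth_fns \<Omega> Fn A \<and> (\<lambda>x. F x (u t x)) \<in> smooth_fns \<Omega> Fn A) \<and>
     bounded ((\<lambda>t. cls (A (u t))) ` {0..T}) \<and>
     bounded ((\<lambda>t. cls (A (\<lambda>x. F x (u t x)))) ` {0..T}) \<and>
     (\<exists>u1 u2 :: real \<Rightarrow> 'x.
        (\<forall>t\<in>{0..T}. ((\<lambda>s. cls (u s)) has_vector_derivative u1 t) (at t within {0..T})) \<and>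
        (\<forall>t\<in>{0..T}. (u1 has_vector_derivative u2 t) (at t within {0..T})) \<and>
        continuous_on {0..T} u2)"


section \<open>Strang splitting with the second order boundary correction\<close>

text \<open>Solutions of the reaction equation live in the set \<open>U\<close> on which \<open>f\<close> is considered.\<close>

definition flow_f :: "'x::banach set \<Rightarrow> ('x \<Rightarrow> 'x) \<Rightarrow> real \<Rightarrow> 'x \<Rightarrow> 'x" where
  "flow_f U f t w0 =
     (THE y. \<exists>w. w 0 = w0 \<and> w t = y \<and>
        (\<forall>s\<in>{0..t}. w s \<in> U \<and> (w has_vector_derivative f (w s)) (at s within {0..t})))"

text \<open>
  \<open>v\<close> is the solution on \<open>[0, \<tau>]\<close> of \<open>v' = A v\<close>, \<open>v(0) = v0\<close>, with boundary values \<open>V(s)\<close> on \<open>\<Gamma>\<close>,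
  by homogenization with \<open>\<rho>(s) = \<rho>0 + s \<rho>1\<close>.
\<close>

definition bvp_solution ::
  "'a::euclidean_space set \<Rightarrow> 'a set \<Rightarrow> ('a \<Rightarrow> 'v::euclidean_space) set \<Rightarrow> (('a \<Rightarrow> 'v) \<Rightarrow> 'x::banach) \<Rightarrow>
   (('a \<Rightarrow> 'v) \<Rightarrow> ('a \<Rightarrow> 'v)) \<Rightarrow> (real \<Rightarrow> 'x \<Rightarrow>\<^sub>L 'x) \<Rightarrow> (real \<Rightarrow> 'a \<Rightarrow> 'v) \<Rightarrow> real \<Rightarrow> 'x \<Rightarrow>
   (real \<Rightarrow> 'x) \<Rightarrow> bool" where
  "bvp_solution \<Omega> \<Gamma> Fn cls A S V \<tau> v0 v \<longleftrightarrow>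
     (\<exists>\<rho>0\<in>smooth_fns \<Omega> Fn A. \<exists>\<rho>1\<in>smooth_fns \<Omega> Fn A.
        (\<forall>s\<in>{0..\<tau>}. \<forall>x\<in>\<Gamma>. \<rho>0 x + s *\<^sub>R \<rho>1 x = V s x) \<and>
        (\<forall>s\<in>{0..\<tau>}.
           v s - cls (\<lambda>x. \<rho>0 x + s *\<^sub>R \<rho>1 x) =
             blinfun_apply (S s) (v0 - cls \<rho>0) +
             integral {0..s} (\<lambda>r. blinfun_apply (S (s - r))
               (cls (A (\<lambda>x. \<rho>0 x + r *\<^sub>R \<rho>1 x)) - cls \<rho>1))))"

definition flow_A ::
  "'a::euclidean_space set \<Rightarrow> 'a set \<Rightarrow> ('a \<Rightarrow> 'v::euclidean_space) set \<Rightarrow> (('a \<Rightarrow> 'v) \<Rightarrow> 'x::banach) \<Rightarrow>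
   (('a \<Rightarrow> 'v) \<Rightarrow> ('a \<Rightarrow> 'v)) \<Rightarrow> (real \<Rightarrow> 'x \<Rightarrow>\<^sub>L 'x) \<Rightarrow> ('a \<Rightarrow> 'v \<Rightarrow> 'v) \<Rightarrow> ('a \<Rightarrow> 'v) \<Rightarrow> real \<Rightarrow> 'x \<Rightarrow> 'x" where
  "flow_A \<Omega> \<Gamma> Fn cls A S F b \<tau> v0 =
     (THE y. \<exists>v. bvp_solution \<Omega> \<Gamma> Fn cls A S (\<lambda>s x. b x + (\<tau> / 2 - s) *\<^sub>R F x (b x)) \<tau> v0 v \<and>
        v \<tau> = y)"

definition strang_tdbc ::
  "'a::euclidean_space set \<Rightarrow> 'a set \<Rightarrow> ('a \<Rightarrow> 'v::euclidean_space) set \<Rightarrow> (('a \<Rightarrow> 'v) \<Rightarrow> 'x::banach) \<Rightarrow>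
   (('a \<Rightarrow> 'v) \<Rightarrow> ('a \<Rightarrow> 'v)) \<Rightarrow> (real \<Rightarrow> 'x \<Rightarrow>\<^sub>L 'x) \<Rightarrow> 'x set \<Rightarrow> ('x \<Rightarrow> 'x) \<Rightarrow> ('a \<Rightarrow> 'v \<Rightarrow> 'v) \<Rightarrow>
   ('a \<Rightarrow> 'v) \<Rightarrow> real \<Rightarrow> 'x \<Rightarrow> 'x" where
  "strang_tdbc \<Omega> \<Gamma> Fn cls A S U f F b \<tau> =
     flow_f U f (\<tau> / 2) \<circ> flow_A \<Omega> \<Gamma> Fn cls A S F b \<tau> \<circ> flow_f U f (\<tau> / 2)"

end

theory Submission
  imports Defs
begin

text \<open>
  Write \<open>p = u(t\<^sub>n)\<close>, \<open>p'\<close> for its time derivative, \<open>S\<close> for the semigroup of \<open>A\<^sub>0\<close>,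
  \<open>q = f'(p) f(p)\<close> and \<open>y = f'(p) p'\<close>. Homogenizing with \<open>\<rho>(s) = p + (\<tau>/2 - s) f(p)\<close> turns the
  linear step into
  \<open>p - \<tau>/2 f(p) + S(\<tau>)(v\<^sub>0 - p - \<tau>/2 f(p)) + \<integral> S(\<tau> - r) p' + \<integral> (\<tau>/2 - r) S(\<tau> - r) A f(p)\<close>.
  Since \<open>u(t\<^sub>n + r) - p\<close> vanishes on the boundary, variation of constants also gives
  \<open>u(t\<^sub>n + \<tau>) = p + \<integral> S(\<tau> - r) p' + \<integral> r S(\<tau> - r) y + O(\<tau>\<^sup>3)\<close>. Expanding the two reaction steps, the terms
  of lower order cancel and the local error is, up to \<open>O(\<tau>\<^sup>3)\<close>,
  \<open>\<tau>\<^sup>2/8 (S(\<tau>) - 1) q + \<integral> (\<tau>/2 - r) (S(\<tau> - r) - 1) A f(p) - \<integral> r (S(\<tau> - r) - 1) y\<close>.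
  This is \<open>O(\<tau>\<^sup>2)\<close>, and it lies in the range of \<open>A\<^sub>0\<close> because \<open>(S(t) - 1) x = A\<^sub>0 \<integral>\<^sub>0\<^sup>t S(r) x\<close>;
  the preimage is \<open>O(\<tau>\<^sup>3)\<close>.
\<close>

section \<open>Smooth functions\<close>

text \<open>The obstacle: \<open>q\<close>, \<open>A f(p)\<close> and \<open>y\<close> are bounded
  but need not vanish on \<open>\<Gamma>\<close>, so \<open>S(\<tau>) - 1\<close> gains no power of
  \<open>\<tau>\<close> on them. Time averaging does gain one: the integral of \<open>S(r) x\<close>
  over \<open>[0, t]\<close> is \<open>O(t)\<close> and lies in the domain of
  \<open>A\<^sub>0\<close> for every \<open>x\<close>. Hence the defect loses an order in norm but
  not in its preimage, and the bound \<open>C / \<tau>\<close> for \<open>A\<^sub>0 E\<close> is the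
  \<open>O(\<tau>^2)\<close> bound of the defect divided by \<open>\<tau>^3\<close>. The boundary
  data enter twice. After homogenization \<open>S(\<tau>)\<close> meets only
  \<open>v0 - p - \<tau>/2 f(p)\<close>, which the first reaction step makes
  \<open>O(\<tau>^2)\<close>; and the weight \<open>\<tau>/2 - r\<close> has mean zero, which lets
  \<open>S(\<tau> - r)\<close> be replaced by \<open>S(\<tau> - r) - 1\<close>. The integral of
  \<open>S(\<tau> - r) p'\<close> is never expanded, since \<open>p'\<close> is not assumed to lie
  in the domain: it occurs in the exact and in the numerical solution and cancels. Constants do not
  depend on \<open>n\<close> because all starting times are treated at once, near the compact
  trajectory. Both subflows are definite descriptions, so existence and uniqueness must be shown for
  each.\<close>

lemma pderivs_lincomb:
  assumes "open V"
    and g: "\<And>es. set es \<subseteq> Basis \<Longrightarrow> pderivs es g differentiable_on V"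
    and h: "\<And>es. set es \<subseteq> Basis \<Longrightarrow> pderivs es h differentiable_on V"
    and "set es \<subseteq> Basis" "x \<in> V"
  shows "pderivs es (\<lambda>x. c *\<^sub>R g x + d *\<^sub>R h x) x = c *\<^sub>R pderivs es g x + d *\<^sub>R pderivs es h x"
  using \<open>set es \<subseteq> Basis\<close> \<open>x \<in> V\<close>
proof (induction es arbitrary: x)
  case (Cons e es)
  have diff: "pderivs es g differentiable (at x)" "pderivs es h differentiable (at x)"
    using g[of es] h[of es] Cons.prems differentiable_on_eq_differentiable_at[OF \<open>open V\<close>]
    by auto
  then have "(pderivs es g has_derivative frechet_derivative (pderivs es g) (at x)) (at x)"
    "(pderivs es h has_derivative frechet_derivative (pderivs es h) (at x)) (at x)"
    by (simp_all only: frechet_derivative_works)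
  then have "((\<lambda>x. c *\<^sub>R pderivs es g x + d *\<^sub>R pderivs es h x) has_derivative
    (\<lambda>v. c *\<^sub>R frechet_derivative (pderivs es g) (at x) v + d *\<^sub>R frechet_derivative (pderivs es h) (at x) v))
      (at x)"
    by (intro has_derivative_add has_derivative_scaleR_right)
  then have "(pderivs es (\<lambda>x. c *\<^sub>R g x + d *\<^sub>R h x) has_derivative
    (\<lambda>v. c *\<^sub>R frechet_derivative (pderivs es g) (at x) v + d *\<^sub>R frechet_derivative (pderivs es h) (at x) v))
      (at x)"
    by (rule has_derivative_transform_within_open[OF _ \<open>open V\<close> \<open>x \<in> V\<close>]) (use Cons in auto)
  from frechet_derivative_at[OF this, symmetric] show ?case by simp
qed simp

lemma smooth_upto_common_nbhd:
  assumes "smooth_upto \<Omega> g" "smooth_upto \<Omega> h"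
  obtains V where "open V" "closure \<Omega> \<subseteq> V"
    "\<And>es. set es \<subseteq> Basis \<Longrightarrow> pderivs es g differentiable_on V"
    "\<And>es. set es \<subseteq> Basis \<Longrightarrow> pderivs es h differentiable_on V"
proof -
  obtain V where "open V" "closure \<Omega> \<subseteq> V"
    "\<forall>es. set es \<subseteq> Basis \<longrightarrow> pderivs es g differentiable_on V"
    using assms(1) unfolding smooth_upto_def by blast
  moreover obtain W where "open W" "closure \<Omega> \<subseteq> W"
    "\<forall>es. set es \<subseteq> Basis \<longrightarrow> pderivs es h differentiable_on W"
    using assms(2) unfolding smooth_upto_def by blast
  ultimately show ?thesis
    using differentiable_on_subset[OF _ Int_lower1[of V W]] differentiable_on_subset[OF _ Int_lower2[of V W]]
    by (intro that[of "V \<inter> W"] open_Int Int_greatest) blast+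
qed

lemma smooth_upto_lincomb:
  assumes "smooth_upto \<Omega> g" "smooth_upto \<Omega> h"
  shows "smooth_upto \<Omega> (\<lambda>x. c *\<^sub>R g x + d *\<^sub>R h x)"
proof -
  obtain V where V: "open V" "closure \<Omega> \<subseteq> V"
    and g: "\<And>es. set es \<subseteq> Basis \<Longrightarrow> pderivs es g differentiable_on V"
    and h: "\<And>es. set es \<subseteq> Basis \<Longrightarrow> pderivs es h differentiable_on V"
    using smooth_upto_common_nbhd[OF assms] by blast
  have "pderivs es (\<lambda>x. c *\<^sub>R g x + d *\<^sub>R h x) differentiable_on V" if es: "set es \<subseteq> Basis" for es
  proof -
    have *: "(\<lambda>x. c *\<^sub>R pderivs es g x + d *\<^sub>R pderivs es h x) differentiable_on V"
      using g[OF es] h[OF es] by (auto intro!: derivative_intros)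
    show ?thesis
      unfolding differentiable_on_eq_differentiable_at[OF V(1)]
    proof
      fix y assume "y \<in> V"
      with * have "(\<lambda>x. c *\<^sub>R pderivs es g x + d *\<^sub>R pderivs es h x) differentiable at y"
        by (simp only: differentiable_on_eq_differentiable_at[OF V(1)])
      then obtain D where "((\<lambda>x. c *\<^sub>R pderivs es g x + d *\<^sub>R pderivs es h x) has_derivative D) (at y)"
        by (auto simp: differentiable_def)
      from has_derivative_transform_within_open[OF this V(1) \<open>y \<in> V\<close>
          pderivs_lincomb[OF V(1) g h es, symmetric]]
      show "pderivs es (\<lambda>x. c *\<^sub>R g x + d *\<^sub>R h x) differentiable at y"
        by (auto simp: differentiable_def)
    qed
  qed
  with V show ?thesis unfolding smooth_upto_def by blast
qed

text \<open>Restricted to smooth functions and to points of \<open>\<Omega>\<close>: where a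
  derivative fails to exist, \<open>frechet_derivative\<close> is an unspecified choice and
  linearity cannot be expected.\<close>

lemma smooth_diff_op_lincomb:
  assumes "smooth_diff_op \<Omega> A" "smooth_upto \<Omega> g" "smooth_upto \<Omega> h" "x \<in> \<Omega>"
  shows "A (\<lambda>x. c *\<^sub>R g x + d *\<^sub>R h x) x = c *\<^sub>R A g x + d *\<^sub>R A h x"
proof -
  obtain V where V: "open V" "closure \<Omega> \<subseteq> V"
    and g: "\<And>es. set es \<subseteq> Basis \<Longrightarrow> pderivs es g differentiable_on V"
    and h: "\<And>es. set es \<subseteq> Basis \<Longrightarrow> pderivs es h differentiable_on V"
    using smooth_upto_common_nbhd[OF assms(2,3)] by blast
  from V \<open>x \<in> \<Omega>\<close> have "x \<in> V" using closure_subset by blast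
  note eq = pderivs_lincomb[OF V(1) g h _ this]
  obtain I and a :: "'a list \<Rightarrow> 'a \<Rightarrow> 'b \<Rightarrow>\<^sub>L 'b" where I: "\<forall>\<alpha>\<in>I. set \<alpha> \<subseteq> Basis"
    and A: "A = (\<lambda>g x. \<Sum>\<alpha>\<in>I. blinfun_apply (a \<alpha> x) (pderivs \<alpha> g x))"
    using assms(1) unfolding smooth_diff_op_def by auto
  have "blinfun_apply (a \<alpha> x) (pderivs \<alpha> (\<lambda>x. c *\<^sub>R g x + d *\<^sub>R h x) x) =
      c *\<^sub>R blinfun_apply (a \<alpha> x) (pderivs \<alpha> g x) + d *\<^sub>R blinfun_apply (a \<alpha> x) (pderivs \<alpha> h x)"
    if "\<alpha> \<in> I" for \<alpha>
    using I that by (subst eq) (auto simp: blinfun.add_right blinfun.scaleR_right)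
  then show ?thesis
    by (simp add: A scaleR_sum_right sum.distrib)
qed

text \<open>The form with two coefficients covers sums, differences and multiples at once; later
  functions are written with explicit coefficients \<open>1\<close>, \<open>0\<close> or
  \<open>- 1\<close> to match it.\<close>

lemma
  assumes "banach_function_space \<Omega> Fn cls" "g \<in> Fn" "h \<in> Fn"
  shows banach_function_space_lincomb_mem: "(\<lambda>x. c *\<^sub>R g x + d *\<^sub>R h x) \<in> Fn"
    and banach_function_space_lincomb: "cls (\<lambda>x. c *\<^sub>R g x + d *\<^sub>R h x) = c *\<^sub>R cls g + d *\<^sub>R cls h"
proof -
  have add: "(\<lambda>x. g x + h x) \<in> Fn \<and> cls (\<lambda>x. g x + h x) = cls g + cls h"
    if "g \<in> Fn" "h \<in> Fn" for g h
    using assms(1) that unfolding banach_function_space_def by blast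
  have scale: "(\<lambda>x. r *\<^sub>R g x) \<in> Fn \<and> cls (\<lambda>x. r *\<^sub>R g x) = r *\<^sub>R cls g" if "g \<in> Fn" for r g
    using assms(1) that unfolding banach_function_space_def by blast
  note sc = scale[OF assms(2), of c] scale[OF assms(3), of d]
  note ad = add[OF sc(1)[THEN conjunct1] sc(2)[THEN conjunct1]]
  from ad show "(\<lambda>x. c *\<^sub>R g x + d *\<^sub>R h x) \<in> Fn" by (rule conjunct1)
  from ad sc show "cls (\<lambda>x. c *\<^sub>R g x + d *\<^sub>R h x) = c *\<^sub>R cls g + d *\<^sub>R cls h"
    by (simp only:)
qed

text \<open>Linearity of \<open>A\<close> is known on \<open>\<Omega>\<close> only. This is enough
  because \<open>cls\<close> does not distinguish functions that agree on
  \<open>\<Omega>\<close>.\<close>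

lemma
  assumes "banach_function_space \<Omega> Fn cls" "smooth_diff_op \<Omega> A"
    and "g \<in> smooth_fns \<Omega> Fn A" "h \<in> smooth_fns \<Omega> Fn A"
  shows smooth_fns_lincomb: "(\<lambda>x. c *\<^sub>R g x + d *\<^sub>R h x) \<in> smooth_fns \<Omega> Fn A"
    and smooth_fns_op_lincomb:
      "cls (A (\<lambda>x. c *\<^sub>R g x + d *\<^sub>R h x)) = c *\<^sub>R cls (A g) + d *\<^sub>R cls (A h)"
proof -
  let ?l = "\<lambda>x. c *\<^sub>R g x + d *\<^sub>R h x"
  have mem: "g \<in> Fn" "h \<in> Fn" "A g \<in> Fn" "A h \<in> Fn" "smooth_upto \<Omega> g" "smooth_upto \<Omega> h"
    using assms by (auto simp: smooth_fns_def)
  have lin: "(\<lambda>x. c *\<^sub>R A g x + d *\<^sub>R A h x) \<in> Fn"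
    using banach_function_space_lincomb_mem[OF assms(1) mem(3,4)] .
  have "\<forall>x\<in>\<Omega>. A ?l x = c *\<^sub>R A g x + d *\<^sub>R A h x"
    using smooth_diff_op_lincomb[OF assms(2) mem(5,6)] by blast
  moreover have congr: "h \<in> Fn \<and> cls h = cls g" if "g \<in> Fn" "\<forall>x\<in>\<Omega>. h x = g x" for g h
    using assms(1) that unfolding banach_function_space_def by blast
  ultimately have *: "A ?l \<in> Fn \<and> cls (A ?l) = cls (\<lambda>x. c *\<^sub>R A g x + d *\<^sub>R A h x)"
    using congr[OF lin(1)] by blast
  then show "cls (A ?l) = c *\<^sub>R cls (A g) + d *\<^sub>R cls (A h)"
    by (simp only: banach_function_space_lincomb[OF assms(1) mem(3,4)])
  show "?l \<in> smooth_fns \<Omega> Fn A"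
    using * smooth_upto_lincomb[OF mem(5,6)] banach_function_space_lincomb_mem[OF assms(1) mem(1,2)]
    by (simp add: smooth_fns_def)
qed


section \<open>Semigroups\<close>

text \<open>Strong continuity at zero bounds every orbit for short times, but bound and time span
  depend on the orbit. The closed sets \<open>C n\<close> vary both together and cover the space, so
  by Baire one of them contains a ball, on which a single bound holds for a single time
  span.\<close>

lemma C0_semigroup_bounded_near_0:
  fixes S :: "real \<Rightarrow> 'x::banach \<Rightarrow>\<^sub>L 'x"
  assumes "C0_semigroup S"
  obtains \<delta> M where "\<delta> > 0" "M \<ge> 1" "\<And>t. t \<in> {0..\<delta>} \<Longrightarrow> norm (S t) \<le> M"
proof -
  define C where "C n = {x. \<forall>t\<in>{0..inverse (real (Suc n))}. norm (S t x) \<le> real (Suc n)}" for n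
  have S0: "S 0 = id_blinfun" and lim: "((\<lambda>t. S t x) \<longlongrightarrow> x) (at_right 0)" for x
    using assms by (auto simp: C0_semigroup_def)
  have "closed (C n)" for n
    unfolding C_def Collect_ball_eq
    by (intro closed_INT ballI closed_Collect_le continuous_intros)
  moreover have "x \<in> (\<Union>n. C n)" for x
  proof -
    have "eventually (\<lambda>t. dist (S t x) x < 1) (at_right 0)"
      using lim[of x] tendstoD zero_less_one by blast
    then obtain d where d: "d > 0" "\<And>t. 0 < t \<Longrightarrow> t < d \<Longrightarrow> dist (S t x) x < 1"
      by (auto simp: eventually_at_right_field)
    obtain n where n: "inverse (real (Suc n)) < d" using d(1) reals_Archimedean by blast
    obtain m where m: "norm x + 1 \<le> real m" using real_arch_simple by blast
    define k where "k = max m n"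
    have "norm (S t x) \<le> real (Suc k)" if "t \<in> {0..inverse (real (Suc k))}" for t
    proof -
      have "norm (S t x - x) \<le> 1"
      proof (cases "t = 0")
        case False
        have le: "inverse (real (Suc k)) \<le> inverse (real (Suc n))"
          by (simp add: k_def le_imp_inverse_le)
        have "t \<le> inverse (real (Suc k))" "0 < t" using that False by auto
        with le n have "t < d" by linarith
        then show ?thesis using d(2)[of t] \<open>0 < t\<close> by (simp add: dist_norm)
      qed (simp add: S0)
      then have "norm (S t x) \<le> norm x + 1" using norm_triangle_sub[of "S t x" x] by linarith
      also have "\<dots> \<le> real (Suc k)" using m by (simp add: k_def)
      finally show ?thesis .
    qed
    then have "x \<in> C k" by (auto simp: C_def)
    then show ?thesis by blast
  qed
  then have "(\<Union>n. C n) = UNIV" by blast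
  moreover have "Met_TC.mcomplete TYPE('x)"
    by (simp add: complete_UNIV)
  ultimately obtain n where "interior (C n) \<noteq> {}"
    using Met_TC.metric_Baire_category_alt[where 'a='x, of "range C"] by fastforce
  then obtain x0 r where r: "r > 0" "cball x0 r \<subseteq> C n"
    using mem_interior_cball by (metis all_not_in_conv)
  \<comment> \<open>Both \<open>x0\<close> and \<open>x0 + y\<close> with \<open>norm y = r\<close>
    lie in \<open>C n\<close>, so \<open>norm (S t y)\<close> is at most \<open>2 * Suc n\<close>;
    scaling gives the quotient. The maximum with \<open>1\<close> keeps \<open>M\<close> positive
    for later divisions and monotonicity steps.\<close>
  define M where "M = max 1 (2 * real (Suc n) / r)"
  have "norm (S t) \<le> M" if t: "t \<in> {0..inverse (real (Suc n))}" for t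
  proof (rule norm_blinfun_bound)
    fix x
    show "norm (S t x) \<le> M * norm x"
    proof (cases "x = 0")
      case False
      define y where "y = (r / norm x) *\<^sub>R x"
      have "norm y = r" using False r by (simp add: y_def)
      then have "x0 + y \<in> C n" "x0 \<in> C n" using r by (auto simp: dist_norm)
      then have "norm (S t (x0 + y) - S t x0) \<le> real (Suc n) + real (Suc n)"
        using t unfolding C_def by (intro norm_triangle_le_diff add_mono) auto
      then have "norm (S t y) \<le> 2 * real (Suc n)" by (simp add: blinfun.bilinear_simps)
      then have "r / norm x * norm (S t x) \<le> 2 * real (Suc n)"
        using r by (simp add: y_def blinfun.bilinear_simps)
      then have "norm (S t x) \<le> (2 * real (Suc n) / r) * norm x"
        using r False by (simp add: field_simps)
      also have "\<dots> \<le> M * norm x" by (intro mult_right_mono) (auto simp: M_def)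
      finally show ?thesis .
    qed simp
  qed (simp add: M_def)
  then show ?thesis by (intro that[of "inverse (real (Suc n))" M]) (auto simp: M_def)
qed

lemma norm_integral_weight_le:
  fixes g :: "real \<Rightarrow> 'x::banach"
  assumes "0 \<le> \<tau>" "continuous_on {0..\<tau>} k" "continuous_on {0..\<tau>} g"
    and "\<And>r. r \<in> {0..\<tau>} \<Longrightarrow> \<bar>k r\<bar> \<le> \<tau>" "\<And>r. r \<in> {0..\<tau>} \<Longrightarrow> norm (g r) \<le> C"
  shows "norm (integral {0..\<tau>} (\<lambda>r. k r *\<^sub>R g r)) \<le> C * \<tau>\<^sup>2"
proof -
  have "norm (integral {0..\<tau>} (\<lambda>r. k r *\<^sub>R g r)) \<le> (\<tau> * C) * (\<tau> - 0)"
  proof (intro integral_bound continuous_on_scaleR assms)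
    fix r assume "r \<in> {0..\<tau>}"
    with assms(4,5) show "norm (k r *\<^sub>R g r) \<le> \<tau> * C"
      by (metis norm_scaleR mult_mono abs_ge_zero norm_ge_zero assms(1))
  qed
  then show ?thesis by (simp add: power2_eq_square mult_ac)
qed

text \<open>Only times up to a small step size matter, so the bound \<open>M\<close> is fixed on one
  interval \<open>{0..\<delta>}\<close> and all statements below are confined to it.\<close>

locale generated_semigroup =
  fixes D :: "'x::banach set" and B :: "'x \<Rightarrow> 'x" and S :: "real \<Rightarrow> 'x \<Rightarrow>\<^sub>L 'x"
    and \<delta> M :: real
  assumes gen: "generates D B S"
    and \<delta>_pos: "\<delta> > 0" and M_ge: "M \<ge> 1"
    and norm_S: "t \<in> {0..\<delta>} \<Longrightarrow> norm (S t) \<le> M"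
begin

lemma S_0: "S 0 x = x"
  and S_add: "0 \<le> s \<Longrightarrow> 0 \<le> t \<Longrightarrow> S (s + t) x = S s (S t x)"
  and S_tendsto: "((\<lambda>t. S t x) \<longlongrightarrow> x) (at_right 0)"
  using gen by (auto simp: generates_def C0_semigroup_def)

lemma norm_S_apply: "t \<in> {0..\<delta>} \<Longrightarrow> norm (S t x) \<le> M * norm x"
  by (meson norm_S norm_blinfun mult_right_mono norm_ge_zero order_trans)

text \<open>Splitting off the smaller time \<open>s\<close> bounds the difference at
  \<open>s\<close> and \<open>t\<close> by \<open>M * norm (S (t - s) x - x)\<close>. This depends
  on \<open>t - s\<close> only, so right continuity at zero yields uniform continuity, hence
  continuity from both sides.\<close>

lemma continuous_S: "continuous_on {0..\<delta>} (\<lambda>t. S t x)"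
proof -
  have "\<exists>d>0. \<forall>s\<in>{0..\<delta>}. \<forall>t\<in>{0..\<delta>}. dist t s < d \<longrightarrow> dist (S t x) (S s x) < e" if "e > 0" for e
  proof -
    have "eventually (\<lambda>t. dist (S t x) x < e / M) (at_right 0)"
      using S_tendsto[of x] that M_ge by (intro tendstoD) auto
    then obtain d where d: "d > 0" "\<And>t. 0 < t \<Longrightarrow> t < d \<Longrightarrow> dist (S t x) x < e / M"
      by (auto simp: eventually_at_right_field)
    have *: "dist (S t x) (S s x) < e" if "s \<in> {0..\<delta>}" "t \<in> {0..\<delta>}" "s < t" "t - s < d" for s t
    proof -
      have "S t x = S s (S (t - s) x)" using S_add[of s "t - s" x] that by simp
      then have "norm (S t x - S s x) \<le> M * norm (S (t - s) x - x)"
        using norm_S_apply[of s "S (t - s) x - x"] that by (simp add: blinfun.bilinear_simps)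
      also have "\<dots> < M * (e / M)"
        using d(2)[of "t - s"] that M_ge by (intro mult_strict_left_mono) (auto simp: dist_norm)
      finally show ?thesis using M_ge by (simp add: dist_norm)
    qed
    have "dist (S t x) (S s x) < e" if "s \<in> {0..\<delta>}" "t \<in> {0..\<delta>}" "dist t s < d" for s t
      using *[of s t] *[of t s] that \<open>e > 0\<close>
      by (cases s t rule: linorder_cases) (auto simp: dist_commute dist_real_def)
    with d(1) show ?thesis by blast
  qed
  then show ?thesis
    by (intro uniformly_continuous_imp_continuous) (simp add: uniformly_continuous_on_def)
qed

text \<open>\<open>S\<close> is continuous in the strong sense only, so the argument is frozen at
  \<open>g x\<close> first; the uniform bound \<open>M\<close> absorbs the change
  \<open>g r - g x\<close>.\<close>

lemma continuous_S_apply: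
  assumes s: "continuous_on X s" "s ` X \<subseteq> {0..\<delta>}" and g: "continuous_on X g"
  shows "continuous_on X (\<lambda>r. S (s r) (g r))"
  unfolding continuous_on_def
proof
  fix x assume x: "x \<in> X"
  have "continuous_on X (\<lambda>r. S (s r) (g x))"
    using continuous_on_compose2[OF continuous_S s] .
  then have 1: "((\<lambda>r. S (s r) (g x)) \<longlongrightarrow> S (s x) (g x)) (at x within X)"
    using x by (simp add: continuous_on_def)
  have "((\<lambda>r. S (s r) (g r - g x)) \<longlongrightarrow> 0) (at x within X)"
  proof (rule tendsto_0_le[where K = M])
    show "((\<lambda>r. g r - g x) \<longlongrightarrow> 0) (at x within X)"
      using g x by (simp add: continuous_on_def LIM_zero)
    show "\<forall>\<^sub>F r in at x within X. norm (S (s r) (g r - g x)) \<le> norm (g r - g x) * M"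
      using s(2) by (auto simp: eventually_at_filter mult.commute norm_S_apply image_subset_iff)
  qed
  from tendsto_add[OF 1 this] show "((\<lambda>r. S (s r) (g r)) \<longlongrightarrow> S (s x) (g x)) (at x within X)"
    by (simp add: blinfun.bilinear_simps)
qed

text \<open>The once integrated semigroup: of size \<open>O(t)\<close>, and mapping every vector
  into the domain of the generator.\<close>

definition H :: "real \<Rightarrow> 'x \<Rightarrow> 'x" where
  "H t x = integral {0..t} (\<lambda>r. S r x)"

lemma S_integrable: "0 \<le> a \<Longrightarrow> b \<le> \<delta> \<Longrightarrow> (\<lambda>r. S r x) integrable_on {a..b}"
  by (intro integrable_continuous_real continuous_on_subset[OF continuous_S]) auto

lemma H_vector_derivative:
  assumes "t \<in> {0..\<delta>}"
  shows "((\<lambda>t. H t x) has_vector_derivative S t x) (at t within {0..\<delta>})"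
  unfolding H_def using integral_has_vector_derivative[OF continuous_S assms] .

lemma continuous_H: "continuous_on {0..\<delta>} (\<lambda>t. H t x)"
  using H_vector_derivative has_vector_derivative_continuous
  unfolding continuous_on_eq_continuous_within by blast

lemma norm_H:
  assumes "t \<in> {0..\<delta>}"
  shows "norm (H t x) \<le> M * t * norm x"
  using assms integral_bound[of 0 t "\<lambda>r. S r x" "M * norm x"] norm_S_apply
      continuous_on_subset[OF continuous_S, of "{0..t}"]
  by (auto simp: H_def mult_ac)

lemma bounded_linear_H:
  assumes "t \<in> {0..\<delta>}"
  shows "bounded_linear (H t)"
proof (rule bounded_linear_intro[where K = "M * t"])
  show "H t (x + y) = H t x + H t y" for x y
    using assms S_integrable[of 0 t]
    by (simp add: H_def blinfun.bilinear_simps integral_add)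
  show "H t (r *\<^sub>R x) = r *\<^sub>R H t x" for r x
    by (simp add: H_def blinfun.bilinear_simps)
  show "norm (H t x) \<le> norm x * (M * t)" for x
    using norm_H[OF assms, of x] by (simp add: mult.commute)
qed

lemma S_H:
  assumes "0 \<le> h" "0 \<le> t" "t + h \<le> \<delta>"
  shows "S h (H t x) = H (t + h) x - H h x"
proof -
  have "S h (H t x) = integral {0..t} (\<lambda>r. S h (S r x))"
    unfolding H_def using assms S_integrable
    by (subst integral_blinfun_apply) auto
  also have "\<dots> = integral {0..t} (\<lambda>r. S (r + h) x)"
    using assms by (intro integral_cong) (metis S_add add.commute atLeastAtMost_iff)
  also have "\<dots> = integral {h..t + h} (\<lambda>r. S r x)"
    using integral_shift_real_ivl[where a = h and c = h and b = "t + h" and f = "\<lambda>r. S r x"] by simp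
  also have "\<dots> = H (t + h) x - H h x"
    using assms Henstock_Kurzweil_Integration.integral_combine[where a = 0 and c = h and b = "t + h" and f = "\<lambda>r. S r x"] S_integrable[of 0 "t + h" x]
    by (simp add: H_def algebra_simps)
  finally show ?thesis .
qed

lemma S_H_commute:
  assumes "0 \<le> h" "0 \<le> t" "t + h \<le> \<delta>"
  shows "S h (H t x) = H t (S h x)"
proof -
  have "S h (S r x) = S r (S h x)" if "r \<in> {0..t}" for r
    using that assms S_add[of h r x] S_add[of r h x] by (simp add: add.commute)
  moreover have "S h (H t x) = integral {0..t} (\<lambda>r. S h (S r x))"
    unfolding H_def using assms S_integrable by (subst integral_blinfun_apply) auto
  ultimately show ?thesis unfolding H_def by (metis (no_types, lifting) integral_cong)
qed

text \<open>Both sides equal \<open>H (t + h) x - H h x - H t x\<close>, which is symmetric in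
  \<open>h\<close> and \<open>t\<close>. Divided by \<open>h\<close>, the left side is the
  difference quotient of the generator at \<open>H t x\<close>, whereas the right side visibly
  converges as \<open>h\<close> tends to zero.\<close>

lemma S_minus_id_H:
  assumes "0 \<le> h" "0 \<le> t" "t + h \<le> \<delta>"
  shows "S h (H t x) - H t x = H h (S t x - x)"
proof -
  have "H h (S t x - x) = H h (S t x) - H h x"
    using assms by (intro linear_diff bounded_linear.linear bounded_linear_H) auto
  also have "\<dots> = S t (H h x) - H h x" using S_H_commute[of t h x] assms by (simp add: add.commute)
  also have "\<dots> = S h (H t x) - H t x"
    using S_H[of t h x] S_H[of h t x] assms by (simp add: add.commute)
  finally show ?thesis by simp
qed

lemma H_quotient_tendsto: "((\<lambda>h. (1 / h) *\<^sub>R H h x) \<longlongrightarrow> x) (at_right 0)"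
proof -
  have "((\<lambda>t. H t x) has_vector_derivative x) (at 0 within {0..\<delta>})"
    using H_vector_derivative[of 0 x] \<delta>_pos by (simp add: S_0)
  then have lim: "((\<lambda>h. (1 / norm (h - 0)) *\<^sub>R (H h x - (H 0 x + (h - 0) *\<^sub>R x))) \<longlongrightarrow> 0)
      (at 0 within {0..\<delta>})"
    by (simp add: has_vector_derivative_def has_derivative_within)
  have "((\<lambda>h. (1 / h) *\<^sub>R H h x - x) \<longlongrightarrow> 0) (at 0 within {0..\<delta>})"
  proof (rule tendsto_0_le[OF lim, where K = 1])
    show "\<forall>\<^sub>F h in at 0 within {0..\<delta>}. norm ((1 / h) *\<^sub>R H h x - x)
      \<le> norm ((1 / norm (h - 0)) *\<^sub>R (H h x - (H 0 x + (h - 0) *\<^sub>R x))) * 1"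
      unfolding eventually_at_filter
    proof (intro always_eventually allI impI)
      fix h :: real assume "h \<noteq> 0" "h \<in> {0..\<delta>}"
      moreover have "H 0 x = 0" by (simp add: H_def)
      ultimately show "norm ((1 / h) *\<^sub>R H h x - x)
          \<le> norm ((1 / norm (h - 0)) *\<^sub>R (H h x - (H 0 x + (h - 0) *\<^sub>R x))) * 1"
        by (simp add: scaleR_diff_right)
    qed
  qed
  then show ?thesis
    using \<delta>_pos by (simp add: at_within_Icc_at_right LIM_zero_iff)
qed

section \<open>The generator: integrals in its domain, and variation of constants\<close>

lemma eventually_at_right_lt: "c > 0 \<Longrightarrow> eventually (\<lambda>h::real. 0 < h \<and> h \<le> c) (at_right 0)"
  by (auto simp: eventually_at_right_field intro!: exI[of _ c])

lemma generator_eqI: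
  assumes "((\<lambda>h. (1 / h) *\<^sub>R (S h x - x)) \<longlongrightarrow> y) (at_right 0)"
  shows "x \<in> D" "B x = y"
proof -
  show "x \<in> D" using assms gen by (auto simp: generates_def)
  then have "((\<lambda>h. (1 / h) *\<^sub>R (S h x - x)) \<longlongrightarrow> B x) (at_right 0)"
    using gen by (auto simp: generates_def)
  from tendsto_unique[OF _ this assms] show "B x = y" by simp
qed

lemma generator_tendsto:
  "x \<in> D \<Longrightarrow> ((\<lambda>h. (1 / h) *\<^sub>R (S h x - x)) \<longlongrightarrow> B x) (at_right 0)"
  using gen by (auto simp: generates_def)

text \<open>Both sides are limits of \<open>H t ((1 / h) *\<^sub>R (S h x - x))\<close>: continuity
  of \<open>H t\<close> gives one, and the symmetry in \<open>S_minus_id_H\<close> rewrites the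
  family as \<open>(1 / h) *\<^sub>R H h (S t x - x)\<close>, which gives the other.\<close>

lemma S_minus_id_domain:
  assumes "x \<in> D" "0 \<le> t" "t < \<delta>"
  shows "S t x - x = H t (B x)"
proof (rule tendsto_unique[OF trivial_limit_at_right_real])
  have "bounded_linear (H t)" using assms by (intro bounded_linear_H) auto
  note lin = bounded_linear.linear[OF this]
  from bounded_linear.tendsto[OF \<open>bounded_linear (H t)\<close> generator_tendsto[OF assms(1)]]
  show "((\<lambda>h. H t ((1 / h) *\<^sub>R (S h x - x))) \<longlongrightarrow> H t (B x)) (at_right 0)" .
  have "\<forall>\<^sub>F h in at_right 0. (1 / h) *\<^sub>R H h (S t x - x) = H t ((1 / h) *\<^sub>R (S h x - x))"
    using eventually_at_right_lt[of "\<delta> - t"]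
  proof (rule eventually_mono)
    fix h assume "0 < h \<and> h \<le> \<delta> - t"
    then have "H h (S t x - x) = H t (S h x) - H t x"
      using assms S_minus_id_H[of h t x] S_H_commute[of h t x] by simp
    then show "(1 / h) *\<^sub>R H h (S t x - x) = H t ((1 / h) *\<^sub>R (S h x - x))"
      by (simp only: linear_diff[OF lin] linear_scale[OF lin])
  qed (use assms in simp)
  from Lim_transform_eventually[OF H_quotient_tendsto this]
  show "((\<lambda>h. H t ((1 / h) *\<^sub>R (S h x - x))) \<longlongrightarrow> S t x - x) (at_right 0)" .
qed

text \<open>The generator passes under the integral because the difference quotient at
  \<open>W\<close> equals \<open>(1 / h) *\<^sub>R H h Y\<close> exactly, \<open>Y\<close> being the
  claimed value: the bounded operators \<open>S h\<close> and \<open>H h\<close> commute with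
  integration, and \<open>S_minus_id_H\<close> matches the integrands.\<close>

lemma
  fixes k :: "real \<Rightarrow> real" and x :: 'x
  assumes "0 \<le> \<tau>" "\<tau> < \<delta>" "continuous_on {0..\<tau>} k"
  defines "W \<equiv> integral {0..\<tau>} (\<lambda>r. k r *\<^sub>R H (\<tau> - r) x)"
  shows integral_H_domain: "W \<in> D"
    and generator_integral_H: "B W = integral {0..\<tau>} (\<lambda>r. k r *\<^sub>R (S (\<tau> - r) x - x))"
proof -
  let ?Y = "integral {0..\<tau>} (\<lambda>r. k r *\<^sub>R (S (\<tau> - r) x - x))"
  have contH: "continuous_on {0..\<tau>} (\<lambda>r. k r *\<^sub>R H (\<tau> - r) x)"
    using assms(1,2) by (intro continuous_on_scaleR assms(3) continuous_on_compose2[OF continuous_H]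
        continuous_on_diff continuous_on_const continuous_on_id) auto
  have contS: "continuous_on {0..\<tau>} (\<lambda>r. k r *\<^sub>R (S (\<tau> - r) x - x))"
    using assms(1,2) by (intro continuous_on_scaleR assms(3) continuous_S_apply
        continuous_on_diff continuous_on_const continuous_on_id) auto
  have "(1 / h) *\<^sub>R H h ?Y = (1 / h) *\<^sub>R (S h W - W)" if h: "0 < h" "h \<le> \<delta> - \<tau>" for h
  proof -
    have bl: "bounded_linear (H h)" using h assms by (intro bounded_linear_H) auto
    note lin = bounded_linear.linear[OF bl]
    have "H h ?Y = integral {0..\<tau>} (\<lambda>r. H h (k r *\<^sub>R (S (\<tau> - r) x - x)))"
      using integral_linear[OF integrable_continuous_real[OF contS] bl] by (simp add: o_def)
    also have "\<dots> = integral {0..\<tau>} (\<lambda>r. S h (k r *\<^sub>R H (\<tau> - r) x) - k r *\<^sub>R H (\<tau> - r) x)"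
    proof (rule integral_cong)
      fix r assume "r \<in> {0..\<tau>}"
      then have "H h (S (\<tau> - r) x - x) = S h (H (\<tau> - r) x) - H (\<tau> - r) x"
        using h assms(1,2) by (subst S_minus_id_H) auto
      then show "H h (k r *\<^sub>R (S (\<tau> - r) x - x)) = S h (k r *\<^sub>R H (\<tau> - r) x) - k r *\<^sub>R H (\<tau> - r) x"
        by (simp only: linear_scale[OF lin] blinfun.scaleR_right scaleR_diff_right[symmetric])
    qed
    also have "\<dots> = integral {0..\<tau>} (\<lambda>r. S h (k r *\<^sub>R H (\<tau> - r) x)) - W"
      unfolding W_def
      by (intro integral_diff integrable_continuous_real contH
          bounded_linear.continuous_on[OF blinfun.bounded_linear_right])
    also have "integral {0..\<tau>} (\<lambda>r. S h (k r *\<^sub>R H (\<tau> - r) x)) = S h W"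
      unfolding W_def by (intro integral_blinfun_apply integrable_continuous_real contH)
    finally show ?thesis by simp
  qed
  then have "\<forall>\<^sub>F h in at_right 0. (1 / h) *\<^sub>R H h ?Y = (1 / h) *\<^sub>R (S h W - W)"
    using eventually_at_right_lt[of "\<delta> - \<tau>"] assms(2) by (auto elim: eventually_mono)
  from Lim_transform_eventually[OF H_quotient_tendsto this]
  have "((\<lambda>h. (1 / h) *\<^sub>R (S h W - W)) \<longlongrightarrow> ?Y) (at_right 0)" .
  from generator_eqI[OF this] show "W \<in> D" "B W = ?Y" .
qed

text \<open>On the domain \<open>S t x = x + H t (B x)\<close>, so the derivative is inherited from
  \<open>H\<close>, one-sided at the end points of the interval.\<close>

lemma S_reverse_vector_derivative:
  assumes "x \<in> D" "\<tau> < \<delta>" "r \<in> {0..\<tau>}"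
  shows "((\<lambda>r. S (\<tau> - r) x) has_vector_derivative - S (\<tau> - r) (B x)) (at r within {0..\<tau>})"
proof -
  have "((\<lambda>t. H t (B x)) has_vector_derivative S (\<tau> - r) (B x))
     (at (\<tau> - r) within (\<lambda>r. \<tau> - r) ` {0..\<tau>})"
    using assms
    by (intro has_vector_derivative_within_subset[OF H_vector_derivative]) auto
  then have "(((\<lambda>t. H t (B x)) \<circ> (\<lambda>r. \<tau> - r)) has_vector_derivative (- 1) *\<^sub>R S (\<tau> - r) (B x))
      (at r within {0..\<tau>})"
    by (intro vector_diff_chain_within) (auto intro!: derivative_eq_intros)
  then have "((\<lambda>r. x + H (\<tau> - r) (B x)) has_vector_derivative - S (\<tau> - r) (B x)) (at r within {0..\<tau>})"
    by (auto intro!: derivative_eq_intros simp: o_def)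
  then show ?thesis
    by (rule has_vector_derivative_transform[rotated 2])
      (use assms S_minus_id_domain[OF assms(1)] in \<open>auto simp: algebra_simps\<close>)
qed

text \<open>\<open>S (\<tau> - r) z(r)\<close> has the derivative \<open>S (\<tau> - r) (z'(r) - B z(r))\<close>.\<close>

lemma variation_of_constants:
  assumes "0 \<le> \<tau>" "\<tau> < \<delta>"
    and D: "\<And>r. r \<in> {0..\<tau>} \<Longrightarrow> z r \<in> D"
    and z': "\<And>r. r \<in> {0..\<tau>} \<Longrightarrow> (z has_vector_derivative z' r) (at r within {0..\<tau>})"
  shows "((\<lambda>r. S (\<tau> - r) (z' r - B (z r))) has_integral z \<tau> - S \<tau> (z 0)) {0..\<tau>}"
proof -
  have "((\<lambda>r. S (\<tau> - r) (z r)) has_vector_derivative S (\<tau> - r) (z' r - B (z r))) (at r within {0..\<tau>})"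
    if r: "r \<in> {0..\<tau>}" for r
  proof -
    let ?F = "at r within {0..\<tau>}"
    \<comment> \<open>A product rule with only strong continuity of \<open>S\<close>:
      \<open>z s\<close> is split into its first order remainder at \<open>r\<close>, the fixed
      vector \<open>z r\<close> and the linear part \<open>(s - r) *\<^sub>R z' r\<close>. The
      uniform bound on \<open>S\<close> makes the remainder harmless.\<close>
    have "((\<lambda>s. S (\<tau> - s) (z s - z r - (s - r) *\<^sub>R z' r)) has_derivative (\<lambda>_. 0)) ?F"
      unfolding has_derivative_within
    proof (rule conjI[OF bounded_linear_zero tendsto_0_le[where K = M]])
      show "((\<lambda>s. (1 / norm (s - r)) *\<^sub>R (z s - (z r + (s - r) *\<^sub>R z' r))) \<longlongrightarrow> 0) ?F"
        using z'[OF r] by (simp add: has_vector_derivative_def has_derivative_within)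
      show "\<forall>\<^sub>F s in ?F. norm ((1 / norm (s - r)) *\<^sub>R (S (\<tau> - s) (z s - z r - (s - r) *\<^sub>R z' r) -
          (S (\<tau> - r) (z r - z r - (r - r) *\<^sub>R z' r) + 0)))
        \<le> norm ((1 / norm (s - r)) *\<^sub>R (z s - (z r + (s - r) *\<^sub>R z' r))) * M"
        unfolding eventually_at_filter
      proof (intro always_eventually allI impI)
        fix s assume "s \<in> {0..\<tau>}"
        define c where "c = 1 / norm (s - r)"
        have "norm (S (\<tau> - s) (c *\<^sub>R (z s - (z r + (s - r) *\<^sub>R z' r))))
          \<le> M * norm (c *\<^sub>R (z s - (z r + (s - r) *\<^sub>R z' r)))"
          using \<open>s \<in> {0..\<tau>}\<close> assms(1,2) by (intro norm_S_apply) auto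
        then show "norm (c *\<^sub>R (S (\<tau> - s) (z s - z r - (s - r) *\<^sub>R z' r) -
            (S (\<tau> - r) (z r - z r - (r - r) *\<^sub>R z' r) + 0)))
          \<le> norm (c *\<^sub>R (z s - (z r + (s - r) *\<^sub>R z' r))) * M"
          by (simp only: diff_self blinfun.zero_right scaleR_zero_left diff_zero add_0 diff_diff_eq
              blinfun.scaleR_right mult.commute)
      qed
    qed
    moreover have "((\<lambda>s. S (\<tau> - s) (z r)) has_vector_derivative - S (\<tau> - r) (B (z r))) ?F"
      using S_reverse_vector_derivative[OF D[OF r] assms(2) r] .
    \<comment> \<open>\<open>z' r\<close> may lie outside the domain, so its orbit need not be
      differentiable; the factor \<open>s - r\<close> makes continuity of the orbit
      sufficient.\<close>
    moreover have "((\<lambda>s. (s - r) *\<^sub>R S (\<tau> - s) (z' r)) has_derivative (\<lambda>h. h *\<^sub>R S (\<tau> - r) (z' r))) ?F"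
      unfolding has_derivative_within
    proof (rule conjI[OF bounded_linear_scaleR_left tendsto_0_le[where K = 1]])
      have "continuous_on {0..\<tau>} (\<lambda>s. S (\<tau> - s) (z' r))"
        using assms(1,2)
        by (intro continuous_S_apply continuous_on_diff continuous_on_const continuous_on_id) auto
      then show "((\<lambda>s. S (\<tau> - s) (z' r) - S (\<tau> - r) (z' r)) \<longlongrightarrow> 0) ?F"
        using r by (simp add: continuous_on_def LIM_zero)
      show "\<forall>\<^sub>F s in ?F. norm ((1 / norm (s - r)) *\<^sub>R ((s - r) *\<^sub>R S (\<tau> - s) (z' r) -
          ((r - r) *\<^sub>R S (\<tau> - r) (z' r) + (s - r) *\<^sub>R S (\<tau> - r) (z' r))))
        \<le> norm (S (\<tau> - s) (z' r) - S (\<tau> - r) (z' r)) * 1"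
        by (auto simp: eventually_at_filter scaleR_diff_right[symmetric])
    qed
    ultimately have "((\<lambda>s. S (\<tau> - s) (z s - z r - (s - r) *\<^sub>R z' r) + S (\<tau> - s) (z r) +
        (s - r) *\<^sub>R S (\<tau> - s) (z' r))
      has_vector_derivative 0 + - S (\<tau> - r) (B (z r)) + S (\<tau> - r) (z' r)) ?F"
      by (intro has_vector_derivative_add) (simp_all add: has_vector_derivative_def)
    then show ?thesis by (simp add: blinfun.bilinear_simps)
  qed
  from fundamental_theorem_of_calculus[OF assms(1) this]
  show ?thesis by (simp add: S_0)
qed

lemma S_reflect_has_integral:
  assumes "0 \<le> \<tau>" "\<tau> \<le> \<delta>"
  shows "((\<lambda>r. S (\<tau> - r) x) has_integral H \<tau> x) {0..\<tau>}"
proof -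
  have "((\<lambda>r. - H (\<tau> - r) x) has_vector_derivative S (\<tau> - r) x) (at r within {0..\<tau>})"
    if "r \<in> {0..\<tau>}" for r
  proof -
    have "((\<lambda>t. H t x) has_vector_derivative S (\<tau> - r) x) (at (\<tau> - r) within (\<lambda>r. \<tau> - r) ` {0..\<tau>})"
      using assms that
      by (intro has_vector_derivative_within_subset[OF H_vector_derivative]) auto
    then have "(((\<lambda>t. H t x) \<circ> (\<lambda>r. \<tau> - r)) has_vector_derivative (- 1) *\<^sub>R S (\<tau> - r) x)
        (at r within {0..\<tau>})"
      by (intro vector_diff_chain_within) (auto intro!: derivative_eq_intros)
    from has_vector_derivative_minus[OF this] show ?thesis by (simp add: o_def)
  qed
  from fundamental_theorem_of_calculus[OF assms(1) this]
  show ?thesis by (simp add: H_def)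
qed

lemma continuous_S_reflect:
  assumes "\<tau> \<le> \<delta>" "continuous_on {0..\<tau>} g"
  shows "continuous_on {0..\<tau>} (\<lambda>r. S (\<tau> - r) (g r))"
  using assms
  by (intro continuous_S_apply continuous_on_diff continuous_on_const continuous_on_id) auto

lemma S_reflect_integrable:
  assumes "\<tau> \<le> \<delta>" "continuous_on {0..\<tau>} g"
  shows "(\<lambda>r. S (\<tau> - r) (g r)) integrable_on {0..\<tau>}"
  using continuous_S_reflect[OF assms] by (rule integrable_continuous_real)

lemma norm_integral_S_reflect:
  assumes "0 \<le> \<tau>" "\<tau> \<le> \<delta>" "continuous_on {0..\<tau>} g" "\<And>r. r \<in> {0..\<tau>} \<Longrightarrow> norm (g r) \<le> C"
  shows "norm (integral {0..\<tau>} (\<lambda>r. S (\<tau> - r) (g r))) \<le> M * C * \<tau>"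
proof -
  have "norm (integral {0..\<tau>} (\<lambda>r. S (\<tau> - r) (g r))) \<le> M * C * (\<tau> - 0)"
  proof (rule integral_bound[OF assms(1) continuous_S_reflect[OF assms(2,3)]])
    fix r assume r: "r \<in> {0..\<tau>}"
    have "norm (S (\<tau> - r) (g r)) \<le> M * norm (g r)" using r assms(2) by (intro norm_S_apply) auto
    also have "\<dots> \<le> M * C" using assms(4)[OF r] M_ge by (intro mult_left_mono) auto
    finally show "norm (S (\<tau> - r) (g r)) \<le> M * C" .
  qed
  then show ?thesis by simp
qed

section \<open>Weighted integrals of the semigroup and the leading part of the local error\<close>

definition wint :: "(real \<Rightarrow> real) \<Rightarrow> real \<Rightarrow> 'x \<Rightarrow> 'x" where
  "wint k \<tau> x = integral {0..\<tau>} (\<lambda>r. k r *\<^sub>R S (\<tau> - r) x)"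

lemma wint_minus_id:
  assumes "\<tau> \<le> \<delta>" "continuous_on {0..\<tau>} k" "(k has_integral c) {0..\<tau>}"
  shows "integral {0..\<tau>} (\<lambda>r. k r *\<^sub>R (S (\<tau> - r) x - x)) = wint k \<tau> x - c *\<^sub>R x"
proof -
  have "((\<lambda>r. k r *\<^sub>R x) has_integral c *\<^sub>R x) {0..\<tau>}"
    using has_integral_scaleR_left[OF assms(3)] .
  moreover have "((\<lambda>r. k r *\<^sub>R S (\<tau> - r) x) has_integral wint k \<tau> x) {0..\<tau>}"
    unfolding wint_def
    by (intro integrable_integral integrable_continuous_real continuous_on_scaleR assms
        continuous_S_reflect continuous_on_const)
  ultimately show ?thesis
    by (intro integral_unique) (simp add: scaleR_diff_right has_integral_diff)
qed

lemma
  assumes "0 \<le> t" "t < \<delta>"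
  shows H_domain: "H t x \<in> D" and generator_H: "B (H t x) = S t x - x"
proof -
  have "\<forall>\<^sub>F h in at_right 0. (1 / h) *\<^sub>R H h (S t x - x) = (1 / h) *\<^sub>R (S h (H t x) - H t x)"
    using eventually_at_right_lt[of "\<delta> - t"]
    by (rule eventually_mono) (use assms S_minus_id_H[of _ t x] in auto)
  from Lim_transform_eventually[OF H_quotient_tendsto this]
  have "((\<lambda>h. (1 / h) *\<^sub>R (S h (H t x) - H t x)) \<longlongrightarrow> S t x - x) (at_right 0)" .
  from generator_eqI[OF this] show "H t x \<in> D" "B (H t x) = S t x - x" .
qed

lemma
  assumes "x \<in> D" "y \<in> D"
  shows domain_lincomb: "c *\<^sub>R x + d *\<^sub>R y \<in> D"
    and generator_lincomb: "B (c *\<^sub>R x + d *\<^sub>R y) = c *\<^sub>R B x + d *\<^sub>R B y"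
proof -
  have "((\<lambda>h. c *\<^sub>R ((1 / h) *\<^sub>R (S h x - x)) + d *\<^sub>R ((1 / h) *\<^sub>R (S h y - y))) \<longlongrightarrow>
      c *\<^sub>R B x + d *\<^sub>R B y) (at_right 0)"
    using assms by (intro tendsto_intros generator_tendsto)
  moreover have "(\<lambda>h. c *\<^sub>R ((1 / h) *\<^sub>R (S h x - x)) + d *\<^sub>R ((1 / h) *\<^sub>R (S h y - y))) =
      (\<lambda>h. (1 / h) *\<^sub>R (S h (c *\<^sub>R x + d *\<^sub>R y) - (c *\<^sub>R x + d *\<^sub>R y)))"
    by (simp add: fun_eq_iff blinfun.add_right blinfun.scaleR_right algebra_simps)
  ultimately have "((\<lambda>h. (1 / h) *\<^sub>R (S h (c *\<^sub>R x + d *\<^sub>R y) - (c *\<^sub>R x + d *\<^sub>R y))) \<longlongrightarrow>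
      c *\<^sub>R B x + d *\<^sub>R B y) (at_right 0)"
    by simp
  from generator_eqI[OF this] show "c *\<^sub>R x + d *\<^sub>R y \<in> D"
    "B (c *\<^sub>R x + d *\<^sub>R y) = c *\<^sub>R B x + d *\<^sub>R B y" .
qed

text \<open>The leading part of the local error, up to terms of third order.\<close>

definition defect :: "real \<Rightarrow> 'x \<Rightarrow> 'x \<Rightarrow> 'x \<Rightarrow> 'x" where
  "defect \<tau> q a y = (\<tau>\<^sup>2 / 8) *\<^sub>R (S \<tau> q - q) + wint (\<lambda>r. \<tau> / 2 - r) \<tau> a +
     ((\<tau>\<^sup>2 / 2) *\<^sub>R y - wint (\<lambda>r. r) \<tau> y)"

text \<open>Each of the three terms carries some \<open>S t - id\<close> on a bounded vector, which
  gives the first bound. Replacing \<open>S t - id\<close> by \<open>H t\<close> gives a preimage,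
  and \<open>norm (H t x)\<close> is smaller by a factor of order \<open>\<tau>\<close>. The factor
  \<open>3\<close> counts the terms, \<open>N\<close> bounds the three vectors together.\<close>

lemma defect_in_range:
  assumes \<tau>: "0 < \<tau>" "\<tau> < \<delta>" and N: "norm q \<le> N" "norm a \<le> N" "norm y \<le> N"
  shows "norm (defect \<tau> q a y) \<le> 3 * (M + 1) * N * \<tau>\<^sup>2"
    and "\<exists>E\<in>D. \<tau> ^ 3 *\<^sub>R B E = defect \<tau> q a y \<and> norm E \<le> 3 * M * N"
proof -
  let ?k1 = "\<lambda>r. \<tau> / 2 - r" and ?k2 = "\<lambda>r::real. r"
  have ck: "continuous_on {0..\<tau>} ?k1" "continuous_on {0..\<tau>} ?k2"
    by (intro continuous_intros)+
  have "N \<ge> 0" using N(1) norm_ge_zero order_trans by blast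
  have Sx: "norm (S t x - x) \<le> (M + 1) * N" if "norm x \<le> N" "t \<in> {0..\<tau>}" for t x
  proof -
    have "norm (S t x) \<le> M * norm x" using \<tau> that by (intro norm_S_apply) auto
    also have "\<dots> \<le> M * N" using that M_ge by (intro mult_left_mono) auto
    finally show ?thesis using norm_triangle_ineq4[of "S t x" x] that by (simp add: algebra_simps)
  qed
  have Hx: "norm (H t x) \<le> M * N * \<tau>" if "norm x \<le> N" "t \<in> {0..\<tau>}" for t x
  proof -
    have "norm (H t x) \<le> (M * t) * norm x" using \<tau> that by (intro norm_H) auto
    also have "\<dots> \<le> (M * \<tau>) * N" using that M_ge \<tau> by (intro mult_mono) auto
    finally show ?thesis by (simp add: mult_ac)
  qed
  have Hxr: "norm (H (\<tau> - r) x) \<le> M * N * \<tau>" "norm (S (\<tau> - r) x - x) \<le> (M + 1) * N"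
    if "norm x \<le> N" "r \<in> {0..\<tau>}" for r x
    using that Hx[of x "\<tau> - r"] Sx[of x "\<tau> - r"] by auto
  have cH: "continuous_on {0..\<tau>} (\<lambda>r. H (\<tau> - r) x)" for x
    using \<tau> by (intro continuous_on_compose2[OF continuous_H] continuous_intros) auto
  have cS: "continuous_on {0..\<tau>} (\<lambda>r. S (\<tau> - r) x - x)" for x
    using \<tau> by (intro continuous_on_diff continuous_S_reflect continuous_on_const) auto
  \<comment> \<open>The mean of the weight vanishes because the boundary correction is centred at
    half the step; thus subtracting \<open>a\<close> inside the integral costs nothing. The weight
    \<open>r\<close> has integral \<open>\<tau>^2 / 2\<close>, exactly the multiple of
    \<open>y\<close> contained in \<open>defect\<close>.\<close>
  have k1: "(?k1 has_integral 0) {0..\<tau>}"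
  proof -
    have "(?k1 has_integral (\<tau> / 2 * \<tau> - \<tau>\<^sup>2 / 2) - (\<tau> / 2 * 0 - 0\<^sup>2 / 2)) {0..\<tau>}"
      using \<tau> by (intro fundamental_theorem_of_calculus)
        (auto intro!: derivative_eq_intros simp: has_real_derivative_iff_has_vector_derivative[symmetric])
    then show ?thesis by (simp add: power2_eq_square)
  qed
  have k2: "(?k2 has_integral \<tau>\<^sup>2 / 2) {0..\<tau>}"
    using ident_has_integral[of 0 \<tau>] \<tau> by simp
  define I1 where "I1 = integral {0..\<tau>} (\<lambda>r. ?k1 r *\<^sub>R (S (\<tau> - r) a - a))"
  define I2 where "I2 = integral {0..\<tau>} (\<lambda>r. ?k2 r *\<^sub>R (S (\<tau> - r) y - y))"
  define W1 where "W1 = integral {0..\<tau>} (\<lambda>r. ?k1 r *\<^sub>R H (\<tau> - r) a)"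
  define W2 where "W2 = integral {0..\<tau>} (\<lambda>r. ?k2 r *\<^sub>R H (\<tau> - r) y)"
  have "I1 = wint ?k1 \<tau> a - 0 *\<^sub>R a" "I2 = wint ?k2 \<tau> y - (\<tau>\<^sup>2 / 2) *\<^sub>R y"
    unfolding I1_def I2_def using \<tau> by (intro wint_minus_id k1 k2 ck; simp)+
  then have defect: "defect \<tau> q a y = (\<tau>\<^sup>2 / 8) *\<^sub>R (S \<tau> q - q) + I1 - I2"
    by (simp add: defect_def)
  have W: "W1 \<in> D" "B W1 = I1" "W2 \<in> D" "B W2 = I2"
    unfolding W1_def W2_def I1_def I2_def using \<tau> ck integral_H_domain generator_integral_H
    by auto
  have abs: "\<bar>?k1 r\<bar> \<le> \<tau>" "\<bar>?k2 r\<bar> \<le> \<tau>" if "r \<in> {0..\<tau>}" for r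
    using that by auto
  have I: "norm I1 \<le> (M + 1) * N * \<tau>\<^sup>2" "norm I2 \<le> (M + 1) * N * \<tau>\<^sup>2"
    unfolding I1_def I2_def using \<tau>
    by (intro norm_integral_weight_le ck cS abs Hxr N; simp)+
  have nW: "norm W1 \<le> M * N * \<tau> * \<tau>\<^sup>2" "norm W2 \<le> M * N * \<tau> * \<tau>\<^sup>2"
    unfolding W1_def W2_def using \<tau>
    by (intro norm_integral_weight_le ck cH abs Hxr N; simp)+
  have "norm ((\<tau>\<^sup>2 / 8) *\<^sub>R (S \<tau> q - q)) \<le> (\<tau>\<^sup>2 / 8) * ((M + 1) * N)"
    using Sx[OF N(1), of \<tau>] \<tau> by (auto intro!: mult_left_mono)
  also have "\<dots> \<le> \<tau>\<^sup>2 * ((M + 1) * N)"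
    using \<open>N \<ge> 0\<close> M_ge by (intro mult_right_mono) auto
  finally have "norm ((\<tau>\<^sup>2 / 8) *\<^sub>R (S \<tau> q - q)) \<le> (M + 1) * N * \<tau>\<^sup>2" by (simp add: mult_ac)
  then show "norm (defect \<tau> q a y) \<le> 3 * (M + 1) * N * \<tau>\<^sup>2"
    unfolding defect
    using norm_triangle_ineq4[of "(\<tau>\<^sup>2 / 8) *\<^sub>R (S \<tau> q - q) + I1" I2]
      norm_triangle_ineq[of "(\<tau>\<^sup>2 / 8) *\<^sub>R (S \<tau> q - q)" I1] I
    by linarith
  \<comment> \<open>The preimage of the defect before division by \<open>\<tau> ^ 3\<close>. The
    trivial coefficients here and in \<open>?E\<close> only fit the two-coefficient form of
    \<open>generator_lincomb\<close>.\<close>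
  define E0 where "E0 = (\<tau>\<^sup>2 / 8) *\<^sub>R H \<tau> q + 1 *\<^sub>R (1 *\<^sub>R W1 + (- 1) *\<^sub>R W2)"
  have Hq: "H \<tau> q \<in> D" "B (H \<tau> q) = S \<tau> q - q" using \<tau> H_domain generator_H by auto
  have "E0 \<in> D" unfolding E0_def by (intro domain_lincomb Hq W)
  have "B E0 = defect \<tau> q a y"
    unfolding E0_def by (simp only: generator_lincomb domain_lincomb Hq W) (simp add: defect)
  have "norm ((\<tau>\<^sup>2 / 8) *\<^sub>R H \<tau> q) \<le> (\<tau>\<^sup>2 / 8) * (M * N * \<tau>)"
    using Hx[OF N(1), of \<tau>] \<tau> by (auto intro!: mult_left_mono)
  also have "\<dots> \<le> \<tau>\<^sup>2 * (M * N * \<tau>)"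
    using \<open>N \<ge> 0\<close> M_ge \<tau> by (intro mult_right_mono) auto
  finally have "norm ((\<tau>\<^sup>2 / 8) *\<^sub>R H \<tau> q) \<le> M * N * \<tau> * \<tau>\<^sup>2" by (simp add: mult_ac)
  then have E0: "norm E0 \<le> 3 * (M * N * \<tau> * \<tau>\<^sup>2)"
    using norm_triangle_ineq[of "(\<tau>\<^sup>2 / 8) *\<^sub>R H \<tau> q" "W1 - W2"] norm_triangle_ineq4[of W1 W2] nW
    unfolding E0_def by simp
  let ?E = "(1 / \<tau> ^ 3) *\<^sub>R E0 + 0 *\<^sub>R E0"
  show "\<exists>E\<in>D. \<tau> ^ 3 *\<^sub>R B E = defect \<tau> q a y \<and> norm E \<le> 3 * M * N"
  proof (intro bexI conjI)
    show "?E \<in> D" by (intro domain_lincomb \<open>E0 \<in> D\<close>)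
    show "\<tau> ^ 3 *\<^sub>R B ?E = defect \<tau> q a y"
      using \<tau> \<open>B E0 = _\<close> by (simp only: generator_lincomb[OF \<open>E0 \<in> D\<close> \<open>E0 \<in> D\<close>]) simp
    show "norm ?E \<le> 3 * M * N"
      using E0 \<tau> by (simp add: field_simps power3_eq_cube power2_eq_square)
  qed
qed

end


section \<open>Bounds that are uniform in time\<close>

text \<open>Both constants are chosen before the starting time \<open>t\<close>, so with
  \<open>t = n * \<tau>\<close> they cannot depend on \<open>n\<close>.\<close>

definition uniform_O :: "real \<Rightarrow> nat \<Rightarrow> (real \<Rightarrow> real \<Rightarrow> 'x::real_normed_vector) \<Rightarrow> bool" where
  "uniform_O T k g \<longleftrightarrow> (\<exists>C. \<exists>\<tau>\<^sub>0>0. \<forall>t \<tau>. 0 \<le> t \<and> 0 < \<tau> \<and> \<tau> \<le> \<tau>\<^sub>0 \<and> t + \<tau> \<le> T \<longrightarrow>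
     norm (g t \<tau>) \<le> C * \<tau> ^ k)"

lemma uniform_OI:
  assumes "\<tau>\<^sub>0 > 0"
    "\<And>t \<tau>. 0 \<le> t \<Longrightarrow> 0 < \<tau> \<Longrightarrow> \<tau> \<le> \<tau>\<^sub>0 \<Longrightarrow> t + \<tau> \<le> T \<Longrightarrow> norm (g t \<tau>) \<le> C * \<tau> ^ k"
  shows "uniform_O T k g"
  unfolding uniform_O_def using assms by (intro exI[of _ C] exI[of _ \<tau>\<^sub>0]) simp

lemma uniform_OE:
  assumes "uniform_O T k g"
  obtains C \<tau>\<^sub>0 where "C \<ge> 0" "\<tau>\<^sub>0 > 0"
    "\<And>t \<tau>. 0 \<le> t \<Longrightarrow> 0 < \<tau> \<Longrightarrow> \<tau> \<le> \<tau>\<^sub>0 \<Longrightarrow> t + \<tau> \<le> T \<Longrightarrow> norm (g t \<tau>) \<le> C * \<tau> ^ k"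
proof -
  obtain C \<tau>\<^sub>0 where C: "\<tau>\<^sub>0 > 0"
    "\<And>t \<tau>. 0 \<le> t \<Longrightarrow> 0 < \<tau> \<Longrightarrow> \<tau> \<le> \<tau>\<^sub>0 \<Longrightarrow> t + \<tau> \<le> T \<Longrightarrow> norm (g t \<tau>) \<le> C * \<tau> ^ k"
    using assms unfolding uniform_O_def by blast
  have "norm (g t \<tau>) \<le> max C 0 * \<tau> ^ k" if "0 \<le> t" "0 < \<tau>" "\<tau> \<le> \<tau>\<^sub>0" "t + \<tau> \<le> T" for t \<tau>
  proof -
    have "C * \<tau> ^ k \<le> max C 0 * \<tau> ^ k" using that by (intro mult_right_mono) auto
    then show ?thesis using C(2)[OF that] by linarith
  qed
  with C(1) show ?thesis by (intro that[of "max C 0" \<tau>\<^sub>0]) auto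
qed

lemma uniform_O_add:
  assumes "uniform_O T k g" "uniform_O T k h"
  shows "uniform_O T k (\<lambda>t \<tau>. g t \<tau> + h t \<tau>)"
proof -
  obtain C \<tau>\<^sub>1 where "C \<ge> 0" and C: "\<tau>\<^sub>1 > 0"
    "\<And>t \<tau>. 0 \<le> t \<Longrightarrow> 0 < \<tau> \<Longrightarrow> \<tau> \<le> \<tau>\<^sub>1 \<Longrightarrow> t + \<tau> \<le> T \<Longrightarrow> norm (g t \<tau>) \<le> C * \<tau> ^ k"
    using uniform_OE[OF assms(1)] by blast
  obtain D \<tau>\<^sub>2 where "D \<ge> 0" and D: "\<tau>\<^sub>2 > 0"
    "\<And>t \<tau>. 0 \<le> t \<Longrightarrow> 0 < \<tau> \<Longrightarrow> \<tau> \<le> \<tau>\<^sub>2 \<Longrightarrow> t + \<tau> \<le> T \<Longrightarrow> norm (h t \<tau>) \<le> D * \<tau> ^ k"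
    using uniform_OE[OF assms(2)] by blast
  show ?thesis
  proof (rule uniform_OI)
    show "min \<tau>\<^sub>1 \<tau>\<^sub>2 > 0" using C(1) D(1) by simp
    show "norm (g t \<tau> + h t \<tau>) \<le> (C + D) * \<tau> ^ k"
      if "0 \<le> t" "0 < \<tau>" "\<tau> \<le> min \<tau>\<^sub>1 \<tau>\<^sub>2" "t + \<tau> \<le> T" for t \<tau>
      using norm_triangle_mono[OF C(2) D(2), of t \<tau> t \<tau>] that by (simp add: distrib_right)
  qed
qed

lemma uniform_O_minus: "uniform_O T k g \<Longrightarrow> uniform_O T k (\<lambda>t \<tau>. - g t \<tau>)"
  by (simp add: uniform_O_def)

lemma uniform_O_diff:
  assumes "uniform_O T k g" "uniform_O T k h"
  shows "uniform_O T k (\<lambda>t \<tau>. g t \<tau> - h t \<tau>)"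
  using uniform_O_add[OF assms(1) uniform_O_minus[OF assms(2)]] by simp

lemma uniform_O_mono:
  assumes "uniform_O T k g" "j \<le> k"
  shows "uniform_O T j g"
proof -
  obtain C \<tau>\<^sub>0 where C: "C \<ge> 0" "\<tau>\<^sub>0 > 0"
    "\<And>t \<tau>. 0 \<le> t \<Longrightarrow> 0 < \<tau> \<Longrightarrow> \<tau> \<le> \<tau>\<^sub>0 \<Longrightarrow> t + \<tau> \<le> T \<Longrightarrow> norm (g t \<tau>) \<le> C * \<tau> ^ k"
    using uniform_OE[OF assms(1)] by blast
  show ?thesis
  proof (rule uniform_OI)
    show "min \<tau>\<^sub>0 1 > 0" using C(2) by simp
    fix t \<tau> :: real assume that: "0 \<le> t" "0 < \<tau>" "\<tau> \<le> min \<tau>\<^sub>0 1" "t + \<tau> \<le> T"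
    then have "C * \<tau> ^ k \<le> C * \<tau> ^ j"
      using C(1) assms(2) by (intro mult_left_mono power_decreasing) auto
    then show "norm (g t \<tau>) \<le> C * \<tau> ^ j" using C(3)[of t \<tau>] that by simp
  qed
qed

lemma uniform_O_eq:
  assumes "uniform_O T k g" "\<tau>\<^sub>1 > 0"
    "\<And>t \<tau>. 0 \<le> t \<Longrightarrow> 0 < \<tau> \<Longrightarrow> \<tau> \<le> \<tau>\<^sub>1 \<Longrightarrow> t + \<tau> \<le> T \<Longrightarrow> h t \<tau> = g t \<tau>"
  shows "uniform_O T k h"
proof -
  obtain C \<tau>\<^sub>0 where C: "C \<ge> 0" "\<tau>\<^sub>0 > 0"
    "\<And>t \<tau>. 0 \<le> t \<Longrightarrow> 0 < \<tau> \<Longrightarrow> \<tau> \<le> \<tau>\<^sub>0 \<Longrightarrow> t + \<tau> \<le> T \<Longrightarrow> norm (g t \<tau>) \<le> C * \<tau> ^ k"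
    using uniform_OE[OF assms(1)] by blast
  show ?thesis
    by (rule uniform_OI[of "min \<tau>\<^sub>0 \<tau>\<^sub>1" _ _ C]) (use C assms(2,3) in auto)
qed

text \<open>Orders add under products. The domination form serves scalar multiples, operators
  applied to vectors and quadratic Taylor remainders alike.\<close>

lemma uniform_O_dominated:
  assumes "uniform_O T j g" "uniform_O T k h" "n = j + k" "\<tau>\<^sub>0 > 0"
    and dom: "\<And>t \<tau>. 0 \<le> t \<Longrightarrow> 0 < \<tau> \<Longrightarrow> \<tau> \<le> \<tau>\<^sub>0 \<Longrightarrow> t + \<tau> \<le> T \<Longrightarrow>
      norm (f t \<tau>) \<le> c * (norm (g t \<tau>) * norm (h t \<tau>))"
    and "c \<ge> 0"
  shows "uniform_O T n f"
proof -
  obtain C \<tau>\<^sub>1 where C: "C \<ge> 0" "\<tau>\<^sub>1 > 0"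
    "\<And>t \<tau>. 0 \<le> t \<Longrightarrow> 0 < \<tau> \<Longrightarrow> \<tau> \<le> \<tau>\<^sub>1 \<Longrightarrow> t + \<tau> \<le> T \<Longrightarrow> norm (g t \<tau>) \<le> C * \<tau> ^ j"
    using uniform_OE[OF assms(1)] by blast
  obtain D \<tau>\<^sub>2 where D: "D \<ge> 0" "\<tau>\<^sub>2 > 0"
    "\<And>t \<tau>. 0 \<le> t \<Longrightarrow> 0 < \<tau> \<Longrightarrow> \<tau> \<le> \<tau>\<^sub>2 \<Longrightarrow> t + \<tau> \<le> T \<Longrightarrow> norm (h t \<tau>) \<le> D * \<tau> ^ k"
    using uniform_OE[OF assms(2)] by blast
  show ?thesis
  proof (rule uniform_OI)
    show "min \<tau>\<^sub>0 (min \<tau>\<^sub>1 \<tau>\<^sub>2) > 0" using C(2) D(2) assms(4) by simp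
    fix t \<tau> assume that: "0 \<le> t" "0 < \<tau>" "\<tau> \<le> min \<tau>\<^sub>0 (min \<tau>\<^sub>1 \<tau>\<^sub>2)" "t + \<tau> \<le> T"
    then have "norm (f t \<tau>) \<le> c * (norm (g t \<tau>) * norm (h t \<tau>))" by (intro dom) auto
    also have "\<dots> \<le> c * ((C * \<tau> ^ j) * (D * \<tau> ^ k))"
      using that C D \<open>c \<ge> 0\<close> by (intro mult_left_mono mult_mono C(3) D(3)) auto
    finally show "norm (f t \<tau>) \<le> c * C * D * \<tau> ^ n"
      by (simp add: assms(3) power_add mult_ac)
  qed
qed

lemma uniform_O_scaleR:
  assumes "uniform_O T j c" "uniform_O T k g" "n = j + k"
  shows "uniform_O T n (\<lambda>t \<tau>. c t \<tau> *\<^sub>R g t \<tau>)"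
  by (rule uniform_O_dominated[OF assms, of 1 _ 1]) auto

lemma uniform_O_blinfun_apply:
  assumes "uniform_O T j L" "uniform_O T k g" "n = j + k"
  shows "uniform_O T n (\<lambda>t \<tau>. blinfun_apply (L t \<tau>) (g t \<tau>))"
  by (rule uniform_O_dominated[OF assms, of 1 _ 1]) (auto intro: norm_blinfun)

lemma uniform_O_monomial: "uniform_O T k (\<lambda>t \<tau>. c * \<tau> ^ k :: real)"
  by (rule uniform_OI[of 1 _ _ "\<bar>c\<bar>"]) (auto simp: abs_mult)


section \<open>The reaction flow\<close>

definition solves_ode :: "'x::banach set \<Rightarrow> ('x \<Rightarrow> 'x) \<Rightarrow> real \<Rightarrow> 'x \<Rightarrow> (real \<Rightarrow> 'x) \<Rightarrow> bool" where
  "solves_ode U f t w0 w \<longleftrightarrow> w 0 = w0 \<and>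
     (\<forall>s\<in>{0..t}. w s \<in> U \<and> (w has_vector_derivative f (w s)) (at s within {0..t}))"

lemma flow_f_eqI:
  assumes "solves_ode U f t w0 w" and "\<And>w'. solves_ode U f t w0 w' \<Longrightarrow> w' t = w t"
  shows "flow_f U f t w0 = w t"
  unfolding flow_f_def
proof (rule the_equality)
  show "\<exists>w'. w' 0 = w0 \<and> w' t = w t \<and>
      (\<forall>s\<in>{0..t}. w' s \<in> U \<and> (w' has_vector_derivative f (w' s)) (at s within {0..t}))"
    using assms(1) unfolding solves_ode_def by blast
  show "y = w t" if "\<exists>w. w 0 = w0 \<and> w t = y \<and>
      (\<forall>s\<in>{0..t}. w s \<in> U \<and> (w has_vector_derivative f (w s)) (at s within {0..t}))" for y
    using that assms(2) unfolding solves_ode_def by blast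
qed

text \<open>At a point \<open>m\<close> where the difference \<open>g\<close> of the solutions is
  largest on \<open>J\<close>, the mean value inequality gives
  \<open>norm (g m) \<le> L * d * norm (g m)\<close>; with \<open>L * d \<le> 1 / 2\<close> the
  maximum is zero. The argument works on both sides of \<open>s0\<close>.\<close>

lemma ode_local_uniqueness:
  fixes w1 w2 :: "real \<Rightarrow> 'x::banach"
  assumes "\<epsilon> > 0" "L \<ge> 0"
    and lip: "\<And>x y. x \<in> ball p \<epsilon> \<Longrightarrow> y \<in> ball p \<epsilon> \<Longrightarrow> norm (f x - f y) \<le> L * norm (x - y)"
    and w1: "\<And>s. s \<in> {0..t} \<Longrightarrow> (w1 has_vector_derivative f (w1 s)) (at s within {0..t})"
    and w2: "\<And>s. s \<in> {0..t} \<Longrightarrow> (w2 has_vector_derivative f (w2 s)) (at s within {0..t})"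
    and s0: "s0 \<in> {0..t}" "w1 s0 = p" "w2 s0 = p"
  obtains d where "d > 0" "\<And>s. s \<in> {0..t} \<Longrightarrow> dist s s0 < d \<Longrightarrow> w1 s = w2 s"
proof -
  have "(w1 \<longlongrightarrow> p) (at s0 within {0..t})" "(w2 \<longlongrightarrow> p) (at s0 within {0..t})"
    using has_vector_derivative_continuous[OF w1[OF s0(1)]] has_vector_derivative_continuous[OF w2[OF s0(1)]]
    by (simp_all add: continuous_within s0)
  then have "\<forall>\<^sub>F s in at s0 within {0..t}. dist (w1 s) p < \<epsilon> \<and> dist (w2 s) p < \<epsilon>"
    using \<open>\<epsilon> > 0\<close> by (intro eventually_conj tendstoD)
  then obtain d1 where d1: "d1 > 0"
    "\<And>s. s \<in> {0..t} \<Longrightarrow> s \<noteq> s0 \<Longrightarrow> dist s s0 < d1 \<Longrightarrow> dist (w1 s) p < \<epsilon> \<and> dist (w2 s) p < \<epsilon>"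
    unfolding eventually_at by blast
  \<comment> \<open>Half of \<open>d1\<close> keeps the closed interval \<open>J\<close> inside the
    range where both solutions stay in the ball; the second term ensures
    \<open>L * d \<le> 1 / 2\<close>, also for \<open>L = 0\<close>.\<close>
  define d where "d = min (d1 / 2) (1 / (2 * (L + 1)))"
  have d: "d > 0" "d < d1" "L * d \<le> 1 / 2"
  proof -
    show "d > 0" "d < d1" using d1(1) \<open>L \<ge> 0\<close> by (auto simp: d_def)
    have "L * d \<le> L * (1 / (2 * (L + 1)))" using \<open>L \<ge> 0\<close> by (intro mult_left_mono) (auto simp: d_def)
    also have "\<dots> \<le> 1 / 2" using \<open>L \<ge> 0\<close> by (simp add: field_simps)
    finally show "L * d \<le> 1 / 2" .
  qed
  define J where "J = {0..t} \<inter> cball s0 d"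
  have J: "J = {max 0 (s0 - d)..min t (s0 + d)}"
    by (auto simp: J_def cball_eq_atLeastAtMost)
  have near: "w1 s \<in> ball p \<epsilon>" "w2 s \<in> ball p \<epsilon>" if "s \<in> J" for s
    using d1(2)[of s] that s0 \<open>\<epsilon> > 0\<close> d by (cases "s = s0"; auto simp: J_def dist_commute)+
  define g where "g s = w1 s - w2 s" for s
  have g': "(g has_vector_derivative f (w1 s) - f (w2 s)) (at s within J)" if "s \<in> J" for s
    unfolding g_def using that
    by (intro has_vector_derivative_diff has_vector_derivative_within_subset[OF w1]
        has_vector_derivative_within_subset[OF w2]) (auto simp: J_def)
  have "continuous_on J (\<lambda>s. norm (g s))"
    using has_vector_derivative_continuous[OF g']
    by (intro continuous_on_norm) (simp add: continuous_on_eq_continuous_within)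
  moreover have "compact J" "s0 \<in> J" "convex J" using s0 d by (auto simp: J) 
  ultimately obtain m where m: "m \<in> J" "\<And>s. s \<in> J \<Longrightarrow> norm (g s) \<le> norm (g m)"
    using continuous_attains_sup[of J "\<lambda>s. norm (g s)"] by blast
  have "norm (g m - g s0) \<le> (L * norm (g m)) * norm (m - s0)"
  proof (rule differentiable_bound[OF \<open>convex J\<close> _ _ \<open>m \<in> J\<close> \<open>s0 \<in> J\<close>])
    fix s assume s: "s \<in> J"
    show "(g has_derivative (\<lambda>h. h *\<^sub>R (f (w1 s) - f (w2 s)))) (at s within J)"
      using g'[OF s] by (simp add: has_vector_derivative_def)
    have "norm (f (w1 s) - f (w2 s)) \<le> L * norm (g s)"
      using lip[OF near[OF s]] by (simp add: g_def)
    also have "\<dots> \<le> L * norm (g m)" using m(2)[OF s] \<open>L \<ge> 0\<close> by (rule mult_left_mono)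
    finally show "onorm (\<lambda>h. h *\<^sub>R (f (w1 s) - f (w2 s))) \<le> L * norm (g m)"
      by (simp add: onorm_scaleR_left onorm_id)
  qed
  also have "\<dots> \<le> (L * norm (g m)) * d"
    using m(1) \<open>L \<ge> 0\<close> by (intro mult_left_mono) (auto simp: J_def dist_norm norm_minus_commute)
  also have "\<dots> = (L * d) * norm (g m)" by simp
  also have "\<dots> \<le> (1 / 2) * norm (g m)" using d(3) by (intro mult_right_mono) auto
  finally have "norm (g m) \<le> 0" using s0 by (simp add: g_def)
  then have "g s = 0" if "s \<in> J" for s using m(2)[OF that] by simp
  then show ?thesis
    using d(1) by (intro that[of d]) (auto simp: g_def J_def dist_commute)
qed

text \<open>\<open>flow_f\<close> admits every solution with values in \<open>U\<close>, where no
  global Lipschitz constant is available. The set of times of agreement is closed by continuity and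
  open by local uniqueness, so connectedness of the interval finishes.\<close>

lemma ode_uniqueness:
  fixes f :: "'x::banach \<Rightarrow> 'x"
  assumes lip: "\<And>p. p \<in> U \<Longrightarrow> \<exists>\<epsilon>>0. \<exists>L\<ge>0. \<forall>x\<in>ball p \<epsilon>. \<forall>y\<in>ball p \<epsilon>. norm (f x - f y) \<le> L * norm (x - y)"
    and w1: "solves_ode U f t w0 w1" and w2: "solves_ode U f t w0 w2" and "0 \<le> t"
  shows "w1 t = w2 t"
proof -
  define Z where "Z = {s \<in> {0..t}. w1 s = w2 s}"
  have d: "(w1 has_vector_derivative f (w1 s)) (at s within {0..t})"
    "(w2 has_vector_derivative f (w2 s)) (at s within {0..t})" "w1 s \<in> U" if "s \<in> {0..t}" for s
    using w1 w2 that by (auto simp: solves_ode_def)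
  have cont: "continuous_on {0..t} w1" "continuous_on {0..t} w2"
    using d has_vector_derivative_continuous unfolding continuous_on_eq_continuous_within by blast+
  have "closedin (top_of_set {0..t}) Z"
  proof -
    have "closedin (top_of_set {0..t}) ({0..t} \<inter> (\<lambda>s. w1 s - w2 s) -` {0})"
      by (intro continuous_closedin_preimage continuous_on_diff cont) auto
    moreover have "{0..t} \<inter> (\<lambda>s. w1 s - w2 s) -` {0} = Z" by (auto simp: Z_def)
    ultimately show ?thesis by simp
  qed
  moreover have "openin (top_of_set {0..t}) Z"
    unfolding openin_euclidean_subtopology_iff
  proof (intro conjI ballI)
    fix s0 assume s0: "s0 \<in> Z"
    then have "w1 s0 \<in> U" using d(3)[of s0] by (auto simp: Z_def)
    then obtain \<epsilon> L where el: "\<epsilon> > 0" "L \<ge> 0"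
      "\<And>x y. x \<in> ball (w1 s0) \<epsilon> \<Longrightarrow> y \<in> ball (w1 s0) \<epsilon> \<Longrightarrow> norm (f x - f y) \<le> L * norm (x - y)"
      using lip[OF \<open>w1 s0 \<in> U\<close>] by blast
    from s0 have "s0 \<in> {0..t}" "w2 s0 = w1 s0" by (auto simp: Z_def)
    from ode_local_uniqueness[OF el d(1,2) this(1) refl this(2)]
    obtain e where "e > 0" "\<And>s. s \<in> {0..t} \<Longrightarrow> dist s s0 < e \<Longrightarrow> w1 s = w2 s" by blast
    then show "\<exists>e>0. \<forall>x'\<in>{0..t}. dist x' s0 < e \<longrightarrow> x' \<in> Z" by (auto simp: Z_def)
  qed (auto simp: Z_def)
  moreover have "0 \<in> Z" using w1 w2 \<open>0 \<le> t\<close> by (auto simp: Z_def solves_ode_def)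
  ultimately have "Z = {0..t}"
    using connected_clopen[of "{0..t}"] by auto
  with \<open>0 \<le> t\<close> have "t \<in> Z" by simp
  then show ?thesis by (simp add: Z_def)
qed

text \<open>Picard iteration: \<open>t * M \<le> r\<close> keeps the iterates in the ball and
  \<open>t * M \<le> 1 / 2\<close> makes the map a contraction with factor one half. A single
  \<open>M\<close> bounds both \<open>f\<close> and its Lipschitz constant.\<close>

lemma ode_existence:
  fixes f :: "'x::banach \<Rightarrow> 'x"
  assumes lip: "\<And>x y. x \<in> cball w0 r \<Longrightarrow> y \<in> cball w0 r \<Longrightarrow> norm (f x - f y) \<le> M * norm (x - y)"
    and bnd: "\<And>x. x \<in> cball w0 r \<Longrightarrow> norm (f x) \<le> M"
    and "0 \<le> t" "t * M \<le> r" "t * M \<le> 1 / 2" "0 \<le> M" "r > 0"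
  obtains w where "solves_ode (cball w0 r) f t w0 w"
proof -
  define S where "S = PiC (UNIV::real set) (\<lambda>_. cball w0 r)"
  have S_iff: "w \<in> S \<longleftrightarrow> (\<forall>s. apply_bcontfun w s \<in> cball w0 r)" for w
    by (auto simp: S_def mem_PiC_iff)
  \<comment> \<open>The fixed point is sought among bounded continuous functions on the whole line.
    Clamping time to \<open>{0..t}\<close> extends each iterate by constants, so that it stays in
    this complete space.\<close>
  define c where "c = clamp 0 t"
  have c: "c s \<in> {0..t}" "s \<in> {0..t} \<Longrightarrow> c s = s" for s
    using clamp_in_interval[of 0 t s] clamp_cancel_cbox[of s 0 t] \<open>0 \<le> t\<close> by (auto simp: c_def)
  have lipf: "continuous_on (cball w0 r) f"
  proof (rule continuous_on_subset)
    have "M-lipschitz_on (cball w0 r) f"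
      using lip \<open>0 \<le> M\<close> by (intro lipschitz_onI) (auto simp: dist_norm)
    then show "continuous_on (cball w0 r) f" by (rule lipschitz_on_continuous_on)
  qed simp
  have cont: "continuous_on X (\<lambda>s. f (apply_bcontfun w s))" if "w \<in> S" for w X
    using that by (intro continuous_on_compose2[OF lipf]) (auto simp: S_iff)
  have fb: "norm (f (apply_bcontfun w s)) \<le> M" if "w \<in> S" for w s
    using that bnd unfolding S_iff by blast
  define P :: "(real \<Rightarrow>\<^sub>C 'x) \<Rightarrow> real \<Rightarrow> 'x" where "P w = (\<lambda>s. w0 + integral {0..s} (\<lambda>r. f (apply_bcontfun w r)))" for w
  have P': "(P w has_vector_derivative f (apply_bcontfun w s)) (at s within {0..t})"
    if "w \<in> S" "s \<in> {0..t}" for w s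
    unfolding P_def
    using has_vector_derivative_add[OF has_vector_derivative_const
        integral_has_vector_derivative[OF cont[OF that(1)] that(2)]]
    by simp
  have "\<exists>v. \<forall>s. apply_bcontfun v s = P w (c s)" if w: "w \<in> S" for w
  proof -
    have "continuous_on (cbox 0 t) (P w)"
      using P'[OF w] has_vector_derivative_continuous
      unfolding continuous_on_eq_continuous_within box_real by blast
    then obtain v where "\<And>s. apply_bcontfun v s = P w (clamp 0 t s)"
      by (rule continuous_on_cbox_bcontfunE) blast
    then show ?thesis unfolding c_def by blast
  qed
  then obtain Q where Q: "\<And>w s. w \<in> S \<Longrightarrow> apply_bcontfun (Q w) s = P w (c s)"
    by metis
  have "\<exists>!w\<in>S. Q w = w"
  proof (rule Banach_fix)
    show "complete S" unfolding S_def complete_eq_closed by (intro closed_PiC) auto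
    have "const_bcontfun w0 \<in> S" using \<open>r > 0\<close> by (auto simp: S_iff)
    then show "S \<noteq> {}" by blast
    show "Q ` S \<subseteq> S"
    proof safe
      fix w assume w: "w \<in> S"
      have "norm (integral {0..c s} (\<lambda>r. f (apply_bcontfun w r))) \<le> r" for s
      proof -
        have "norm (integral {0..c s} (\<lambda>r. f (apply_bcontfun w r))) \<le> M * (c s - 0)"
          using c(1)[of s] by (intro integral_bound cont w fb) auto
        also have "\<dots> \<le> M * t" using c(1)[of s] \<open>0 \<le> M\<close> by (intro mult_left_mono) auto
        finally show ?thesis using assms(4) by (simp add: mult.commute)
      qed
      then show "Q w \<in> S"
        unfolding S_iff by (simp add: Q[OF w] P_def dist_norm)
    qed
    show "dist (Q w) (Q v) \<le> 1 / 2 * dist w v" if wv: "w \<in> S" "v \<in> S" for w v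
    proof (rule dist_bound)
      fix s
      let ?i = "\<lambda>r. f (apply_bcontfun w r) - f (apply_bcontfun v r)"
      have "dist (apply_bcontfun (Q w) s) (apply_bcontfun (Q v) s) = norm (integral {0..c s} ?i)"
        by (simp add: Q wv P_def dist_norm integral_diff integrable_continuous_real cont)
      also have "\<dots> \<le> (M * dist w v) * (c s - 0)"
      proof (intro integral_bound continuous_on_diff cont wv)
        fix x
        have "norm (?i x) \<le> M * dist (apply_bcontfun w x) (apply_bcontfun v x)"
          using lip wv unfolding S_iff dist_norm by blast
        also have "\<dots> \<le> M * dist w v" using \<open>0 \<le> M\<close> dist_bounded by (intro mult_left_mono) auto
        finally show "norm (?i x) \<le> M * dist w v" .
      qed (use c(1) in auto)
      also have "\<dots> \<le> (M * dist w v) * t"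
        using c(1)[of s] \<open>0 \<le> M\<close> by (intro mult_left_mono) auto
      also have "\<dots> = (t * M) * dist w v" by simp
      also have "\<dots> \<le> 1 / 2 * dist w v" using assms(5) by (intro mult_right_mono) auto
      finally show "dist (apply_bcontfun (Q w) s) (apply_bcontfun (Q v) s) \<le> 1 / 2 * dist w v" .
    qed
  qed auto
  then obtain w where w: "w \<in> S" "Q w = w" by blast
  have eq: "apply_bcontfun w s = P w s" if "s \<in> {0..t}" for s
    using Q[OF w(1), of s] w(2) c(2)[OF that] by simp
  have "(apply_bcontfun w has_vector_derivative f (apply_bcontfun w s)) (at s within {0..t})"
    if "s \<in> {0..t}" for s
    using has_vector_derivative_transform[OF that eq P'[OF w(1) that]] .
  moreover have "apply_bcontfun w 0 = w0" using eq[of 0] \<open>0 \<le> t\<close> by (simp add: P_def)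
  ultimately have "solves_ode (cball w0 r) f t w0 (apply_bcontfun w)"
    using w(1) by (auto simp: solves_ode_def S_iff)
  then show ?thesis by (rule that)
qed

lemma vector_derivative_bound:
  fixes g :: "real \<Rightarrow> 'x::real_normed_vector"
  assumes "\<And>s. s \<in> {a..b} \<Longrightarrow> (g has_vector_derivative g' s) (at s within {a..b})"
    and "\<And>s. s \<in> {a..b} \<Longrightarrow> norm (g' s) \<le> B"
    and "x \<in> {a..b}" "y \<in> {a..b}"
  shows "norm (g x - g y) \<le> B * \<bar>x - y\<bar>"
proof -
  have "norm (g x - g y) \<le> B * norm (x - y)"
    using assms
    by (intro differentiable_bound[where S = "{a..b}" and f' = "\<lambda>s h. h *\<^sub>R g' s"])
      (auto simp: has_vector_derivative_def onorm_scaleR_left onorm_id)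
  then show ?thesis by simp
qed

text \<open>Continuity alone bounds nothing on a ball of an infinite-dimensional space; compactness
  of \<open>K\<close> does. The open set \<open>G\<close>, where the sum \<open>N\<close> of the
  three norms stays below its bound on \<open>K\<close> plus one, contains \<open>K\<close> and
  hence balls of one radius about all its points. The bound on \<open>f''\<close> becomes the
  Lipschitz bound for \<open>f'\<close> on these convex balls.\<close>

lemma C2_on_uniform_nbhd:
  fixes f :: "'x::real_normed_vector \<Rightarrow> 'x"
  assumes "open U" "C2_on U f" "compact K" "K \<subseteq> U"
  obtains f' r M where "r > 0" "M \<ge> 1"
    "\<And>p. p \<in> K \<Longrightarrow> cball p r \<subseteq> U"
    "\<And>x. x \<in> U \<Longrightarrow> (f has_derivative blinfun_apply (f' x)) (at x)"
    "continuous_on U f'"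
    "\<And>p x. p \<in> K \<Longrightarrow> x \<in> cball p r \<Longrightarrow> norm (f x) \<le> M"
    "\<And>p x. p \<in> K \<Longrightarrow> x \<in> cball p r \<Longrightarrow> norm (f' x) \<le> M"
    "\<And>p x y. p \<in> K \<Longrightarrow> x \<in> cball p r \<Longrightarrow> y \<in> cball p r \<Longrightarrow> norm (f' x - f' y) \<le> M * norm (x - y)"
proof -
  obtain f' :: "'x \<Rightarrow> 'x \<Rightarrow>\<^sub>L 'x" and f'' :: "'x \<Rightarrow> 'x \<Rightarrow>\<^sub>L ('x \<Rightarrow>\<^sub>L 'x)" where
    f': "\<forall>x\<in>U. (f has_derivative blinfun_apply (f' x)) (at x)" and
    f'': "\<forall>x\<in>U. (f' has_derivative blinfun_apply (f'' x)) (at x)" and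
    cf'': "continuous_on U f''"
    using assms(2) unfolding C2_on_def by auto
  have cf: "continuous_on U f" and cf': "continuous_on U f'"
    by (intro continuous_at_imp_continuous_on ballI has_derivative_continuous; use f' f'' in blast)+
  define N where "N x = norm (f x) + norm (f' x) + norm (f'' x)" for x
  have cN: "continuous_on U N"
    unfolding N_def by (intro continuous_intros cf cf' cf'')
  have "bounded (N ` K)"
    by (intro compact_imp_bounded compact_continuous_image continuous_on_subset[OF cN] assms)
  then obtain B where B: "B > 0" "\<And>x. x \<in> K \<Longrightarrow> norm (N x) \<le> B"
    by (auto simp: bounded_pos)
  define G where "G = {x \<in> U. N x < B + 1}"
  have "G = U \<inter> N -` {..<B + 1}" by (auto simp: G_def)
  then have "open G" using cN \<open>open U\<close> continuous_open_preimage by (metis open_lessThan)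
  moreover have "K \<subseteq> G"
  proof
    fix x assume "x \<in> K"
    with B(2)[OF this] show "x \<in> G" using \<open>K \<subseteq> U\<close> by (auto simp: G_def)
  qed
  ultimately obtain e where e: "e > 0" "(\<Union>x\<in>K. cball x e) \<subseteq> G"
    using compact_subset_open_imp_cball_epsilon_subset[OF \<open>compact K\<close>] by blast
  have sub: "x \<in> U" "N x < B + 1" if "p \<in> K" "x \<in> cball p e" for p x
  proof -
    have "x \<in> G" using e(2) that by blast
    then show "x \<in> U" "N x < B + 1" by (auto simp: G_def)
  qed
  show ?thesis
  proof (rule that[of e "B + 1" f'])
    show "norm (f x) \<le> B + 1" "norm (f' x) \<le> B + 1" if "p \<in> K" "x \<in> cball p e" for p x
      using sub(2)[OF that] norm_ge_zero[of "f x"] norm_ge_zero[of "f' x"] norm_ge_zero[of "f'' x"]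
      unfolding N_def by linarith+
    show "norm (f' x - f' y) \<le> (B + 1) * norm (x - y)"
      if p: "p \<in> K" and xy: "x \<in> cball p e" "y \<in> cball p e" for p x y
    proof (rule differentiable_bound[OF convex_cball _ _ xy])
      fix z assume z: "z \<in> cball p e"
      show "(f' has_derivative blinfun_apply (f'' z)) (at z within cball p e)"
        using f'' sub(1)[OF p z] has_derivative_at_withinI by blast
      show "onorm (blinfun_apply (f'' z)) \<le> B + 1"
        using sub(2)[OF p z] norm_ge_zero[of "f z"] norm_ge_zero[of "f' z"]
        unfolding N_def norm_blinfun.rep_eq[symmetric] by linarith
    qed
  qed (use e B f' cf' sub in auto)
qed

text \<open>\<open>K\<close> will be the trajectory of the exact solution. Of the second derivative
  only the Lipschitz bound for \<open>f'\<close> is kept, which is what the second order remainders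
  use.\<close>

locale C2_nbhd =
  fixes U K :: "'x::banach set" and f :: "'x \<Rightarrow> 'x" and f' :: "'x \<Rightarrow> 'x \<Rightarrow>\<^sub>L 'x" and r M :: real
  assumes open_U: "open U" and r_pos: "r > 0" and M_ge_1: "M \<ge> 1"
    and cball_subset: "p \<in> K \<Longrightarrow> cball p r \<subseteq> U"
    and f_derivative: "x \<in> U \<Longrightarrow> (f has_derivative blinfun_apply (f' x)) (at x)"
    and f'_continuous: "continuous_on U f'"
    and f_bound: "p \<in> K \<Longrightarrow> x \<in> cball p r \<Longrightarrow> norm (f x) \<le> M"
    and f'_bound: "p \<in> K \<Longrightarrow> x \<in> cball p r \<Longrightarrow> norm (f' x) \<le> M"
    and f'_lipschitz: "p \<in> K \<Longrightarrow> x \<in> cball p r \<Longrightarrow> y \<in> cball p r \<Longrightarrow>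
      norm (f' x - f' y) \<le> M * norm (x - y)"
begin

lemma f_lipschitz:
  assumes p: "p \<in> K" and "x \<in> cball p r" "y \<in> cball p r"
  shows "norm (f x - f y) \<le> M * norm (x - y)"
proof (rule differentiable_bound[OF convex_cball _ _ assms(2,3)])
  fix z assume z: "z \<in> cball p r"
  show "(f has_derivative blinfun_apply (f' z)) (at z within cball p r)"
    using f_derivative cball_subset[OF p] z has_derivative_at_withinI by blast
  show "onorm (blinfun_apply (f' z)) \<le> M"
    using f'_bound[OF p z] by (simp add: norm_blinfun.rep_eq)
qed

text \<open>Along the segment, \<open>f'\<close> differs from \<open>f' x\<close> by at most
  \<open>M * norm (y - x)\<close>; the linearized mean value inequality supplies the second
  factor.\<close>

lemma f_taylor:
  assumes p: "p \<in> K" and x: "x \<in> cball p r" and y: "y \<in> cball p r"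
  shows "norm (f y - f x - f' x (y - x)) \<le> M * (norm (y - x))\<^sup>2"
proof -
  have seg: "z \<in> cball p r" "norm (z - x) \<le> norm (y - x)" if "z \<in> closed_segment x y" for z
    using that closed_segment_subset[OF x y convex_cball] segment_bound(1)[OF that] by auto
  have "norm (f y - f x - blinfun_apply (f' x) (y - x)) \<le> norm (y - x) * (M * norm (y - x))"
  proof (rule differentiable_bound_linearization[where S = "closed_segment x y" and f' = "\<lambda>x. blinfun_apply (f' x)"])
    show "x + t *\<^sub>R (y - x) \<in> closed_segment x y" if "t \<in> {0..1}" for t
      using that by (auto simp: in_segment algebra_simps intro!: exI[of _ t])
    fix z assume z: "z \<in> closed_segment x y"
    show "(f has_derivative blinfun_apply (f' z)) (at z within closed_segment x y)"
      using f_derivative cball_subset[OF p] seg(1)[OF z] has_derivative_at_withinI by blast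
    have "onorm (\<lambda>h. blinfun_apply (f' z) h - blinfun_apply (f' x) h) = norm (f' z - f' x)"
      by (simp add: norm_blinfun.rep_eq blinfun.diff_left[symmetric])
    also have "\<dots> \<le> M * norm (z - x)" using f'_lipschitz[OF p seg(1)[OF z] x] .
    also have "\<dots> \<le> M * norm (y - x)" using seg(2)[OF z] M_ge_1 by (intro mult_left_mono) auto
    finally show "onorm (blinfun_apply (f' z) - blinfun_apply (f' x)) \<le> M * norm (y - x)"
      by (simp add: fun_diff_def)
  qed simp
  then show ?thesis by (simp add: power2_eq_square mult_ac)
qed

text \<open>Needed throughout \<open>U\<close>, not only near \<open>K\<close>: in the uniqueness
  part of \<open>flow_f\<close> a competing solution may go anywhere in \<open>U\<close>.\<close>

lemma f_locally_lipschitz: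
  assumes "p \<in> U"
  shows "\<exists>\<epsilon>>0. \<exists>L\<ge>0. \<forall>x\<in>ball p \<epsilon>. \<forall>y\<in>ball p \<epsilon>. norm (f x - f y) \<le> L * norm (x - y)"
proof -
  have "(f' \<longlongrightarrow> f' p) (at p)"
    using f'_continuous assms open_U by (simp add: continuous_on_eq_continuous_at isCont_def)
  then have "\<forall>\<^sub>F x in at p. dist (f' x) (f' p) < 1" by (rule tendstoD) simp
  then obtain d where d: "d > 0" "\<And>x. x \<noteq> p \<Longrightarrow> dist x p < d \<Longrightarrow> dist (f' x) (f' p) < 1"
    unfolding eventually_at by blast
  obtain e where e: "e > 0" "ball p e \<subseteq> U" using open_U assms open_contains_ball by blast
  define \<epsilon> where "\<epsilon> = min d e"
  have "norm (f x - f y) \<le> (norm (f' p) + 1) * norm (x - y)" if xy: "x \<in> ball p \<epsilon>" "y \<in> ball p \<epsilon>" for x y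
  proof (rule differentiable_bound[OF convex_ball _ _ xy])
    fix z assume z: "z \<in> ball p \<epsilon>"
    then have "z \<in> U" using e(2) by (auto simp: \<epsilon>_def)
    then show "(f has_derivative blinfun_apply (f' z)) (at z within ball p \<epsilon>)"
      using f_derivative has_derivative_at_withinI by blast
    have "norm (f' z - f' p) \<le> 1"
      using d(2)[of z] z by (cases "z = p") (auto simp: \<epsilon>_def dist_norm norm_minus_commute less_imp_le)
    then have "norm (f' z) \<le> norm (f' p) + 1"
      using norm_triangle_sub[of "f' z" "f' p"] by linarith
    then show "onorm (blinfun_apply (f' z)) \<le> norm (f' p) + 1"
      by (simp add: norm_blinfun.rep_eq)
  qed
  moreover have "\<epsilon> > 0" using d e by (simp add: \<epsilon>_def)
  moreover have "norm (f' p) + 1 \<ge> 0" by simp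
  ultimately show ?thesis by blast
qed

text \<open>Three rounds of the mean value inequality, each feeding the next:
  \<open>norm (w s - w0)\<close> is \<open>O(s)\<close>, then the first order remainder is
  \<open>O(h * s)\<close>, then the second order one is \<open>O(h^3)\<close>. The constant
  \<open>2 * M ^ 3\<close> adds the Taylor remainder \<open>M * (M * h)^2\<close> and the first
  order remainder under \<open>f' w0\<close>. Starting within \<open>r / 2\<close> of
  \<open>p\<close> leaves room for a solution moving by \<open>r / 2\<close>.\<close>

lemma flow_f_expansion:
  assumes p: "p \<in> K" and w0: "w0 \<in> cball p (r / 2)" and h: "0 \<le> h" "h * M \<le> r / 2" "h * M \<le> 1 / 2"
  shows "norm (flow_f U f h w0 - (w0 + h *\<^sub>R f w0 + (h\<^sup>2 / 2) *\<^sub>R f' w0 (f w0))) \<le> 2 * M ^ 3 * h ^ 3"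
proof -
  have sub: "cball w0 (r / 2) \<subseteq> cball p r"
  proof
    fix x assume "x \<in> cball w0 (r / 2)"
    then show "x \<in> cball p r" using w0 dist_triangle[of p x w0] by auto
  qed
  have "w0 \<in> cball p r" using w0 r_pos by auto
  note fw0 = f_bound[OF p this] and f'w0 = f'_bound[OF p this]
  obtain w where w: "solves_ode (cball w0 (r / 2)) f h w0 w"
  proof (rule ode_existence[of w0 "r / 2" f M h])
    show "norm (f x - f y) \<le> M * norm (x - y)" if "x \<in> cball w0 (r / 2)" "y \<in> cball w0 (r / 2)" for x y
      using f_lipschitz[OF p] sub that by blast
    show "norm (f x) \<le> M" if "x \<in> cball w0 (r / 2)" for x
      using f_bound[OF p] sub that by blast
  qed (use h r_pos M_ge_1 in auto)
  then have "solves_ode U f h w0 w"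
    using sub cball_subset[OF p] unfolding solves_ode_def by blast
  moreover from this have "w' h = w h" if "solves_ode U f h w0 w'" for w'
    using ode_uniqueness[OF f_locally_lipschitz that _ h(1)] by blast
  ultimately have flow: "flow_f U f h w0 = w h" by (rule flow_f_eqI)
  have w_0: "w 0 = w0" using w by (simp add: solves_ode_def)
  have in_ball: "w s \<in> cball p r"
    and w': "(w has_vector_derivative f (w s)) (at s within {0..h})" if "s \<in> {0..h}" for s
    using w sub that unfolding solves_ode_def by blast+
  have M3: "0 \<le> M" "0 \<le> M\<^sup>2" "0 \<le> M ^ 3" using M_ge_1 by auto
  have ww0: "norm (w s - w0) \<le> M * s" if "s \<in> {0..h}" for s
    using vector_derivative_bound[OF w' f_bound[OF p in_ball], of s 0] that h(1) w_0 by simp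
  have first: "norm (w s - w0 - s *\<^sub>R f w0) \<le> M\<^sup>2 * h * s" if s: "s \<in> {0..h}" for s
  proof -
    let ?g = "\<lambda>s. w s - w0 - s *\<^sub>R f w0"
    have "norm (?g s - ?g 0) \<le> (M\<^sup>2 * h) * \<bar>s - 0\<bar>"
    proof (rule vector_derivative_bound)
      fix t assume t: "t \<in> {0..h}"
      show "(?g has_vector_derivative f (w t) - f w0) (at t within {0..h})"
        by (auto intro!: derivative_eq_intros w'[OF t])
      have "norm (f (w t) - f w0) \<le> M * norm (w t - w0)"
        using f_lipschitz[OF p in_ball[OF t] \<open>w0 \<in> cball p r\<close>] .
      also have "\<dots> \<le> M * (M * t)" using ww0[OF t] M3 by (intro mult_left_mono)
      also have "\<dots> \<le> M * (M * h)" using t M3 by (intro mult_left_mono) auto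
      finally show "norm (f (w t) - f w0) \<le> M\<^sup>2 * h" by (simp add: power2_eq_square)
    qed (use s h in auto)
    then show ?thesis using s w_0 h by (simp add: diff_diff_eq add.commute)
  qed
  let ?g = "\<lambda>s. w s - (w0 + s *\<^sub>R f w0 + (s\<^sup>2 / 2) *\<^sub>R f' w0 (f w0))"
  have "norm (?g h - ?g 0) \<le> (2 * M ^ 3 * h\<^sup>2) * \<bar>h - 0\<bar>"
  proof (rule vector_derivative_bound)
    fix t assume t: "t \<in> {0..h}"
    show "(?g has_vector_derivative f (w t) - (f w0 + t *\<^sub>R f' w0 (f w0))) (at t within {0..h})"
      by (auto intro!: derivative_eq_intros w'[OF t])
    have "norm (f (w t) - f w0 - f' w0 (w t - w0)) \<le> M * (norm (w t - w0))\<^sup>2"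
      using f_taylor[OF p \<open>w0 \<in> cball p r\<close> in_ball[OF t]] .
    also have "\<dots> \<le> M * (M * h)\<^sup>2"
    proof (intro mult_left_mono power_mono)
      show "norm (w t - w0) \<le> M * h"
        using ww0[OF t] t M3 mult_left_mono[of t h M] by auto
    qed (use M3 in auto)
    finally have 1: "norm (f (w t) - f w0 - f' w0 (w t - w0)) \<le> M ^ 3 * h\<^sup>2"
      by (simp add: power_mult_distrib power3_eq_cube power2_eq_square mult_ac)
    have "norm (f' w0 (w t - w0 - t *\<^sub>R f w0)) \<le> norm (f' w0) * norm (w t - w0 - t *\<^sub>R f w0)"
      by (rule norm_blinfun)
    also have "\<dots> \<le> M * (M\<^sup>2 * h * h)"
    proof (intro mult_mono f'w0)
      have "M\<^sup>2 * h * t \<le> M\<^sup>2 * h * h" using t M3 by (intro mult_left_mono) auto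
      then show "norm (w t - w0 - t *\<^sub>R f w0) \<le> M\<^sup>2 * h * h" using first[OF t] by linarith
    qed (use M3 in auto)
    finally have 2: "norm (f' w0 (w t - w0 - t *\<^sub>R f w0)) \<le> M ^ 3 * h\<^sup>2"
      by (simp add: power3_eq_cube power2_eq_square mult_ac)
    have "f (w t) - (f w0 + t *\<^sub>R f' w0 (f w0)) =
      (f (w t) - f w0 - f' w0 (w t - w0)) + f' w0 (w t - w0 - t *\<^sub>R f w0)"
      by (simp add: blinfun.bilinear_simps)
    then show "norm (f (w t) - (f w0 + t *\<^sub>R f' w0 (f w0))) \<le> 2 * M ^ 3 * h\<^sup>2"
      using norm_triangle_mono[OF 1 2] by (simp only:)
  qed (use h in auto)
  then show ?thesis using h(1) by (simp add: flow w_0 power3_eq_cube power2_eq_square mult_ac)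
qed

end


section \<open>One step of the splitting\<close>

context generated_semigroup
begin

text \<open>The value at time \<open>\<tau>\<close> that a given lifting yields, with
  \<open>A\<close> already distributed over the lifting by linearity.\<close>

definition homogenized ::
  "(('a \<Rightarrow> 'v) \<Rightarrow> 'x) \<Rightarrow> (('a \<Rightarrow> 'v) \<Rightarrow> ('a \<Rightarrow> 'v)) \<Rightarrow> real \<Rightarrow> 'x \<Rightarrow>
    ('a \<Rightarrow> 'v) \<Rightarrow> ('a \<Rightarrow> 'v) \<Rightarrow> 'x" where
  "homogenized cls A \<tau> v0 \<rho>0 \<rho>1 = cls \<rho>0 + \<tau> *\<^sub>R cls \<rho>1 + S \<tau> (v0 - cls \<rho>0) +
     integral {0..\<tau>} (\<lambda>r. S (\<tau> - r) (cls (A \<rho>0) + r *\<^sub>R cls (A \<rho>1) - cls \<rho>1))"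

text \<open>The difference of two liftings with the same boundary values vanishes on
  \<open>\<Gamma>\<close> at all times, so it stays in the domain. Variation of constants for this
  difference \<open>z\<close> is precisely the identity between the two formulas.\<close>

lemma homogenized_eq:
  fixes cls :: "('a::euclidean_space \<Rightarrow> 'v::euclidean_space) \<Rightarrow> 'x"
  assumes setting: "banach_function_space \<Omega> Fn cls" "smooth_diff_op \<Omega> A"
    "dirichlet_realization \<Omega> \<Gamma> Fn cls A D B"
    and \<tau>: "0 < \<tau>" "\<tau> < \<delta>"
    and smooth: "\<rho>0 \<in> smooth_fns \<Omega> Fn A" "\<rho>1 \<in> smooth_fns \<Omega> Fn A"
      "\<sigma>0 \<in> smooth_fns \<Omega> Fn A" "\<sigma>1 \<in> smooth_fns \<Omega> Fn A"
    and bdry: "\<And>s x. s \<in> {0..\<tau>} \<Longrightarrow> x \<in> \<Gamma> \<Longrightarrow> \<rho>0 x + s *\<^sub>R \<rho>1 x = \<sigma>0 x + s *\<^sub>R \<sigma>1 x"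
  shows "homogenized cls A \<tau> v0 \<rho>0 \<rho>1 = homogenized cls A \<tau> v0 \<sigma>0 \<sigma>1"
proof -
  define d0 where "d0 = (\<lambda>x. 1 *\<^sub>R \<rho>0 x + (- 1) *\<^sub>R \<sigma>0 x)"
  define d1 where "d1 = (\<lambda>x. 1 *\<^sub>R \<rho>1 x + (- 1) *\<^sub>R \<sigma>1 x)"
  have Fn: "g \<in> Fn" if "g \<in> smooth_fns \<Omega> Fn A" for g using that by (simp add: smooth_fns_def)
  note lin = smooth_fns_lincomb[OF setting(1,2)] smooth_fns_op_lincomb[OF setting(1,2)]
    banach_function_space_lincomb[OF setting(1) Fn Fn]
  have d: "d0 \<in> smooth_fns \<Omega> Fn A" "d1 \<in> smooth_fns \<Omega> Fn A"
    unfolding d0_def d1_def by (rule lin(1)[OF smooth(1,3)], rule lin(1)[OF smooth(2,4)])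
  have cd: "cls d0 = cls \<rho>0 - cls \<sigma>0" "cls d1 = cls \<rho>1 - cls \<sigma>1"
    unfolding d0_def d1_def by (simp_all only: lin(3)[OF smooth(1,3)] lin(3)[OF smooth(2,4)]) simp_all
  have cAd: "cls (A d0) = cls (A \<rho>0) - cls (A \<sigma>0)" "cls (A d1) = cls (A \<rho>1) - cls (A \<sigma>1)"
    unfolding d0_def d1_def by (simp_all only: lin(2)[OF smooth(1,3)] lin(2)[OF smooth(2,4)]) simp_all
  have d0: "d0 x = 0" if "x \<in> \<Gamma>" for x using bdry[of 0 x] that \<tau> by (simp add: d0_def)
  \<comment> \<open>An affine function of \<open>s\<close> that vanishes at \<open>0\<close> and at
    \<open>\<tau> > 0\<close> has zero slope.\<close>
  have d1: "d1 x = 0" if "x \<in> \<Gamma>" for x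
    using bdry[of \<tau> x] bdry[of 0 x] that \<tau> by (simp add: d1_def)
  define z where "z r = cls d0 + r *\<^sub>R cls d1" for r
  have z: "z r \<in> D" "B (z r) = cls (A d0) + r *\<^sub>R cls (A d1)" for r
  proof -
    define g where "g = (\<lambda>x. 1 *\<^sub>R d0 x + r *\<^sub>R d1 x)"
    have "g \<in> smooth_fns \<Omega> Fn A" unfolding g_def by (rule lin(1)[OF d])
    note dir = setting(3)[unfolded dirichlet_realization_def, THEN bspec, OF this]
    have g: "cls g = z r" unfolding g_def by (simp only: lin(3)[OF d]) (simp add: z_def)
    have Ag: "cls (A g) = cls (A d0) + r *\<^sub>R cls (A d1)"
      unfolding g_def by (simp only: lin(2)[OF d]) simp
    have "\<forall>x\<in>\<Gamma>. g x = 0" using d0 d1 by (simp add: g_def)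
    with dir g Ag show "z r \<in> D" "B (z r) = cls (A d0) + r *\<^sub>R cls (A d1)" by simp_all
  qed
  have "((\<lambda>r. S (\<tau> - r) (cls d1 - B (z r))) has_integral z \<tau> - S \<tau> (z 0)) {0..\<tau>}"
    using \<tau> z(1)
    by (intro variation_of_constants) (auto simp: z_def intro!: derivative_eq_intros)
  then have "integral {0..\<tau>} (\<lambda>r. S (\<tau> - r) (cls d1 - B (z r))) = z \<tau> - S \<tau> (z 0)"
    by (rule integral_unique)
  moreover have "integral {0..\<tau>} (\<lambda>r. S (\<tau> - r) (cls d1 - B (z r))) =
      integral {0..\<tau>} (\<lambda>r. S (\<tau> - r) (cls (A \<sigma>0) + r *\<^sub>R cls (A \<sigma>1) - cls \<sigma>1)
        - S (\<tau> - r) (cls (A \<rho>0) + r *\<^sub>R cls (A \<rho>1) - cls \<rho>1))"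
    by (simp only: z(2) cd cAd blinfun.diff_right[symmetric]) (simp add: algebra_simps)
  moreover have "\<dots> = integral {0..\<tau>} (\<lambda>r. S (\<tau> - r) (cls (A \<sigma>0) + r *\<^sub>R cls (A \<sigma>1) - cls \<sigma>1))
     - integral {0..\<tau>} (\<lambda>r. S (\<tau> - r) (cls (A \<rho>0) + r *\<^sub>R cls (A \<rho>1) - cls \<rho>1))"
    using \<tau> by (intro integral_diff S_reflect_integrable continuous_intros) auto
  moreover have "z \<tau> - S \<tau> (z 0) = (cls \<rho>0 + \<tau> *\<^sub>R cls \<rho>1 + S \<tau> (v0 - cls \<rho>0))
      - (cls \<sigma>0 + \<tau> *\<^sub>R cls \<sigma>1 + S \<tau> (v0 - cls \<sigma>0))"
    by (simp add: z_def cd blinfun.diff_right blinfun.add_right algebra_simps)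
  ultimately show ?thesis unfolding homogenized_def by (simp add: algebra_simps)
qed

text \<open>\<open>bvp_solution\<close> leaves the lifting existentially quantified, so the
  description in \<open>flow_A\<close> is unique only because \<open>homogenized_eq\<close> makes
  the value independent of it.\<close>

lemma flow_A_homogenized:
  fixes cls :: "('a::euclidean_space \<Rightarrow> 'v::euclidean_space) \<Rightarrow> 'x"
  assumes setting: "banach_function_space \<Omega> Fn cls" "smooth_diff_op \<Omega> A"
    "dirichlet_realization \<Omega> \<Gamma> Fn cls A D B"
    and \<tau>: "0 < \<tau>" "\<tau> < \<delta>"
    and smooth: "\<rho>0 \<in> smooth_fns \<Omega> Fn A" "\<rho>1 \<in> smooth_fns \<Omega> Fn A"
    and bdry: "\<And>s x. s \<in> {0..\<tau>} \<Longrightarrow> x \<in> \<Gamma> \<Longrightarrow> \<rho>0 x + s *\<^sub>R \<rho>1 x = b x + (\<tau> / 2 - s) *\<^sub>R F x (b x)"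
  shows "flow_A \<Omega> \<Gamma> Fn cls A S F b \<tau> v0 = homogenized cls A \<tau> v0 \<rho>0 \<rho>1"
  unfolding flow_A_def
proof (rule the_equality)
  have Fn: "g \<in> Fn" if "g \<in> smooth_fns \<Omega> Fn A" for g using that by (simp add: smooth_fns_def)
  have lin: "cls (\<lambda>x. \<sigma>0 x + s *\<^sub>R \<sigma>1 x) = cls \<sigma>0 + s *\<^sub>R cls \<sigma>1"
    "cls (A (\<lambda>x. \<sigma>0 x + s *\<^sub>R \<sigma>1 x)) = cls (A \<sigma>0) + s *\<^sub>R cls (A \<sigma>1)"
    if "\<sigma>0 \<in> smooth_fns \<Omega> Fn A" "\<sigma>1 \<in> smooth_fns \<Omega> Fn A" for \<sigma>0 \<sigma>1 s
    using banach_function_space_lincomb[OF setting(1) Fn[OF that(1)] Fn[OF that(2)], of 1 s]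
      smooth_fns_op_lincomb[OF setting(1,2) that, of 1 s]
    by (simp_all only: scaleR_one)
  let ?V = "\<lambda>s x. b x + (\<tau> / 2 - s) *\<^sub>R F x (b x)"
  define v where "v s = cls (\<lambda>x. \<rho>0 x + s *\<^sub>R \<rho>1 x) + (S s (v0 - cls \<rho>0) +
    integral {0..s} (\<lambda>r. S (s - r) (cls (A (\<lambda>x. \<rho>0 x + r *\<^sub>R \<rho>1 x)) - cls \<rho>1)))" for s
  have "bvp_solution \<Omega> \<Gamma> Fn cls A S ?V \<tau> v0 v"
    unfolding bvp_solution_def using smooth bdry
    by (intro bexI[of _ \<rho>0] bexI[of _ \<rho>1] conjI ballI) (simp_all add: v_def)
  moreover have "v \<tau> = homogenized cls A \<tau> v0 \<rho>0 \<rho>1"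
    by (simp add: v_def homogenized_def lin[OF smooth])
  ultimately show "\<exists>v. bvp_solution \<Omega> \<Gamma> Fn cls A S ?V \<tau> v0 v \<and> v \<tau> = homogenized cls A \<tau> v0 \<rho>0 \<rho>1"
    by blast
  fix y assume "\<exists>v. bvp_solution \<Omega> \<Gamma> Fn cls A S ?V \<tau> v0 v \<and> v \<tau> = y"
  then obtain \<sigma>0 \<sigma>1 v where \<sigma>: "\<sigma>0 \<in> smooth_fns \<Omega> Fn A" "\<sigma>1 \<in> smooth_fns \<Omega> Fn A"
    and bdry': "\<And>s x. s \<in> {0..\<tau>} \<Longrightarrow> x \<in> \<Gamma> \<Longrightarrow> \<sigma>0 x + s *\<^sub>R \<sigma>1 x = ?V s x"
    and v: "\<And>s. s \<in> {0..\<tau>} \<Longrightarrow> v s - cls (\<lambda>x. \<sigma>0 x + s *\<^sub>R \<sigma>1 x) = S s (v0 - cls \<sigma>0) +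
      integral {0..s} (\<lambda>r. S (s - r) (cls (A (\<lambda>x. \<sigma>0 x + r *\<^sub>R \<sigma>1 x)) - cls \<sigma>1))"
    and "v \<tau> = y"
    unfolding bvp_solution_def by blast
  have "v \<tau> = homogenized cls A \<tau> v0 \<sigma>0 \<sigma>1"
    using v[of \<tau>] \<tau> by (simp add: homogenized_def lin[OF \<sigma>] algebra_simps)
  also have "\<dots> = homogenized cls A \<tau> v0 \<rho>0 \<rho>1"
    using bdry bdry' by (intro homogenized_eq[OF setting \<tau> \<sigma> smooth]) simp
  finally show "y = homogenized cls A \<tau> v0 \<rho>0 \<rho>1" using \<open>v \<tau> = y\<close> by simp
qed

text \<open>Since \<open>g = b\<close> on \<open>\<Gamma>\<close>, also
  \<open>F x (g x) = F x (b x)\<close> there, and a lifting can be built from the solution itself.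
  Then \<open>A\<close> acts only on \<open>u\<close> and on \<open>f(u)\<close>, where it is
  bounded in time, and the source \<open>A \<rho>0 + r A \<rho>1 - \<rho>1\<close> separates into
  the constant \<open>A g + \<phi>\<close> and a term with weight
  \<open>\<tau> / 2 - r\<close>.\<close>

lemma flow_A_eq:
  fixes cls :: "('a::euclidean_space \<Rightarrow> 'v::euclidean_space) \<Rightarrow> 'x"
  assumes setting: "banach_function_space \<Omega> Fn cls" "smooth_diff_op \<Omega> A"
    "dirichlet_realization \<Omega> \<Gamma> Fn cls A D B"
    and \<tau>: "0 < \<tau>" "\<tau> < \<delta>"
    and smooth: "g \<in> smooth_fns \<Omega> Fn A" "(\<lambda>x. F x (g x)) \<in> smooth_fns \<Omega> Fn A"
    and bdry: "\<And>x. x \<in> \<Gamma> \<Longrightarrow> g x = b x"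
    and \<phi>: "\<phi> = cls (\<lambda>x. F x (g x))"
  shows "flow_A \<Omega> \<Gamma> Fn cls A S F b \<tau> v0 =
    cls g - (\<tau> / 2) *\<^sub>R \<phi> + S \<tau> (v0 - cls g - (\<tau> / 2) *\<^sub>R \<phi>) + H \<tau> (cls (A g) + \<phi>) +
      wint (\<lambda>r. \<tau> / 2 - r) \<tau> (cls (A (\<lambda>x. F x (g x))))"
proof -
  let ?G = "\<lambda>x. F x (g x)"
  have Fn: "g \<in> Fn" if "g \<in> smooth_fns \<Omega> Fn A" for g using that by (simp add: smooth_fns_def)
  define \<rho>0 where "\<rho>0 = (\<lambda>x. 1 *\<^sub>R g x + (\<tau> / 2) *\<^sub>R ?G x)"
  define \<rho>1 where "\<rho>1 = (\<lambda>x. 0 *\<^sub>R g x + (- 1) *\<^sub>R ?G x)"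
  have \<rho>: "\<rho>0 \<in> smooth_fns \<Omega> Fn A" "\<rho>1 \<in> smooth_fns \<Omega> Fn A"
    unfolding \<rho>0_def \<rho>1_def by (intro smooth_fns_lincomb[OF setting(1,2) smooth])+
  have cls_\<rho>: "cls \<rho>0 = cls g + (\<tau> / 2) *\<^sub>R \<phi>" "cls \<rho>1 = - \<phi>"
    unfolding \<rho>0_def \<rho>1_def \<phi>
    by (simp_all only: banach_function_space_lincomb[OF setting(1) Fn[OF smooth(1)] Fn[OF smooth(2)]])
       simp_all
  have cls_A\<rho>: "cls (A \<rho>0) = cls (A g) + (\<tau> / 2) *\<^sub>R cls (A ?G)" "cls (A \<rho>1) = - cls (A ?G)"
    unfolding \<rho>0_def \<rho>1_def by (simp_all only: smooth_fns_op_lincomb[OF setting(1,2) smooth]) simp_all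
  have "flow_A \<Omega> \<Gamma> Fn cls A S F b \<tau> v0 = homogenized cls A \<tau> v0 \<rho>0 \<rho>1"
    using bdry by (intro flow_A_homogenized[OF setting \<tau> \<rho>]) (simp add: \<rho>0_def \<rho>1_def algebra_simps)
  moreover have "integral {0..\<tau>} (\<lambda>r. S (\<tau> - r) (cls (A \<rho>0) + r *\<^sub>R cls (A \<rho>1) - cls \<rho>1)) =
      H \<tau> (cls (A g) + \<phi>) + wint (\<lambda>r. \<tau> / 2 - r) \<tau> (cls (A ?G))"
  proof -
    have "((\<lambda>r. S (\<tau> - r) (cls (A g) + \<phi>)) has_integral H \<tau> (cls (A g) + \<phi>)) {0..\<tau>}"
      using \<tau> by (intro S_reflect_has_integral) auto
    moreover have "((\<lambda>r. (\<tau> / 2 - r) *\<^sub>R S (\<tau> - r) (cls (A ?G))) has_integral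
        wint (\<lambda>r. \<tau> / 2 - r) \<tau> (cls (A ?G))) {0..\<tau>}"
      unfolding wint_def using \<tau>
      by (intro integrable_integral integrable_continuous_real continuous_on_scaleR
        continuous_S_reflect continuous_on_const continuous_on_diff continuous_on_id) auto
    ultimately have "((\<lambda>r. S (\<tau> - r) (cls (A g) + \<phi>) + (\<tau> / 2 - r) *\<^sub>R S (\<tau> - r) (cls (A ?G))) has_integral
      H \<tau> (cls (A g) + \<phi>) + wint (\<lambda>r. \<tau> / 2 - r) \<tau> (cls (A ?G))) {0..\<tau>}"
      by (rule has_integral_add)
    moreover have "S (\<tau> - r) (cls (A g) + \<phi>) + (\<tau> / 2 - r) *\<^sub>R S (\<tau> - r) (cls (A ?G)) =
      S (\<tau> - r) (cls (A \<rho>0) + r *\<^sub>R cls (A \<rho>1) - cls \<rho>1)" for r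
      by (simp only: cls_A\<rho> cls_\<rho> blinfun.scaleR_right[symmetric] blinfun.add_right[symmetric])
        (simp add: algebra_simps)
    ultimately show ?thesis by (intro integral_unique) simp
  qed
  moreover have "\<tau> *\<^sub>R \<phi> = (\<tau> / 2) *\<^sub>R \<phi> + (\<tau> / 2) *\<^sub>R \<phi>"
    by (simp add: scaleR_add_left[symmetric])
  ultimately show ?thesis
    by (simp add: homogenized_def cls_\<rho> diff_diff_eq)
qed

end

text \<open>Here \<open>M\<close> bounds the semigroup and \<open>L\<close> is the constant of
  \<open>C2_nbhd\<close>, so \<open>M_ge\<close> says \<open>M \<ge> 1\<close> while
  \<open>M_ge_1\<close> says \<open>L \<ge> 1\<close>. The single \<open>N\<close> bounds the time
  derivative of the solution, its Lipschitz constant and \<open>A f(u)\<close>.\<close>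

locale tdbc_step = generated_semigroup D B S \<delta> M
  + C2_nbhd U "(\<lambda>t. cls (u t)) ` {0..T}" f f' r L
  for D :: "'x::banach set" and B :: "'x \<Rightarrow> 'x" and S :: "real \<Rightarrow> 'x \<Rightarrow>\<^sub>L 'x" and \<delta> M :: real
    and U :: "'x set" and cls :: "('a::euclidean_space \<Rightarrow> 'v::euclidean_space) \<Rightarrow> 'x"
    and u :: "real \<Rightarrow> 'a \<Rightarrow> 'v" and T :: real
    and f :: "'x \<Rightarrow> 'x" and f' :: "'x \<Rightarrow> 'x \<Rightarrow>\<^sub>L 'x" and r L :: real +
  fixes \<Omega> \<Gamma> :: "'a set" and Fn :: "('a \<Rightarrow> 'v) set" and A :: "('a \<Rightarrow> 'v) \<Rightarrow> ('a \<Rightarrow> 'v)"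
    and F :: "'a \<Rightarrow> 'v \<Rightarrow> 'v" and b :: "'a \<Rightarrow> 'v" and N :: real
  assumes fn_space: "banach_function_space \<Omega> Fn cls" and diff_op: "smooth_diff_op \<Omega> A"
    and dirichlet: "dirichlet_realization \<Omega> \<Gamma> Fn cls A D B"
    and pointwise: "acts_pointwise Fn cls U f F"
    and u_smooth: "t \<in> {0..T} \<Longrightarrow> u t \<in> smooth_fns \<Omega> Fn A"
    and Fu_smooth: "t \<in> {0..T} \<Longrightarrow> (\<lambda>x. F x (u t x)) \<in> smooth_fns \<Omega> Fn A"
    and u_boundary: "t \<in> {0..T} \<Longrightarrow> x \<in> \<Gamma> \<Longrightarrow> u t x = b x"
    and u_derivative: "t \<in> {0..T} \<Longrightarrow>
      ((\<lambda>s. cls (u s)) has_vector_derivative cls (A (u t)) + f (cls (u t))) (at t within {0..T})"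
    and u_derivative_bound: "t \<in> {0..T} \<Longrightarrow> norm (cls (A (u t)) + f (cls (u t))) \<le> N"
    and u_derivative_lipschitz: "t \<in> {0..T} \<Longrightarrow> s \<in> {0..T} \<Longrightarrow>
      norm ((cls (A (u t)) + f (cls (u t))) - (cls (A (u s)) + f (cls (u s)))) \<le> N * \<bar>t - s\<bar>"
    and AFu_bound: "t \<in> {0..T} \<Longrightarrow> norm (cls (A (\<lambda>x. F x (u t x)))) \<le> N"
begin

definition p :: "real \<Rightarrow> 'x" where "p t = cls (u t)"
definition p' :: "real \<Rightarrow> 'x" where "p' t = cls (A (u t)) + f (p t)"
definition a :: "real \<Rightarrow> 'x" where "a t = cls (A (\<lambda>x. F x (u t x)))"
definition q :: "real \<Rightarrow> 'x" where "q t = f' (p t) (f (p t))"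
definition y :: "real \<Rightarrow> 'x" where "y t = f' (p t) (p' t)"

lemma p_mem: "t \<in> {0..T} \<Longrightarrow> p t \<in> (\<lambda>t. cls (u t)) ` {0..T}"
  by (auto simp: p_def)

lemma p_ball: "p t \<in> cball (p t) r"
  using r_pos by simp

lemma p_in_U: "t \<in> {0..T} \<Longrightarrow> p t \<in> U"
  using cball_subset[OF p_mem] p_ball by blast

lemma f_p: "t \<in> {0..T} \<Longrightarrow> f (p t) = cls (\<lambda>x. F x (u t x))"
proof -
  assume t: "t \<in> {0..T}"
  have "cls (u t) \<in> U" using p_in_U[OF t] by (simp add: p_def)
  moreover have "u t \<in> Fn" using u_smooth[OF t] by (simp add: smooth_fns_def)
  ultimately show ?thesis using pointwise by (simp add: acts_pointwise_def p_def)
qed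

lemma p_derivative: "t \<in> {0..T} \<Longrightarrow> (p has_vector_derivative p' t) (at t within {0..T})"
  using u_derivative[of t] unfolding p_def[abs_def] p'_def .

lemma p'_bound: "t \<in> {0..T} \<Longrightarrow> norm (p' t) \<le> N"
  using u_derivative_bound[of t] by (simp add: p_def p'_def)

lemma N_nonneg: "t \<in> {0..T} \<Longrightarrow> N \<ge> 0"
  using p'_bound[of t] norm_ge_zero order_trans by blast

lemma p_lipschitz:
  assumes "0 \<le> t" "0 \<le> s" "t + s \<le> T"
  shows "norm (p (t + s) - p t) \<le> N * s"
  using vector_derivative_bound[OF p_derivative p'_bound, of "t + s" t] assms by simp

lemma p_taylor:
  assumes "0 \<le> t" "0 \<le> s" "t + s \<le> T"
  shows "norm (p (t + s) - p t - s *\<^sub>R p' t) \<le> N * s\<^sup>2"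
proof -
  let ?g = "\<lambda>x. p x - (x - t) *\<^sub>R p' t"
  have N: "N \<ge> 0" using assms N_nonneg[of t] by auto
  have "norm (?g (t + s) - ?g t) \<le> (N * s) * \<bar>t + s - t\<bar>"
  proof (rule vector_derivative_bound)
    fix x assume x: "x \<in> {t..t + s}"
    have "(p has_vector_derivative p' x) (at x within {t..t + s})"
      using assms x by (intro has_vector_derivative_within_subset[OF p_derivative]) auto
    then show "(?g has_vector_derivative p' x - p' t) (at x within {t..t + s})"
      by (auto intro!: derivative_eq_intros)
    have "norm (p' x - p' t) \<le> N * \<bar>x - t\<bar>"
      using u_derivative_lipschitz[of x t] assms x by (simp add: p_def p'_def)
    also have "\<dots> \<le> N * s" using x N by (intro mult_left_mono) auto
    finally show "norm (p' x - p' t) \<le> N * s" .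
  qed (use assms in auto)
  then show ?thesis using assms by (simp add: power2_eq_square algebra_simps)
qed

lemma q_bound: "t \<in> {0..T} \<Longrightarrow> norm (q t) \<le> L * L"
  and y_bound: "t \<in> {0..T} \<Longrightarrow> norm (y t) \<le> L * N"
proof -
  assume t: "t \<in> {0..T}"
  have f': "norm (f' (p t)) \<le> L" and f: "norm (f (p t)) \<le> L"
    using f'_bound[OF p_mem[OF t] p_ball] f_bound[OF p_mem[OF t] p_ball] .
  show "norm (q t) \<le> L * L"
    unfolding q_def using M_ge_1 f f' by (intro order_trans[OF norm_blinfun] mult_mono) auto
  show "norm (y t) \<le> L * N"
    unfolding y_def using M_ge_1 f' p'_bound[OF t] by (intro order_trans[OF norm_blinfun] mult_mono) auto
qed

lemma exact_solution_formula:
  assumes t: "0 \<le> t" "t + \<tau> \<le> T" and \<tau>: "0 < \<tau>" "\<tau> < \<delta>"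
  shows "p (t + \<tau>) = p t + H \<tau> (p' t) +
    integral {0..\<tau>} (\<lambda>r. S (\<tau> - r) (f (p (t + r)) - f (p t)))"
proof -
  have in_T: "t + r \<in> {0..T}" "t \<in> {0..T}" if "r \<in> {0..\<tau>}" for r using that t by auto
  define z where "z r = p (t + r) - p t" for r
  have z: "z r \<in> D" "B (z r) = cls (A (u (t + r))) - cls (A (u t))" if r: "r \<in> {0..\<tau>}" for r
  proof -
    define g where "g = (\<lambda>x. 1 *\<^sub>R u (t + r) x + (- 1) *\<^sub>R u t x)"
    note smooth = u_smooth[OF in_T(1)[OF r]] u_smooth[OF in_T(2)[OF r]]
    then have Fn: "u (t + r) \<in> Fn" "u t \<in> Fn" by (auto simp: smooth_fns_def)
    have "g \<in> smooth_fns \<Omega> Fn A"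
      unfolding g_def by (rule smooth_fns_lincomb[OF fn_space diff_op smooth])
    note dir = dirichlet[unfolded dirichlet_realization_def, THEN bspec, OF this]
    have g: "cls g = z r"
      unfolding g_def
      by (simp only: banach_function_space_lincomb[OF fn_space Fn]) (simp add: z_def p_def)
    have Ag: "cls (A g) = cls (A (u (t + r))) - cls (A (u t))"
      unfolding g_def by (simp only: smooth_fns_op_lincomb[OF fn_space diff_op smooth]) simp
    have "\<forall>x\<in>\<Gamma>. g x = 0" using u_boundary in_T[OF r] by (simp add: g_def)
    with dir g Ag show "z r \<in> D" "B (z r) = cls (A (u (t + r))) - cls (A (u t))" by simp_all
  qed
  have z': "(z has_vector_derivative p' (t + r)) (at r within {0..\<tau>})" if r: "r \<in> {0..\<tau>}" for r
  proof -
    have "(p has_vector_derivative p' (t + r)) (at (t + r) within (\<lambda>r. t + r) ` {0..\<tau>})"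
      using t in_T(1)[OF r] by (intro has_vector_derivative_within_subset[OF p_derivative]) auto
    then have "((p \<circ> (\<lambda>r. t + r)) has_vector_derivative 1 *\<^sub>R p' (t + r)) (at r within {0..\<tau>})"
      by (intro vector_diff_chain_within) (auto intro!: derivative_eq_intros)
    then show ?thesis
      unfolding z_def[abs_def] by (auto intro!: derivative_eq_intros simp: o_def)
  qed
  have "((\<lambda>r. S (\<tau> - r) (p' (t + r) - B (z r))) has_integral z \<tau> - S \<tau> (z 0)) {0..\<tau>}"
    using \<tau> z(1) z' by (intro variation_of_constants) auto
  then have "((\<lambda>r. S (\<tau> - r) (p' (t + r) - B (z r))) has_integral z \<tau>) {0..\<tau>}"
    by (simp add: z_def blinfun.zero_right)
  moreover have "((\<lambda>r. S (\<tau> - r) (p' t)) has_integral H \<tau> (p' t)) {0..\<tau>}"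
    using \<tau> by (intro S_reflect_has_integral) auto
  ultimately have "((\<lambda>r. S (\<tau> - r) (p' (t + r) - B (z r)) - S (\<tau> - r) (p' t)) has_integral
      z \<tau> - H \<tau> (p' t)) {0..\<tau>}"
    by (rule has_integral_diff)
  then have "((\<lambda>r. S (\<tau> - r) (f (p (t + r)) - f (p t))) has_integral z \<tau> - H \<tau> (p' t)) {0..\<tau>}"
    by (rule has_integral_eq[rotated])
      (simp add: z(2) blinfun.diff_right[symmetric] p'_def)
  then show ?thesis by (simp add: integral_unique z_def)
qed

end

section \<open>Expansion of the local error, uniformly in the starting time\<close>

context tdbc_step
begin

lemma uniform_O_bounded:
  assumes "\<And>t. t \<in> {0..T} \<Longrightarrow> norm (g t) \<le> C"
  shows "uniform_O T 0 (\<lambda>t \<tau>. g t)"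
  by (rule uniform_OI[of 1 _ _ C]) (use assms in auto)

lemma uniform_O_S: "uniform_O T 0 (\<lambda>t \<tau>. S \<tau>)"
  by (rule uniform_OI[of \<delta> _ _ M]) (use norm_S \<delta>_pos in auto)

lemma uniform_O_f': "uniform_O T 0 (\<lambda>t \<tau>. f' (p t))"
  by (rule uniform_O_bounded[of _ L]) (use f'_bound[OF p_mem p_ball] in auto)

lemma uniform_O_q: "uniform_O T 0 (\<lambda>t \<tau>. q t)"
  by (rule uniform_O_bounded[OF q_bound])

lemma uniform_O_exact_taylor: "uniform_O T 2 (\<lambda>t \<tau>. p (t + \<tau>) - p t - \<tau> *\<^sub>R p' t)"
  by (rule uniform_OI[of 1 _ _ N]) (use p_taylor in auto)

lemma continuous_f_p:
  assumes "0 \<le> t" "t + \<tau> \<le> T"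
  shows "continuous_on {0..\<tau>} (\<lambda>s. f (p (t + s)))"
proof (rule continuous_on_compose2[where g = f and t = U])
  show "continuous_on U f"
    using f_derivative has_derivative_continuous by (blast intro: continuous_at_imp_continuous_on)
  have "continuous_on {0..T} p"
    using p_derivative has_vector_derivative_continuous
    unfolding continuous_on_eq_continuous_within by blast
  then show "continuous_on {0..\<tau>} (\<lambda>s. p (t + s))"
    by (rule continuous_on_compose2[where g = p]) (use assms in \<open>auto intro!: continuous_intros\<close>)
  show "(\<lambda>s. p (t + s)) ` {0..\<tau>} \<subseteq> U"
    using assms p_in_U by auto
qed

text \<open>Linearizing \<open>f\<close> at \<open>p t\<close> and then \<open>p\<close> at
  \<open>t\<close> replaces the reaction increment at time \<open>s\<close> by
  \<open>s *\<^sub>R y t\<close> up to \<open>O(\<tau>^2)\<close>; integrating against the bounded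
  semigroup gains the third power.\<close>

lemma uniform_O_exact:
  "uniform_O T 3 (\<lambda>t \<tau>. p (t + \<tau>) - p t - H \<tau> (p' t) - wint (\<lambda>r. r) \<tau> (y t))"
proof (rule uniform_OI)
  \<comment> \<open>\<open>\<delta> / 2\<close> makes \<open>\<tau> < \<delta>\<close> strict. The
    second term gives \<open>N * \<tau> \<le> r\<close>, which keeps \<open>p (t + s)\<close> in the
    ball of the Taylor estimate; the absolute value is there because \<open>N \<ge> 0\<close> is
    available only once a time in \<open>{0..T}\<close> is at hand.\<close>
  show "min (\<delta> / 2) (r / (\<bar>N\<bar> + 1)) > 0" using \<delta>_pos r_pos by simp
  fix t \<tau> assume t: "0 \<le> t" "t + \<tau> \<le> T" and \<tau>: "0 < \<tau>" "\<tau> \<le> min (\<delta> / 2) (r / (\<bar>N\<bar> + 1))"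
  have \<tau>\<delta>: "\<tau> < \<delta>" "\<tau> \<le> \<delta>" using \<tau> \<delta>_pos by auto
  have tT: "t \<in> {0..T}" using t \<tau> by auto
  have "(\<bar>N\<bar> + 1) * \<tau> \<le> r" using \<tau>(2) by (simp add: field_simps)
  moreover have "N \<ge> 0" using N_nonneg[OF tT] .
  ultimately have N\<tau>: "N * \<tau> \<le> r" using \<tau>(1) by (simp add: distrib_right)
  let ?g = "\<lambda>s. f (p (t + s)) - f (p t)"
  have cont: "continuous_on {0..\<tau>} ?g"
    by (intro continuous_on_diff continuous_f_p t continuous_on_const)
  have cont': "continuous_on {0..\<tau>} (\<lambda>s. ?g s - s *\<^sub>R y t)"
    by (intro continuous_on_diff[OF cont] continuous_intros)
  have "((\<lambda>s. S (\<tau> - s) (?g s)) has_integral p (t + \<tau>) - p t - H \<tau> (p' t)) {0..\<tau>}"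
    using integrable_integral[OF S_reflect_integrable[OF \<tau>\<delta>(2) cont]]
    by (simp add: exact_solution_formula[OF t \<tau>(1) \<tau>\<delta>(1)])
  moreover have "((\<lambda>s. s *\<^sub>R S (\<tau> - s) (y t)) has_integral wint (\<lambda>r. r) \<tau> (y t)) {0..\<tau>}"
    unfolding wint_def
    by (intro integrable_integral integrable_continuous_real continuous_on_scaleR
        continuous_S_reflect[OF \<tau>\<delta>(2)] continuous_on_const continuous_on_id)
  ultimately have "((\<lambda>s. S (\<tau> - s) (?g s) - s *\<^sub>R S (\<tau> - s) (y t)) has_integral
      p (t + \<tau>) - p t - H \<tau> (p' t) - wint (\<lambda>r. r) \<tau> (y t)) {0..\<tau>}"
    by (rule has_integral_diff)
  then have eq: "p (t + \<tau>) - p t - H \<tau> (p' t) - wint (\<lambda>r. r) \<tau> (y t) =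
      integral {0..\<tau>} (\<lambda>s. S (\<tau> - s) (?g s - s *\<^sub>R y t))"
    by (simp add: integral_unique blinfun.diff_right blinfun.scaleR_right)
  have bound: "norm (?g s - s *\<^sub>R y t) \<le> (L * N\<^sup>2 + L * N) * \<tau>\<^sup>2" if s: "s \<in> {0..\<tau>}" for s
  proof -
    have lip: "norm (p (t + s) - p t) \<le> N * s" using p_lipschitz[of t s] t s by auto
    also have le: "\<dots> \<le> N * \<tau>" using s \<open>N \<ge> 0\<close> by (intro mult_left_mono) auto
    finally have "norm (p (t + s) - p t) \<le> N * \<tau>" .
    then have ball: "p (t + s) \<in> cball (p t) r" using N\<tau> by (simp add: dist_norm norm_minus_commute)
    have "norm (?g s - f' (p t) (p (t + s) - p t)) \<le> L * (norm (p (t + s) - p t))\<^sup>2"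
      using f_taylor[OF p_mem[OF tT] p_ball ball] .
    also have "\<dots> \<le> L * (N * \<tau>)\<^sup>2"
      using lip le M_ge_1 by (intro mult_left_mono power_mono) auto
    finally have 1: "norm (?g s - f' (p t) (p (t + s) - p t)) \<le> L * (N * \<tau>)\<^sup>2" .
    have "norm (f' (p t) (p (t + s) - p t - s *\<^sub>R p' t)) \<le>
        norm (f' (p t)) * norm (p (t + s) - p t - s *\<^sub>R p' t)"
      by (rule norm_blinfun)
    also have "\<dots> \<le> L * (N * s\<^sup>2)"
      using t s M_ge_1 \<open>N \<ge> 0\<close> by (intro mult_mono f'_bound[OF p_mem[OF tT] p_ball] p_taylor) auto
    also have "\<dots> \<le> L * (N * \<tau>\<^sup>2)"
      using s M_ge_1 \<open>N \<ge> 0\<close> by (intro mult_left_mono power_mono) auto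
    finally have 2: "norm (f' (p t) (p (t + s) - p t - s *\<^sub>R p' t)) \<le> L * (N * \<tau>\<^sup>2)" .
    have "?g s - s *\<^sub>R y t = (?g s - f' (p t) (p (t + s) - p t)) + f' (p t) (p (t + s) - p t - s *\<^sub>R p' t)"
      by (simp add: y_def blinfun.diff_right blinfun.scaleR_right)
    then have "norm (?g s - s *\<^sub>R y t) \<le> L * (N * \<tau>)\<^sup>2 + L * (N * \<tau>\<^sup>2)"
      using norm_triangle_mono[OF 1 2] by (simp only:)
    then show ?thesis by (simp add: power_mult_distrib algebra_simps)
  qed
  have "norm (integral {0..\<tau>} (\<lambda>s. S (\<tau> - s) (?g s - s *\<^sub>R y t))) \<le>
      M * ((L * N\<^sup>2 + L * N) * \<tau>\<^sup>2) * \<tau>"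
    using \<tau>(1) by (intro norm_integral_S_reflect[OF _ \<tau>\<delta>(2) cont' bound]) auto
  then show "norm (p (t + \<tau>) - p t - H \<tau> (p' t) - wint (\<lambda>r. r) \<tau> (y t)) \<le>
      M * (L * N\<^sup>2 + L * N) * \<tau> ^ 3"
    unfolding eq by (simp add: power3_eq_cube power2_eq_square mult_ac)
qed

lemma uniform_O_wint:
  assumes "\<And>t. t \<in> {0..T} \<Longrightarrow> norm (g t) \<le> C"
    and "\<And>\<tau>. continuous_on {0..\<tau>} (k \<tau>)" "\<And>r \<tau>. r \<in> {0..\<tau>} \<Longrightarrow> \<bar>k \<tau> r\<bar> \<le> \<tau>"
  shows "uniform_O T 2 (\<lambda>t \<tau>. wint (k \<tau>) \<tau> (g t))"
proof (rule uniform_OI)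
  show "\<delta> > 0" by (rule \<delta>_pos)
  fix t \<tau> assume t: "0 \<le> t" "0 < \<tau>" "\<tau> \<le> \<delta>" "t + \<tau> \<le> T"
  show "norm (wint (k \<tau>) \<tau> (g t)) \<le> (M * C) * \<tau>\<^sup>2"
    unfolding wint_def
  proof (rule norm_integral_weight_le[OF _ assms(2) _ assms(3)])
    show "continuous_on {0..\<tau>} (\<lambda>r. S (\<tau> - r) (g t))"
      by (intro continuous_S_reflect t continuous_on_const)
    fix r assume r: "r \<in> {0..\<tau>}"
    have "norm (S (\<tau> - r) (g t)) \<le> M * norm (g t)" using r t by (intro norm_S_apply) auto
    also have "\<dots> \<le> M * C" using assms(1)[of t] t M_ge by (intro mult_left_mono) auto
    finally show "norm (S (\<tau> - r) (g t)) \<le> M * C" .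
  qed (use t in auto)
qed

definition step_f :: "real \<Rightarrow> real \<Rightarrow> 'x" where
  "step_f t \<tau> = flow_f U f (\<tau> / 2) (p t)"

definition step_fA :: "real \<Rightarrow> real \<Rightarrow> 'x" where
  "step_fA t \<tau> = flow_A \<Omega> \<Gamma> Fn cls A S F b \<tau> (step_f t \<tau>)"

definition step :: "real \<Rightarrow> real \<Rightarrow> 'x" where
  "step t \<tau> = flow_f U f (\<tau> / 2) (step_fA t \<tau>)"

lemma step_eq_strang: "step t \<tau> = strang_tdbc \<Omega> \<Gamma> Fn cls A S U f F b \<tau> (cls (u t))"
  by (simp add: step_def step_fA_def step_f_def strang_tdbc_def p_def)

lemma step_fA_eq:
  assumes "t \<in> {0..T}" "0 < \<tau>" "\<tau> < \<delta>"
  shows "step_fA t \<tau> = p t - (\<tau> / 2) *\<^sub>R f (p t) + S \<tau> (step_f t \<tau> - p t - (\<tau> / 2) *\<^sub>R f (p t)) +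
    H \<tau> (p' t) + wint (\<lambda>r. \<tau> / 2 - r) \<tau> (a t)"
  using flow_A_eq[where cls = cls and g = "u t" and F = F and b = b, OF fn_space diff_op dirichlet assms(2,3) u_smooth[OF assms(1)] Fu_smooth[OF assms(1)]
      u_boundary[OF assms(1)] f_p[OF assms(1)], of "step_f t \<tau>"]
  by (simp add: step_fA_def p_def p'_def a_def)

text \<open>Stated for a start \<open>w\<close> that is \<open>O(\<tau>)\<close> away from
  \<open>p\<close>, so that it serves both reaction steps: the first with \<open>w = p\<close>, the
  second with the result of the linear step. The coefficient \<open>\<tau>^2 / 8\<close> is
  \<open>(\<tau> / 2)^2 / 2\<close>.\<close>

lemma uniform_O_flow_f:
  assumes "uniform_O T 1 (\<lambda>t \<tau>. w t \<tau> - p t)"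
  shows "uniform_O T 3 (\<lambda>t \<tau>. flow_f U f (\<tau> / 2) (w t \<tau>) -
    (w t \<tau> + (\<tau> / 2) *\<^sub>R f (w t \<tau>) + (\<tau>\<^sup>2 / 8) *\<^sub>R f' (w t \<tau>) (f (w t \<tau>))))"
proof -
  obtain C \<tau>\<^sub>0 where C: "C \<ge> 0" "\<tau>\<^sub>0 > 0"
    "\<And>t \<tau>. 0 \<le> t \<Longrightarrow> 0 < \<tau> \<Longrightarrow> \<tau> \<le> \<tau>\<^sub>0 \<Longrightarrow> t + \<tau> \<le> T \<Longrightarrow> norm (w t \<tau> - p t) \<le> C * \<tau> ^ 1"
    using uniform_OE[OF assms] by blast
  show ?thesis
  proof (rule uniform_OI)
    \<comment> \<open>The term with \<open>C\<close> keeps \<open>w\<close> within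
      \<open>r / 2\<close> of \<open>p\<close>; the last two are the step size conditions of
      \<open>flow_f_expansion\<close> for the half step \<open>\<tau> / 2\<close>.\<close>
    show "min \<tau>\<^sub>0 (min (r / (2 * (C + 1))) (min (r / L) (1 / L))) > 0"
      using C r_pos M_ge_1 by simp
    fix t \<tau> assume t: "0 \<le> t" "t + \<tau> \<le> T" "0 < \<tau>"
      and \<tau>: "\<tau> \<le> min \<tau>\<^sub>0 (min (r / (2 * (C + 1))) (min (r / L) (1 / L)))"
    have "norm (w t \<tau> - p t) \<le> C * \<tau>" using C(3)[of t \<tau>] t \<tau> by simp
    also have "\<dots> \<le> (C + 1) * \<tau>" using t by (simp add: distrib_right)
    also have "\<dots> \<le> r / 2" using \<tau> C(1) by (simp add: field_simps)
    finally have "w t \<tau> \<in> cball (p t) (r / 2)" by (simp add: dist_norm norm_minus_commute)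
    moreover have "\<tau> / 2 * L \<le> r / 2" "\<tau> / 2 * L \<le> 1 / 2"
      using \<tau> M_ge_1 by (auto simp: field_simps)
    ultimately have "norm (flow_f U f (\<tau> / 2) (w t \<tau>) - (w t \<tau> + (\<tau> / 2) *\<^sub>R f (w t \<tau>) +
        ((\<tau> / 2)\<^sup>2 / 2) *\<^sub>R f' (w t \<tau>) (f (w t \<tau>)))) \<le> 2 * L ^ 3 * (\<tau> / 2) ^ 3"
      using t by (intro flow_f_expansion[OF p_mem]) auto
    then show "norm (flow_f U f (\<tau> / 2) (w t \<tau>) - (w t \<tau> + (\<tau> / 2) *\<^sub>R f (w t \<tau>) +
        (\<tau>\<^sup>2 / 8) *\<^sub>R f' (w t \<tau>) (f (w t \<tau>)))) \<le> (L ^ 3 / 4) * \<tau> ^ 3"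
      by (simp add: power_divide)
  qed
qed

text \<open>The orders differ according to use: \<open>f (w)\<close> will be multiplied by
  \<open>\<tau> / 2\<close>, the second order term only by \<open>\<tau>^2 / 8\<close>, so both
  remainders end up of third order.\<close>

lemma uniform_O_f_taylor:
  assumes "uniform_O T 1 (\<lambda>t \<tau>. w t \<tau> - p t)"
  shows "uniform_O T 2 (\<lambda>t \<tau>. f (w t \<tau>) - f (p t) - f' (p t) (w t \<tau> - p t))"
    and "uniform_O T 1 (\<lambda>t \<tau>. f' (w t \<tau>) (f (w t \<tau>)) - q t)"
proof -
  obtain C \<tau>\<^sub>0 where C: "C \<ge> 0" "\<tau>\<^sub>0 > 0"
    "\<And>t \<tau>. 0 \<le> t \<Longrightarrow> 0 < \<tau> \<Longrightarrow> \<tau> \<le> \<tau>\<^sub>0 \<Longrightarrow> t + \<tau> \<le> T \<Longrightarrow> norm (w t \<tau> - p t) \<le> C * \<tau> ^ 1"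
    using uniform_OE[OF assms] by blast
  define \<tau>\<^sub>1 where "\<tau>\<^sub>1 = min \<tau>\<^sub>0 (r / (C + 1))"
  have "\<tau>\<^sub>1 > 0" using C r_pos by (simp add: \<tau>\<^sub>1_def)
  have ball: "w t \<tau> \<in> cball (p t) r" if t: "0 \<le> t" "0 < \<tau>" "\<tau> \<le> \<tau>\<^sub>1" "t + \<tau> \<le> T" for t \<tau>
  proof -
    have "norm (w t \<tau> - p t) \<le> C * \<tau>" using C(3)[of t \<tau>] t by (simp add: \<tau>\<^sub>1_def)
    also have "\<dots> \<le> (C + 1) * \<tau>" using t by (simp add: distrib_right)
    also have "\<dots> \<le> r" using t C(1) by (simp add: field_simps \<tau>\<^sub>1_def)
    finally show ?thesis by (simp add: dist_norm norm_minus_commute)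
  qed
  have mem: "p t \<in> (\<lambda>t. cls (u t)) ` {0..T}" if "0 \<le> t" "0 < \<tau>" "t + \<tau> \<le> T" for t \<tau>
    using that by (intro p_mem) auto
  show "uniform_O T 2 (\<lambda>t \<tau>. f (w t \<tau>) - f (p t) - f' (p t) (w t \<tau> - p t))"
  proof (rule uniform_O_dominated[OF assms assms _ \<open>\<tau>\<^sub>1 > 0\<close>])
    fix t \<tau> assume t: "0 \<le> t" "0 < \<tau>" "\<tau> \<le> \<tau>\<^sub>1" "t + \<tau> \<le> T"
    show "norm (f (w t \<tau>) - f (p t) - f' (p t) (w t \<tau> - p t)) \<le>
        L * (norm (w t \<tau> - p t) * norm (w t \<tau> - p t))"
      using f_taylor[OF mem[OF t(1,2,4)] p_ball ball[OF t]] by (simp add: power2_eq_square)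
  qed (use M_ge_1 in simp_all)
  show "uniform_O T 1 (\<lambda>t \<tau>. f' (w t \<tau>) (f (w t \<tau>)) - q t)"
  \<comment> \<open>The constant function \<open>1\<close> plays the factor of order zero in the
    product.\<close>
  proof (rule uniform_O_dominated[OF uniform_O_bounded[of "\<lambda>t. 1::real" 1] assms _ \<open>\<tau>\<^sub>1 > 0\<close>])
    fix t \<tau> assume t: "0 \<le> t" "0 < \<tau>" "\<tau> \<le> \<tau>\<^sub>1" "t + \<tau> \<le> T"
    let ?n = "norm (w t \<tau> - p t)"
    have "norm (f' (w t \<tau>) (f (w t \<tau>) - f (p t))) \<le> L * (L * ?n)"
      using f'_bound[OF mem[OF t(1,2,4)] ball[OF t]] f_lipschitz[OF mem[OF t(1,2,4)] ball[OF t] p_ball] M_ge_1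
      by (intro order_trans[OF norm_blinfun] mult_mono) auto
    moreover have "norm ((f' (w t \<tau>) - f' (p t)) (f (p t))) \<le> (L * ?n) * L"
      using f'_lipschitz[OF mem[OF t(1,2,4)] ball[OF t] p_ball] f_bound[OF mem[OF t(1,2,4)] p_ball] M_ge_1
      by (intro order_trans[OF norm_blinfun] mult_mono) auto
    ultimately have "norm (f' (w t \<tau>) (f (w t \<tau>) - f (p t)) + (f' (w t \<tau>) - f' (p t)) (f (p t)))
        \<le> L * (L * ?n) + (L * ?n) * L"
      by (rule norm_triangle_mono)
    then show "norm (f' (w t \<tau>) (f (w t \<tau>)) - q t) \<le> (2 * L * L) * (norm (1::real) * ?n)"
      by (simp add: q_def blinfun.diff_right blinfun.diff_left algebra_simps)
  qed auto
qed

text \<open>The remainders \<open>e1\<close> to \<open>e7\<close> turn every approximation into an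
  exact identity. The claim is then an algebraic identity among them, followed by counting
  orders.\<close>

lemma local_error_expansion:
  "uniform_O T 3 (\<lambda>t \<tau>. step t \<tau> - p (t + \<tau>) - defect \<tau> (q t) (a t) (y t))"
proof -
  define e1 where "e1 t \<tau> = step_f t \<tau> - (p t + (\<tau> / 2) *\<^sub>R f (p t) + (\<tau>\<^sup>2 / 8) *\<^sub>R q t)" for t \<tau>
  define e2 where "e2 t \<tau> = p (t + \<tau>) - p t - H \<tau> (p' t) - wint (\<lambda>r. r) \<tau> (y t)" for t \<tau>
  define e3 where "e3 t \<tau> = p (t + \<tau>) - p t - \<tau> *\<^sub>R p' t" for t \<tau>
  define v where "v t \<tau> = step_fA t \<tau>" for t \<tau>
  define e4 where "e4 t \<tau> = v t \<tau> - p t + (\<tau> / 2) *\<^sub>R f (p t) - \<tau> *\<^sub>R p' t" for t \<tau>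
  define e5 where "e5 t \<tau> = step t \<tau> - (v t \<tau> + (\<tau> / 2) *\<^sub>R f (v t \<tau>) + (\<tau>\<^sup>2 / 8) *\<^sub>R f' (v t \<tau>) (f (v t \<tau>)))" for t \<tau>
  define e6 where "e6 t \<tau> = f (v t \<tau>) - f (p t) - f' (p t) (v t \<tau> - p t)" for t \<tau>
  define e7 where "e7 t \<tau> = f' (v t \<tau>) (f (v t \<tau>)) - q t" for t \<tau>
  have lin: "uniform_O T 1 (\<lambda>t \<tau>. \<tau> / 2)" "uniform_O T 1 (\<lambda>t \<tau>. \<tau>)"
    and quad: "uniform_O T 2 (\<lambda>t \<tau>. \<tau>\<^sup>2 / 8)"
    using uniform_O_monomial[of T 1 "1 / 2"] uniform_O_monomial[of T 1 1] uniform_O_monomial[of T 2 "1 / 8"]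
    by simp_all
  have 1: "uniform_O T 3 e1"
    using uniform_O_flow_f[of "\<lambda>t \<tau>. p t"] uniform_OI[of 1 T "\<lambda>t \<tau>. 0" 0 1]
    by (simp add: e1_def[abs_def] step_f_def q_def)
  have 2: "uniform_O T 3 e2" unfolding e2_def[abs_def] by (rule uniform_O_exact)
  have 3: "uniform_O T 2 e3" unfolding e3_def[abs_def] by (rule uniform_O_exact_taylor)
  have J: "uniform_O T 2 (\<lambda>t \<tau>. wint (\<lambda>r. \<tau> / 2 - r) \<tau> (a t))"
    using AFu_bound by (intro uniform_O_wint[of _ N]) (auto simp: a_def intro!: continuous_intros)
  have R: "uniform_O T 2 (\<lambda>t \<tau>. wint (\<lambda>r. r) \<tau> (y t))"
    by (rule uniform_O_wint[OF y_bound]) (auto intro!: continuous_intros)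
  have Se1: "uniform_O T 2 (\<lambda>t \<tau>. S \<tau> (e1 t \<tau> + (\<tau>\<^sup>2 / 8) *\<^sub>R q t))"
  proof (rule uniform_O_blinfun_apply[OF uniform_O_S uniform_O_add])
    show "uniform_O T 2 e1" by (rule uniform_O_mono[OF 1]) simp
    show "uniform_O T 2 (\<lambda>t \<tau>. (\<tau>\<^sup>2 / 8) *\<^sub>R q t)"
      by (rule uniform_O_scaleR[OF quad uniform_O_q]) simp
  qed simp
  have v: "v t \<tau> = p t - (\<tau> / 2) *\<^sub>R f (p t) + S \<tau> (e1 t \<tau> + (\<tau>\<^sup>2 / 8) *\<^sub>R q t) + H \<tau> (p' t) +
      wint (\<lambda>r. \<tau> / 2 - r) \<tau> (a t)"
    if "0 \<le> t" "0 < \<tau>" "\<tau> \<le> \<delta> / 2" "t + \<tau> \<le> T" for t \<tau>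
    using step_fA_eq[of t \<tau>] that \<delta>_pos by (simp add: v_def e1_def diff_diff_eq)
  \<comment> \<open>\<open>H \<tau> (p' t) - \<tau> *\<^sub>R p' t\<close> cannot be estimated
    through the generator, since \<open>p' t\<close> is not known to lie in its domain. Instead
    \<open>H \<tau> (p' t)\<close> is eliminated by the formula for the exact solution, whose time
    regularity (\<open>e3\<close>) supplies the second order.\<close>
  have 4: "uniform_O T 2 e4"
  proof (rule uniform_O_eq)
    have "uniform_O T 2 e2" by (rule uniform_O_mono[OF 2]) simp
    then show "uniform_O T 2 (\<lambda>t \<tau>. e3 t \<tau> + S \<tau> (e1 t \<tau> + (\<tau>\<^sup>2 / 8) *\<^sub>R q t) +
        wint (\<lambda>r. \<tau> / 2 - r) \<tau> (a t) - wint (\<lambda>r. r) \<tau> (y t) - e2 t \<tau>)"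
      by (intro uniform_O_diff uniform_O_add 3 Se1 J R)
    show "\<delta> / 2 > 0" using \<delta>_pos by simp
    show "e4 t \<tau> = e3 t \<tau> + S \<tau> (e1 t \<tau> + (\<tau>\<^sup>2 / 8) *\<^sub>R q t) +
        wint (\<lambda>r. \<tau> / 2 - r) \<tau> (a t) - wint (\<lambda>r. r) \<tau> (y t) - e2 t \<tau>"
      if "0 \<le> t" "0 < \<tau>" "\<tau> \<le> \<delta> / 2" "t + \<tau> \<le> T" for t \<tau>
      unfolding e4_def e3_def e2_def v[OF that] by simp
  qed
  have vp: "uniform_O T 1 (\<lambda>t \<tau>. v t \<tau> - p t)"
  proof -
    have f: "uniform_O T 0 (\<lambda>t \<tau>. f (p t))"
      by (rule uniform_O_bounded[of _ L]) (use f_bound[OF p_mem p_ball] in auto)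
    have p': "uniform_O T 0 (\<lambda>t \<tau>. p' t)" by (rule uniform_O_bounded[OF p'_bound])
    have "uniform_O T 1 e4" by (rule uniform_O_mono[OF 4]) simp
    moreover have "uniform_O T 1 (\<lambda>t \<tau>. (\<tau> / 2) *\<^sub>R f (p t))" "uniform_O T 1 (\<lambda>t \<tau>. \<tau> *\<^sub>R p' t)"
      by (rule uniform_O_scaleR[OF lin(1) f], simp, rule uniform_O_scaleR[OF lin(2) p'], simp)
    ultimately have "uniform_O T 1 (\<lambda>t \<tau>. e4 t \<tau> - (\<tau> / 2) *\<^sub>R f (p t) + \<tau> *\<^sub>R p' t)"
      by (intro uniform_O_diff uniform_O_add)
    then show ?thesis by (simp add: e4_def)
  qed
  have 5: "uniform_O T 3 e5"
    using uniform_O_flow_f[OF vp] by (simp add: e5_def[abs_def] step_def v_def)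
  have 6: "uniform_O T 2 e6" and 7: "uniform_O T 1 e7"
    using uniform_O_f_taylor[OF vp] by (simp_all add: e6_def[abs_def] e7_def[abs_def])
  have rest: "uniform_O T 3 (\<lambda>t \<tau>. S \<tau> (e1 t \<tau>))" "uniform_O T 3 (\<lambda>t \<tau>. (\<tau> / 2) *\<^sub>R f' (p t) (e4 t \<tau>))"
    "uniform_O T 3 (\<lambda>t \<tau>. (\<tau> / 2) *\<^sub>R e6 t \<tau>)" "uniform_O T 3 (\<lambda>t \<tau>. (\<tau>\<^sup>2 / 8) *\<^sub>R e7 t \<tau>)"
    by (rule uniform_O_blinfun_apply[OF uniform_O_S 1], simp)
      (rule uniform_O_scaleR[OF lin(1) uniform_O_blinfun_apply[OF uniform_O_f' 4 refl]]
        uniform_O_scaleR[OF lin(1) 6] uniform_O_scaleR[OF quad 7], simp)+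
  show ?thesis
  proof (rule uniform_O_eq)
    show "uniform_O T 3 (\<lambda>t \<tau>. S \<tau> (e1 t \<tau>) - e2 t \<tau> + (\<tau> / 2) *\<^sub>R f' (p t) (e4 t \<tau>) +
        (\<tau> / 2) *\<^sub>R e6 t \<tau> + (\<tau>\<^sup>2 / 8) *\<^sub>R e7 t \<tau> + e5 t \<tau>)"
      by (intro uniform_O_add uniform_O_diff rest 2 5)
    show "\<delta> / 2 > 0" using \<delta>_pos by simp
    fix t \<tau> assume t: "0 \<le> t" "0 < \<tau>" "\<tau> \<le> \<delta> / 2" "t + \<tau> \<le> T"
    let ?J = "wint (\<lambda>r. \<tau> / 2 - r) \<tau> (a t)" and ?R = "wint (\<lambda>r. r) \<tau> (y t)"
    have Sv: "S \<tau> (e1 t \<tau> + (\<tau>\<^sup>2 / 8) *\<^sub>R q t) = S \<tau> (e1 t \<tau>) + (\<tau>\<^sup>2 / 8) *\<^sub>R S \<tau> (q t)"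
      by (simp add: blinfun.add_right blinfun.scaleR_right)
    have vp: "v t \<tau> - p t = e4 t \<tau> - (\<tau> / 2) *\<^sub>R f (p t) + \<tau> *\<^sub>R p' t" by (simp add: e4_def)
    \<comment> \<open>The first order part of \<open>v - p\<close> is
      \<open>\<tau> p' - \<tau>/2 f(p)\<close>; under \<open>(\<tau> / 2) *\<^sub>R f' (p t)\<close>
      it produces the \<open>y\<close> term of the defect and \<open>- \<tau>^2/4\<close> times
      \<open>q\<close>.\<close>
    have "(\<tau> / 2) *\<^sub>R f' (p t) (v t \<tau> - p t) =
        (\<tau> / 2) *\<^sub>R f' (p t) (e4 t \<tau>) - (\<tau>\<^sup>2 / 4) *\<^sub>R q t + (\<tau>\<^sup>2 / 2) *\<^sub>R y t"
      unfolding vp q_def y_def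
      by (simp add: blinfun.add_right blinfun.diff_right blinfun.scaleR_right
          scaleR_add_right scaleR_diff_right power2_eq_square)
    \<comment> \<open>One half cancels against the second reaction step; the other pairs with
      \<open>S \<tau> (q t)\<close>. Written as a sum, the cancellation needs only additive
      simplification.\<close>
    moreover have "(\<tau>\<^sup>2 / 4) *\<^sub>R q t = (\<tau>\<^sup>2 / 8) *\<^sub>R q t + (\<tau>\<^sup>2 / 8) *\<^sub>R q t"
      by (simp add: scaleR_add_left[symmetric])
    ultimately have f'v: "(\<tau> / 2) *\<^sub>R f' (p t) (v t \<tau> - p t) =
        (\<tau> / 2) *\<^sub>R f' (p t) (e4 t \<tau>) - ((\<tau>\<^sup>2 / 8) *\<^sub>R q t + (\<tau>\<^sup>2 / 8) *\<^sub>R q t) + (\<tau>\<^sup>2 / 2) *\<^sub>R y t"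
      by simp
    have "f (v t \<tau>) = f (p t) + f' (p t) (v t \<tau> - p t) + e6 t \<tau>" by (simp add: e6_def)
    then have fv: "(\<tau> / 2) *\<^sub>R f (v t \<tau>) =
        (\<tau> / 2) *\<^sub>R f (p t) + (\<tau> / 2) *\<^sub>R f' (p t) (v t \<tau> - p t) + (\<tau> / 2) *\<^sub>R e6 t \<tau>"
      by (simp only: scaleR_add_right)
    have "f' (v t \<tau>) (f (v t \<tau>)) = q t + e7 t \<tau>" by (simp add: e7_def)
    then have gv: "(\<tau>\<^sup>2 / 8) *\<^sub>R f' (v t \<tau>) (f (v t \<tau>)) = (\<tau>\<^sup>2 / 8) *\<^sub>R q t + (\<tau>\<^sup>2 / 8) *\<^sub>R e7 t \<tau>"
      by (simp only: scaleR_add_right)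
    have step: "step t \<tau> = v t \<tau> + (\<tau> / 2) *\<^sub>R f (v t \<tau>) + (\<tau>\<^sup>2 / 8) *\<^sub>R f' (v t \<tau>) (f (v t \<tau>)) + e5 t \<tau>"
      by (simp add: e5_def)
    have exact: "p (t + \<tau>) = p t + H \<tau> (p' t) + ?R + e2 t \<tau>" by (simp add: e2_def)
    have "step t \<tau> - p (t + \<tau>) =
      (p t - (\<tau> / 2) *\<^sub>R f (p t) + (S \<tau> (e1 t \<tau>) + (\<tau>\<^sup>2 / 8) *\<^sub>R S \<tau> (q t)) + H \<tau> (p' t) + ?J)
      + ((\<tau> / 2) *\<^sub>R f (p t) + ((\<tau> / 2) *\<^sub>R f' (p t) (e4 t \<tau>) -
          ((\<tau>\<^sup>2 / 8) *\<^sub>R q t + (\<tau>\<^sup>2 / 8) *\<^sub>R q t) + (\<tau>\<^sup>2 / 2) *\<^sub>R y t) + (\<tau> / 2) *\<^sub>R e6 t \<tau>)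
      + ((\<tau>\<^sup>2 / 8) *\<^sub>R q t + (\<tau>\<^sup>2 / 8) *\<^sub>R e7 t \<tau>) + e5 t \<tau>
      - (p t + H \<tau> (p' t) + ?R + e2 t \<tau>)"
      by (simp only: step exact fv gv f'v) (simp only: v[OF t] Sv)
    then show "step t \<tau> - p (t + \<tau>) - defect \<tau> (q t) (a t) (y t) =
        S \<tau> (e1 t \<tau>) - e2 t \<tau> + (\<tau> / 2) *\<^sub>R f' (p t) (e4 t \<tau>) +
        (\<tau> / 2) *\<^sub>R e6 t \<tau> + (\<tau>\<^sup>2 / 8) *\<^sub>R e7 t \<tau> + e5 t \<tau>"
      unfolding defect_def scaleR_diff_right by (simp only:) simp
  qed
qed

end

theorem theorem1:
  fixes \<Omega> \<Gamma> :: "'a::euclidean_space set"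
    and Fn :: "('a \<Rightarrow> 'v::euclidean_space) set"
    and cls :: "('a \<Rightarrow> 'v) \<Rightarrow> 'x::banach"
    and A :: "('a \<Rightarrow> 'v) \<Rightarrow> ('a \<Rightarrow> 'v)"
    and D\<^sub>0 :: "'x set" and A\<^sub>0 :: "'x \<Rightarrow> 'x"
    and S :: "real \<Rightarrow> 'x \<Rightarrow>\<^sub>L 'x"
    and U :: "'x set" and f :: "'x \<Rightarrow> 'x" and F :: "'a \<Rightarrow> 'v \<Rightarrow> 'v"
    and b u0 :: "'a \<Rightarrow> 'v" and u :: "real \<Rightarrow> 'a \<Rightarrow> 'v" and T :: real
  assumes "open \<Omega>" and "connected \<Omega>" and "\<Omega> \<noteq> {}" and "\<Gamma> \<subseteq> frontier \<Omega>"
    and "banach_function_space \<Omega> Fn cls"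
    and "smooth_diff_op \<Omega> A"
    and "dirichlet_realization \<Omega> \<Gamma> Fn cls A D\<^sub>0 A\<^sub>0"
    and "generates D\<^sub>0 A\<^sub>0 S"
    and "open U" and "acts_pointwise Fn cls U f F" and "C2_on U f"
    and "0 < T"
    and "exact_solution \<Gamma> cls A f b u0 T u"
    and "smooth_framework \<Omega> Fn cls A F T u"
    and "\<forall>t\<in>{0..T}. cls (u t) \<in> U"
  shows
    "(\<exists>C. \<exists>\<tau>\<^sub>0>0. \<forall>\<tau> (n::nat). 0 < \<tau> \<and> \<tau> \<le> \<tau>\<^sub>0 \<and> real n * \<tau> + \<tau> \<le> T \<longrightarrow>
        norm (strang_tdbc \<Omega> \<Gamma> Fn cls A S U f F b \<tau> (cls (u (real n * \<tau>)))
               - cls (u (real n * \<tau> + \<tau>))) \<le> C * \<tau>\<^sup>2) \<and>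
     (analytic_semigroup S \<longrightarrow>
       (\<exists>C. \<exists>\<tau>\<^sub>0>0. \<forall>\<tau> (n::nat). 0 < \<tau> \<and> \<tau> \<le> \<tau>\<^sub>0 \<and> real n * \<tau> + \<tau> \<le> T \<longrightarrow>
          (\<exists>E\<in>D\<^sub>0.
             norm (strang_tdbc \<Omega> \<Gamma> Fn cls A S U f F b \<tau> (cls (u (real n * \<tau>)))
                    - cls (u (real n * \<tau> + \<tau>)) - \<tau> ^ 3 *\<^sub>R A\<^sub>0 E) \<le> C * \<tau> ^ 3 \<and>
             norm E \<le> C \<and>
             norm (A\<^sub>0 E) \<le> C / \<tau>)))"
proof -
  have u_derivative: "((\<lambda>s. cls (u s)) has_vector_derivative cls (A (u t)) + f (cls (u t))) (at t within {0..T})"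
    if "t \<in> {0..T}" for t
    using \<open>exact_solution \<Gamma> cls A f b u0 T u\<close> that unfolding exact_solution_def by blast
  obtain u1 u2 :: "real \<Rightarrow> 'x" where
    u1: "\<And>t. t \<in> {0..T} \<Longrightarrow> ((\<lambda>s. cls (u s)) has_vector_derivative u1 t) (at t within {0..T})"
    and u2: "\<And>t. t \<in> {0..T} \<Longrightarrow> (u1 has_vector_derivative u2 t) (at t within {0..T})"
    and cont_u2: "continuous_on {0..T} u2"
    using \<open>smooth_framework \<Omega> Fn cls A F T u\<close> unfolding smooth_framework_def by blast
  \<comment> \<open>Uniqueness of derivatives identifies \<open>u1\<close> with the right-hand side
    of the equation, so that the bound on \<open>u2\<close> becomes the Lipschitz bound for this
    right-hand side.\<close>
  have u1_eq: "u1 t = cls (A (u t)) + f (cls (u t))" if "t \<in> {0..T}" for t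
    using vector_derivative_unique_within_closed_interval[where a = 0 and b = T and x = t]
      \<open>0 < T\<close> that u1[OF that] u_derivative[OF that] by simp
  have cont: "continuous_on {0..T} (\<lambda>t. cls (u t))" "continuous_on {0..T} u1"
    using u1 u2 has_vector_derivative_continuous
    unfolding continuous_on_eq_continuous_within by blast+
  have "bounded (u1 ` {0..T})" "bounded (u2 ` {0..T})"
    by (intro compact_imp_bounded compact_continuous_image cont cont_u2 compact_Icc)+
  moreover have "bounded ((\<lambda>t. cls (A (\<lambda>x. F x (u t x)))) ` {0..T})"
    using \<open>smooth_framework \<Omega> Fn cls A F T u\<close> unfolding smooth_framework_def by blast
  ultimately obtain B1 B2 B3 where
    "\<forall>x\<in>u1 ` {0..T}. norm x \<le> B1" "\<forall>x\<in>u2 ` {0..T}. norm x \<le> B2"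
    "\<forall>x\<in>(\<lambda>t. cls (A (\<lambda>x. F x (u t x)))) ` {0..T}. norm x \<le> B3"
    unfolding bounded_iff by blast
  then have B: "norm (u1 t) \<le> B1" "norm (u2 t) \<le> B2"
    "norm (cls (A (\<lambda>x. F x (u t x)))) \<le> B3" if "t \<in> {0..T}" for t
    using that by blast+
  define N where "N = max B1 (max B2 B3)"
  have N: "B1 \<le> N" "B2 \<le> N" "B3 \<le> N" by (auto simp: N_def)
  have "compact ((\<lambda>t. cls (u t)) ` {0..T})" by (intro compact_continuous_image cont compact_Icc)
  moreover have "(\<lambda>t. cls (u t)) ` {0..T} \<subseteq> U" using \<open>\<forall>t\<in>{0..T}. cls (u t) \<in> U\<close> by blast
  ultimately obtain f' r L where nbhd: "C2_nbhd U ((\<lambda>t. cls (u t)) ` {0..T}) f f' r L"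
    by (rule C2_on_uniform_nbhd[OF \<open>open U\<close> \<open>C2_on U f\<close>])
      (rule that, rule C2_nbhd.intro[OF \<open>open U\<close>])
  have "C0_semigroup S" using \<open>generates D\<^sub>0 A\<^sub>0 S\<close> by (simp add: generates_def)
  then obtain \<delta> M where semi: "generated_semigroup D\<^sub>0 A\<^sub>0 S \<delta> M"
    by (rule C0_semigroup_bounded_near_0)
      (rule that, rule generated_semigroup.intro[OF \<open>generates D\<^sub>0 A\<^sub>0 S\<close>])
  interpret tdbc_step D\<^sub>0 A\<^sub>0 S \<delta> M U cls u T f f' r L \<Omega> \<Gamma> Fn A F b N
  proof (intro tdbc_step.intro semi nbhd tdbc_step_axioms.intro)
    fix t assume t: "t \<in> {0..T}"
    show "u t \<in> smooth_fns \<Omega> Fn A" "(\<lambda>x. F x (u t x)) \<in> smooth_fns \<Omega> Fn A"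
      using \<open>smooth_framework \<Omega> Fn cls A F T u\<close> t unfolding smooth_framework_def by blast+
    show "u t x = b x" if "x \<in> \<Gamma>" for x
      using \<open>exact_solution \<Gamma> cls A f b u0 T u\<close> t that unfolding exact_solution_def by blast
    show "norm (cls (A (u t)) + f (cls (u t))) \<le> N"
      using B(1)[OF t] N(1) u1_eq[OF t] by simp
    show "norm (cls (A (\<lambda>x. F x (u t x)))) \<le> N" using B(3)[OF t] N(3) by linarith
    fix s assume s: "s \<in> {0..T}"
    have "norm (u1 t - u1 s) \<le> N * \<bar>t - s\<bar>"
      using B(2) N(2) by (intro vector_derivative_bound[OF u2 _ t s]) fastforce+
    then show "norm ((cls (A (u t)) + f (cls (u t))) - (cls (A (u s)) + f (cls (u s)))) \<le> N * \<bar>t - s\<bar>"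
      by (simp only: u1_eq[OF t] u1_eq[OF s])
  qed (use assms u_derivative in auto)
  obtain C \<tau>\<^sub>0 where C: "C \<ge> 0" "\<tau>\<^sub>0 > 0"
    "\<And>t \<tau>. 0 \<le> t \<Longrightarrow> 0 < \<tau> \<Longrightarrow> \<tau> \<le> \<tau>\<^sub>0 \<Longrightarrow> t + \<tau> \<le> T \<Longrightarrow>
      norm (step t \<tau> - p (t + \<tau>) - defect \<tau> (q t) (a t) (y t)) \<le> C * \<tau> ^ 3"
    using uniform_OE[OF local_error_expansion] by blast
  define Q where "Q = max (L * L) (max N (L * N))"
  have Q: "norm (q t) \<le> Q" "norm (a t) \<le> Q" "norm (y t) \<le> Q" if "t \<in> {0..T}" for t
    using q_bound[OF that] AFu_bound[OF that] y_bound[OF that] by (auto simp: Q_def a_def)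
  \<comment> \<open>\<open>\<delta> / 2\<close> ensures \<open>\<tau> < \<delta>\<close>, and
    \<open>1\<close> allows \<open>\<tau> ^ 3 \<le> \<tau>^2\<close> in the first estimate.\<close>
  define \<tau>\<^sub>1 where "\<tau>\<^sub>1 = min \<tau>\<^sub>0 (min 1 (\<delta> / 2))"
  have "\<tau>\<^sub>1 > 0" using C(2) \<delta>_pos by (simp add: \<tau>\<^sub>1_def)
  \<comment> \<open>The sum serves all four estimates: the third order remainder, the second order
    error, the preimage, and its image divided by \<open>\<tau> ^ 3\<close>.\<close>
  define C' where "C' = C + 3 * (M + 1) * Q"
  have "Q \<ge> 0" using order_trans[OF norm_ge_zero Q(1)[of 0]] \<open>0 < T\<close> by simp
  have C': "C \<le> C'" "3 * (M + 1) * Q \<le> C'" "3 * M * Q \<le> C'"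
    using C(1) M_ge \<open>Q \<ge> 0\<close> by (auto simp: C'_def distrib_right distrib_left add_increasing)
  have step: "norm (step t \<tau> - p (t + \<tau>)) \<le> C' * \<tau>\<^sup>2"
      "\<exists>E\<in>D\<^sub>0. norm (step t \<tau> - p (t + \<tau>) - \<tau> ^ 3 *\<^sub>R A\<^sub>0 E) \<le> C' * \<tau> ^ 3 \<and>
        norm E \<le> C' \<and> norm (A\<^sub>0 E) \<le> C' / \<tau>"
    if \<tau>: "0 < \<tau>" "\<tau> \<le> \<tau>\<^sub>1" and t: "0 \<le> t" "t + \<tau> \<le> T" for t \<tau>
  proof -
    have tT: "t \<in> {0..T}" and \<tau>\<delta>: "\<tau> < \<delta>" and \<tau>1: "\<tau> \<le> 1" "\<tau> \<le> \<tau>\<^sub>0"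
      using t \<tau> \<delta>_pos by (auto simp: \<tau>\<^sub>1_def)
    let ?G = "defect \<tau> (q t) (a t) (y t)"
    note G = defect_in_range[OF \<tau>(1) \<tau>\<delta> Q[OF tT]]
    have err: "norm (step t \<tau> - p (t + \<tau>) - ?G) \<le> C * \<tau> ^ 3" using C(3)[of t \<tau>] t \<tau> \<tau>1 by simp
    also have "\<dots> \<le> C * \<tau>\<^sup>2"
      using \<tau> \<tau>1 C(1) by (intro mult_left_mono power_decreasing) auto
    finally have "norm (step t \<tau> - p (t + \<tau>)) \<le> C * \<tau>\<^sup>2 + 3 * (M + 1) * Q * \<tau>\<^sup>2"
      using norm_triangle_mono[OF _ G(1), of "step t \<tau> - p (t + \<tau>) - ?G" "C * \<tau>\<^sup>2"] by simp
    then show "norm (step t \<tau> - p (t + \<tau>)) \<le> C' * \<tau>\<^sup>2" by (simp add: C'_def algebra_simps)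
    obtain E where E: "E \<in> D\<^sub>0" "\<tau> ^ 3 *\<^sub>R A\<^sub>0 E = ?G" "norm E \<le> 3 * M * Q" using G(2) by blast
    \<comment> \<open>The bound on \<open>A\<^sub>0 E\<close> is the second order bound of the
      defect read backwards.\<close>
    have "\<tau> ^ 3 * norm (A\<^sub>0 E) = norm ?G" using \<tau> E(2) by (metis abs_of_pos norm_scaleR zero_less_power)
    also have "\<dots> \<le> C' * \<tau>\<^sup>2"
      using G(1) mult_right_mono[OF C'(2), of "\<tau>\<^sup>2"] by simp
    finally have "norm (A\<^sub>0 E) \<le> C' / \<tau>"
      using \<tau> by (simp add: field_simps power3_eq_cube power2_eq_square)
    moreover have "norm (step t \<tau> - p (t + \<tau>) - \<tau> ^ 3 *\<^sub>R A\<^sub>0 E) \<le> C' * \<tau> ^ 3"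
      unfolding E(2) using \<tau> by (intro order_trans[OF err mult_right_mono[OF C'(1)]]) simp
    ultimately show "\<exists>E\<in>D\<^sub>0. norm (step t \<tau> - p (t + \<tau>) - \<tau> ^ 3 *\<^sub>R A\<^sub>0 E) \<le> C' * \<tau> ^ 3 \<and>
        norm E \<le> C' \<and> norm (A\<^sub>0 E) \<le> C' / \<tau>"
      using E(1,3) C'(3) by (intro bexI[of _ E]) auto
  qed
  show ?thesis
    using step[unfolded step_eq_strang p_def] \<open>\<tau>\<^sub>1 > 0\<close>
    by (intro conjI impI exI[of _ C'] exI[of _ \<tau>\<^sub>1] allI) simp_all
qed

end
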